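(* Let $k\ge 7$ be a fixed integer. There exist constants $\eta>0$ and $\delta>0$, depending on $k$, such that for every odd prime $p$, with $q=p^k$, every integer $a$ with $(a,q)=1$, and every real $x>q^{\frac{3}{2}-\eta}$, $$\sum_{\substack{n\le x\\ n\equiv a \bmod q}} \tau(n) - \frac{1}{\phi(q)} \sum_{\substack{n\le x\\ (n,q)=1}} \tau(n) \ll \frac{x^{1-\delta}}{q},$$ where the implied constant depends on $k$.
   Context: Here $\tau(n)$ denotes the number of positive divisors of the positive integer $n$, $\phi$ is the Euler totient function, $(\cdot,\cdot)$ denotes the greatest common divisor, and the sums run over positive integers $n$. The notation $A\ll B$ means $|A|\le C B$ for some constant $C>0$ (the implied constant); here $C$ depends only on $k$, so that the bound is uniform in $p$, $a$ and $x$. *)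

theory Defs
  imports Complex_Main "HOL-Number_Theory.Number_Theory"
begin

definition divisor_count :: "nat \<Rightarrow> nat"
  where "divisor_count n = card {d. d dvd n}"

end

(* Opening \<tau>(n) and applying Dirichlet's hyperbola method reduces the theorem to boxes: for
   intervals I, J one compares #{(m,n) in I x J : mn = a mod q} with its expected value. Detecting
   the congruence by additive characters turns the discrepancy into incomplete Kloosterman sums
   sum_{m in I} e(b/m / q). Completing them gives short sums over u of complete sums S(u,b;q), and
   the trivial bound |S| <= 2 sqrt q is exactly the barrier x = q^(3/2).

   For q = p^k stationary phase evaluates S(u,b;q) as a combination of e(2r/q) and e(-2r/q) with
   r^2 = bu. Along u = u0 + pt the root r is a polynomial in t of degree k - 1 modulo q (binomial
   series of the square root) with t^(k-1)-coefficient exactly divisible by p^(k-1), so the phase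
   2r/q has leading coefficient c/p with p not dividing c. Weyl differencing over t-intervals of length
   p^(2/3) then saves a power of p. This needs u-intervals longer than p^(5/3), while the relevant
   length is about q^(1/4) = p^(k/4); hence k >= 7. Frequencies divisible by p reduce to the modulus
   p^(k-1), where square-root cancellation already saves p. *)
theory Submission
  imports Defs "HOL-Analysis.Analysis"
begin

section \<open>Additive characters\<close>

text \<open>The region m n \<le> x is not a union of boxes. It is cut into strips on which m varies
  by a factor 1 + \<Delta>, with \<Delta> a small negative power of x. To compare a strip with the
  boxes inside and around it, the lower bound -1/phi(q) for the centred weight is enough. The strips
  cost a small power of x, so each box must gain a power of q over q^(1/2), not just a logarithm.
  The frequency length q^(1/4) comes from m \<le> x^(1/2), about q^(3/4), completed modulo q. The
  exponent 5/3 is 1 + 2/3: p residue classes, each a Weyl sum with fixed cost p^(2/3). The value 2/3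
  lies between 1/2, below which the quadratic case saves nothing, and 3/4, beyond which k = 7 would
  be lost; it leaves the margin 1/4 - 5/21 = 1/84. All box estimates allow arbitrary side lengths,
  even beyond q, so large x needs no separate treatment. Primes p \<le> 2k, for which the
  coefficients of the square root series may fail to be units or even to exist modulo p, are
  finitely many and go into the constant.\<close>

definition ee :: "real \<Rightarrow> complex" where "ee x = cis (2 * pi * x)"

lemma ee_add: "ee (x + y) = ee x * ee y"
  by (simp add: ee_def cis_mult algebra_simps)

lemma ee_0 [simp]: "ee 0 = 1"
  by (simp add: ee_def)

lemma norm_ee [simp]: "cmod (ee x) = 1"
  by (simp add: ee_def)

lemma ee_minus: "ee (- x) = cnj (ee x)"
  by (simp add: ee_def cis_cnj)

lemma ee_diff: "ee (x - y) = ee x * cnj (ee y)"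
  using ee_add[of x "- y"] by (simp add: ee_minus)

lemma ee_of_int [simp]: "ee (of_int n) = 1"
  by (simp add: ee_def)

lemma ee_mult_nat: "ee (of_nat n * x) = ee x ^ n"
  unfolding ee_def by (subst Complex.DeMoivre) (simp only: mult_ac)

lemma norm_one_minus_ee: "cmod (1 - ee x) = 2 * \<bar>sin (pi * x)\<bar>"
proof -
  have "(cmod (1 - ee x))\<^sup>2 = (1 - cos (2 * (pi * x)))\<^sup>2 + (sin (2 * (pi * x)))\<^sup>2"
    by (simp add: ee_def cmod_power2 algebra_simps)
  also have "\<dots> = 2 - 2 * cos (2 * (pi * x))"
    using sin_cos_squared_add[of "2 * (pi * x)"] by (simp add: power2_eq_square algebra_simps)
  also have "\<dots> = (2 * \<bar>sin (pi * x)\<bar>)\<^sup>2"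
    unfolding cos_double_sin by (simp add: power2_eq_square algebra_simps)
  finally show ?thesis
    by (rule power2_eq_imp_eq) auto
qed

lemma norm_one_minus_ee_le: "cmod (1 - ee x) \<le> 2 * pi * \<bar>x\<bar>"
  using abs_sin_x_le_abs_x[of "pi * x"] by (simp add: norm_one_minus_ee abs_mult)

text \<open>Jordan's inequality: sine is concave on [0, pi], so on [0, pi/2] it lies above the chord
  joining the end points.\<close>

lemma norm_one_minus_ee_ge:
  assumes "0 \<le> x" "x \<le> 1 / 2"
  shows "cmod (1 - ee x) \<ge> 4 * x"
proof -
  have cc: "concave_on {0..pi} sin"
  proof (rule f''_le0_imp_concave[where f' = cos and f'' = "\<lambda>x. - sin x"])
    show "(cos has_real_derivative - sin x) (at x)" for x by (auto intro!: derivative_eq_intros)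
  qed (auto intro!: derivative_eq_intros sin_ge_zero)
  have "sin ((1 - 2 * x) *\<^sub>R 0 + (2 * x) *\<^sub>R (pi / 2)) \<ge> (1 - 2 * x) * sin 0 + 2 * x * sin (pi / 2)"
    by (rule concave_onD[OF cc]) (use assms in auto)
  then have "sin (pi * x) \<ge> 2 * x" by (simp add: mult.commute)
  then show ?thesis by (simp add: norm_one_minus_ee)
qed

definition ech :: "nat \<Rightarrow> int \<Rightarrow> complex" where "ech q n = ee (of_int n / of_nat q)"

lemma ech_add: "ech q (m + n) = ech q m * ech q n"
  by (simp add: ech_def add_divide_distrib ee_add)

lemma ech_0 [simp]: "ech q 0 = 1"
  by (simp add: ech_def)

lemma norm_ech [simp]: "cmod (ech q n) = 1"
  by (simp add: ech_def)

lemma ech_minus: "ech q (- n) = cnj (ech q n)"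
  by (simp add: ech_def ee_minus flip: minus_divide_left)

lemma ech_mult_nat: "ech q (int n * x) = ech q x ^ n"
  by (simp add: ech_def flip: ee_mult_nat)

lemma ech_cong:
  assumes "[m = n] (mod int q)"
  shows "ech q m = ech q n"
proof (cases "q = 0")
  case True
  then show ?thesis by (simp add: ech_def)
next
  case False
  obtain j where j: "m = n + int q * j"
    using cong_sym[OF assms] unfolding cong_iff_lin by blast
  have "real_of_int m / real q = real_of_int n / real q + of_int j"
    using False by (simp add: j field_simps)
  then show ?thesis by (simp only: ech_def ee_add) simp
qed

lemma ech_cong_0: "int q dvd n \<Longrightarrow> ech q n = 1"
  using ech_cong[of n 0 q] by (simp add: cong_0_iff)

lemma ech_scale: "d > 0 \<Longrightarrow> ech (d * q) (int d * n) = ech q n"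
  by (simp add: ech_def)

text \<open>The minimum is the distance from n to the nearest multiple of q. A residue beyond q/2 is
  reflected to q - r, which conjugates the character and keeps the modulus. The two extra
  conclusions make that distance positive, as is required before dividing by it.\<close>

lemma norm_one_minus_ech_ge:
  assumes "\<not> int q dvd n" "q > 0"
  shows "cmod (1 - ech q n) \<ge> 4 / real q * real_of_int (min (n mod int q) (int q - n mod int q))"
    and "n mod int q > 0" "n mod int q < int q"
proof -
  define r where "r = n mod int q"
  show r: "n mod int q > 0" "n mod int q < int q" using assms
    using pos_mod_bound[of "int q" n] pos_mod_sign[of "int q" n] by (auto simp: dvd_eq_mod_eq_0 le_less simp del: pos_mod_bound pos_mod_sign)
  have e: "ech q n = ech q r"
    by (rule ech_cong) (simp add: r_def Cong.cong_def)
  have r0: "0 < r" "r < int q" using r by (simp_all only: r_def)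
  have rq: "real_of_int r < real q" using r0(2) by linarith
  show "cmod (1 - ech q n) \<ge> 4 / real q * real_of_int (min (n mod int q) (int q - n mod int q))"
    unfolding e r_def[symmetric]
  proof (cases "2 * r \<le> int q")
    case True
    then have "2 * real_of_int r \<le> real q" by linarith
    then have "cmod (1 - ee (real_of_int r / real q)) \<ge> 4 * (real_of_int r / real q)"
      using r0 by (intro norm_one_minus_ee_ge) (auto simp: field_simps)
    moreover have "min r (int q - r) = r" using True by simp
    ultimately show "cmod (1 - ech q r) \<ge> 4 / real q * real_of_int (min r (int q - r))"
      by (simp add: ech_def)
  next
    case False
    then have "2 * (int q - r) \<le> int q" by simp
    then have "real_of_int (2 * (int q - r)) \<le> real_of_int (int q)" by (simp only: of_int_le_iff)
    then have "2 * real_of_int (int q - r) \<le> real q" by simp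
    then have "cmod (1 - ee (real_of_int (int q - r) / real q)) \<ge> 4 * (real_of_int (int q - r) / real q)"
      using r0 rq by (intro norm_one_minus_ee_ge) (auto simp: field_simps)
    moreover have "ech q (int q - r) = cnj (ech q r)"
      using ech_add[of q "int q" "- r"] ech_cong_0[of q "int q"] by (simp add: ech_minus)
    moreover have "cmod (1 - cnj (ech q r)) = cmod (1 - ech q r)"
      by (subst complex_mod_cnj[symmetric]) simp
    moreover have "min r (int q - r) = int q - r" using False by simp
    ultimately show "cmod (1 - ech q r) \<ge> 4 / real q * real_of_int (min r (int q - r))"
      unfolding ech_def[of q "int q - r"] by simp
  qed
qed

lemma ech_eq_1_iff:
  assumes "q > 0"
  shows "ech q n = 1 \<longleftrightarrow> int q dvd n"
proof
  assume 1: "ech q n = 1"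
  show "int q dvd n"
  proof (rule ccontr)
    assume nd: "\<not> int q dvd n"
    have "4 / real q * real_of_int (min (n mod int q) (int q - n mod int q)) > 0"
      using norm_one_minus_ech_ge(2,3)[OF nd assms] assms by (intro mult_pos_pos) auto
    then show False using norm_one_minus_ech_ge(1)[OF nd assms] 1 by simp
  qed
qed (rule ech_cong_0)

lemma norm_geometric_ech_le:
  assumes "z \<noteq> 1" "cmod z = 1"
  shows "cmod (\<Sum>j<N. z ^ j) \<le> 2 / cmod (1 - z)"
proof -
  have "(\<Sum>j<N. z ^ j) = (1 - z ^ N) / (1 - z)"
    using assms by (simp add: sum_gp_strict)
  moreover have "cmod (1 - z ^ N) \<le> 2"
    using norm_triangle_ineq4[of 1 "z ^ N"] assms by (simp add: norm_power)
  ultimately show ?thesis by (simp add: norm_divide divide_right_mono)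
qed

lemma sum_ech_orthogonal:
  assumes "q > 0"
  shows "(\<Sum>v<q. ech q (int v * n)) = (if int q dvd n then of_nat q else 0)"
proof (cases "int q dvd n")
  case True
  then show ?thesis by (simp add: ech_cong_0)
next
  case False
  have "(\<Sum>v<q. ech q (int v * n)) = (\<Sum>v<q. ech q n ^ v)"
    by (simp add: ech_mult_nat)
  also have "\<dots> = (1 - ech q n ^ q) / (1 - ech q n)"
    using False assms by (simp add: sum_gp_strict ech_eq_1_iff)
  also have "ech q n ^ q = 1"
    using ech_cong_0[of q "int q * n"] by (simp add: ech_mult_nat)
  finally show ?thesis using False by simp
qed

section \<open>Sums over complete residue systems\<close>

lemma sum_interval_int: "(\<Sum>j<n. f (int j)) = (\<Sum>m\<in>{0..<int n}. f m)"
  by (rule sum.reindex_bij_witness[of _ nat int]) auto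

text \<open>An injective map of a finite set into itself is a permutation. The substitutions m -> c
  m with a unit c, m -> z + m and m -> -m in complete sums all go through this form.\<close>

lemma sum_residues_reindex:
  fixes f :: "int \<Rightarrow> 'a :: comm_monoid_add"
  assumes "q > 0" and f: "\<And>m n. [m = n] (mod int q) \<Longrightarrow> f m = f n"
    and g: "\<And>m n. [g m = g n] (mod int q) \<Longrightarrow> [m = n] (mod int q)"
  shows "(\<Sum>m\<in>{0..<int q}. f (g m)) = (\<Sum>m\<in>{0..<int q}. f m)"
proof -
  let ?h = "\<lambda>m. g m mod int q"
  have inj: "inj_on ?h {0..<int q}"
  proof (rule inj_onI)
    fix x y assume *: "x \<in> {0..<int q}" "y \<in> {0..<int q}" "?h x = ?h y"
    have "[x = y] (mod int q)" by (rule g) (use * in \<open>simp add: Cong.cong_def\<close>)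
    then show "x = y" using * by (simp add: Cong.cong_def)
  qed
  have "?h ` {0..<int q} = {0..<int q}"
    by (rule endo_inj_surj) (use inj assms in auto)
  then have "(\<Sum>m\<in>{0..<int q}. f m) = (\<Sum>m\<in>{0..<int q}. f (?h m))"
    using sum.reindex[OF inj, of f] by simp
  also have "\<dots> = (\<Sum>m\<in>{0..<int q}. f (g m))"
    by (intro sum.cong refl f) (simp add: Cong.cong_def)
  finally show ?thesis by simp
qed

section \<open>Weyl sums with leading coefficient \<open>\<gamma> / p\<close>\<close>

text \<open>Weyl differencing as an exact identity: expand the square and collect the pairs at
  distance h, the opposite order giving conjugates. In the induction the new point
  \<open>z N\<close> adds exactly one term to each lag h = 1, ..., N.\<close>

lemma norm_sum_squared_correlations:
  fixes z :: "nat \<Rightarrow> complex"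
  shows "(cmod (\<Sum>j<N. z j))\<^sup>2 =
    (\<Sum>j<N. (cmod (z j))\<^sup>2) + 2 * Re (\<Sum>h\<in>{1..<N}. \<Sum>j<N - h. z (j + h) * cnj (z j))"
proof (induction N)
  case 0
  then show ?case by simp
next
  case (Suc N)
  let ?S = "\<Sum>j<N. z j"
  have 1: "(\<Sum>h\<in>{1..<Suc N}. \<Sum>j<Suc N - h. z (j + h) * cnj (z j))
    = (\<Sum>h\<in>{1..<Suc N}. (\<Sum>j<N - h. z (j + h) * cnj (z j)) + z N * cnj (z (N - h)))"
    by (intro sum.cong refl) (simp add: Suc_diff_le)
  have 2: "(\<Sum>h\<in>{1..<Suc N}. \<Sum>j<N - h. z (j + h) * cnj (z j))
    = (\<Sum>h\<in>{1..<N}. \<Sum>j<N - h. z (j + h) * cnj (z j))"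
    by (rule sum.mono_neutral_right) auto
  have 3: "(\<Sum>h\<in>{1..<Suc N}. z N * cnj (z (N - h))) = z N * cnj ?S"
    unfolding sum_distrib_left cnj_sum
    by (rule sum.reindex_bij_witness[of _ "\<lambda>j. N - j" "\<lambda>h. N - h"]) auto
  have "(cmod (?S + z N))\<^sup>2 = (cmod ?S)\<^sup>2 + (cmod (z N))\<^sup>2 + 2 * Re (z N * cnj ?S)"
    unfolding cmod_power2 by (simp add: power2_eq_square algebra_simps sum_negf)
  moreover have "(\<Sum>h\<in>{1..<Suc N}. \<Sum>j<Suc N - h. z (j + h) * cnj (z j))
    = (\<Sum>h\<in>{1..<N}. \<Sum>j<N - h. z (j + h) * cnj (z j)) + z N * cnj ?S"
    unfolding 1 sum.distrib 2 3 ..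
  ultimately show ?case
    unfolding sum.lessThan_Suc using Suc.IH by (simp only: plus_complex.simps distrib_left add_ac)
qed

lemma norm_sum_ee_squared_le:
  fixes f :: "nat \<Rightarrow> real"
  shows "(cmod (\<Sum>j<N. ee (f j)))\<^sup>2 \<le>
    real N + 2 * (\<Sum>h\<in>{1..<N}. cmod (\<Sum>j<N - h. ee (f (j + h) - f j)))"
proof -
  have "Re (\<Sum>h\<in>{1..<N}. \<Sum>j<N - h. ee (f (j + h)) * cnj (ee (f j)))
      \<le> (\<Sum>h\<in>{1..<N}. cmod (\<Sum>j<N - h. ee (f (j + h) - f j)))"
    unfolding ee_diff by (rule order_trans[OF complex_Re_le_cmod norm_sum])
  then show ?thesis
    unfolding norm_sum_squared_correlations by simp
qed

lemma sum_lessThan_split: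
  fixes g :: "nat \<Rightarrow> 'a :: comm_monoid_add"
  shows "(\<Sum>j<m + n. g j) = (\<Sum>j<m. g j) + (\<Sum>j<n. g (m + j))"
  by (induction n) (simp_all add: add.assoc)

section \<open>Harmonic sums and reciprocal distances to multiples of q\<close>

lemma harm_le_one_plus_ln: "n > 0 \<Longrightarrow> (\<Sum>i\<in>{1..n}. 1 / real i) \<le> 1 + ln (real n)"
proof (induction n rule: nat_induct_non_zero)
  case 1
  then show ?case by simp
next
  case (Suc n)
  have "ln (real n / real (Suc n)) \<le> real n / real (Suc n) - 1"
    using Suc by (intro ln_le_minus_one) simp
  then have "1 / real (Suc n) \<le> ln (real (Suc n)) - ln (real n)"
    using Suc by (simp add: ln_div field_simps)
  then show ?case using Suc by simp
qed

text \<open>The smaller of r and q - r is one of the two, so its reciprocal is at most the sum of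
  both reciprocals; the reflection r -> q - r identifies the two resulting harmonic sums.\<close>

lemma sum_inverse_min_residue_le:
  assumes "q > 1"
  shows "(\<Sum>r\<in>{1..<int q}. 1 / real_of_int (min r (int q - r))) \<le> 2 * (1 + ln (real q))"
proof -
  have "(\<Sum>r\<in>{1..<int q}. 1 / real_of_int (min r (int q - r)))
      \<le> (\<Sum>r\<in>{1..<int q}. 1 / real_of_int r + 1 / real_of_int (int q - r))"
    by (intro sum_mono) (auto simp: min_def)
  also have "\<dots> = (\<Sum>r\<in>{1..<int q}. 1 / real_of_int r) + (\<Sum>r\<in>{1..<int q}. 1 / real_of_int (int q - r))"
    by (rule sum.distrib)
  also have "(\<Sum>r\<in>{1..<int q}. 1 / real_of_int (int q - r)) = (\<Sum>r\<in>{1..<int q}. 1 / real_of_int r)"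
    by (rule sum.reindex_bij_witness[of _ "\<lambda>r. int q - r" "\<lambda>r. int q - r"]) auto
  also have "(\<Sum>r\<in>{1..<int q}. 1 / real_of_int r) = (\<Sum>i\<in>{1..q - 1}. 1 / real i)"
    by (rule sum.reindex_bij_witness[of _ int nat]) auto
  also have "\<dots> \<le> 1 + ln (real (q - 1))"
    using assms by (intro harm_le_one_plus_ln) simp
  also have "\<dots> \<le> 1 + ln (real q)"
    using assms by simp
  finally show ?thesis by simp
qed

lemma prime_multiples_distinct:
  fixes p :: nat and c :: int
  assumes "prime p" "\<not> int p dvd c"
  shows "inj_on (\<lambda>h. (c * int h) mod int p) {..<p}"
proof (rule inj_onI)
  fix x y assume *: "x \<in> {..<p}" "y \<in> {..<p}" "c * int x mod int p = c * int y mod int p"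
  have "coprime c (int p)"
    using assms prime_imp_coprime[of "int p" c] by (simp add: coprime_commute)
  then have "[int x = int y] (mod int p)"
    using *(3) by (simp add: Cong.cong_def[symmetric] cong_mult_lcancel)
  then show "x = y" using * by (simp add: Cong.cong_def)
qed

text \<open>Differencing a quadratic phase leaves a geometric series of ratio e(2 \<gamma> h / p);
  a0, a1 and X enter only through a factor of modulus one. For 0 < h < N \<le> p the residues 2
  \<gamma> h are nonzero and distinct modulo p, so the geometric bounds add up to at most p (1 + log
  p).\<close>

lemma quadratic_ee_sum_bound:
  assumes p: "prime p" "p > 2" and \<gamma>: "\<not> int p dvd \<gamma>" and N: "N \<le> p"
  shows "(cmod (\<Sum>j<N. ee (a0 + a1 * (X + real j) + real_of_int \<gamma> / real p * (X + real j)\<^sup>2)))\<^sup>2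
    \<le> 3 * real p * (1 + ln (real p))"
proof -
  define f where "f j = a0 + a1 * (X + real j) + real_of_int \<gamma> / real p * (X + real j)\<^sup>2" for j :: nat
  have p2: "\<not> int p dvd 2 * \<gamma>"
    using p \<gamma> zdvd_imp_le[of "int p" 2] prime_dvd_mult_iff[of "int p" 2 \<gamma>] by auto
  have lp: "ln (real p) \<ge> 0" using p by simp
  define r where "r h = (2 * \<gamma> * int h) mod int p" for h :: nat
  have each: "cmod (\<Sum>j<N - h. ee (f (j + h) - f j)) \<le> real p / 2 * (1 / real_of_int (min (r h) (int p - r h)))"
    and rh: "r h \<in> {1..<int p}"
    if h: "h \<in> {1..<N}" for h
  proof -
    define c where "c = a1 * real h + real_of_int \<gamma> / real p * (real h)\<^sup>2 + 2 * real_of_int \<gamma> / real p * real h * X"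
    have "f (j + h) - f j = c + real j * (real_of_int (2 * \<gamma> * int h) / real p)" for j
      using p by (simp add: f_def c_def field_simps power2_eq_square)
    then have "ee (f (j + h) - f j) = ee c * ech p (2 * \<gamma> * int h) ^ j" for j
      by (simp only: ee_add ee_mult_nat ech_def)
    then have *: "cmod (\<Sum>j<N - h. ee (f (j + h) - f j)) = cmod (\<Sum>j<N - h. ech p (2 * \<gamma> * int h) ^ j)"
      by (simp add: norm_mult flip: sum_distrib_left)
    have "\<not> p dvd h" using h N by (auto dest: dvd_imp_le)
    then have nd: "\<not> int p dvd 2 * \<gamma> * int h"
      using p2 p by (simp add: prime_dvd_mult_iff)
    note g = norm_one_minus_ech_ge[OF nd, folded r_def]
    have p0: "p > 0" using p by simp
    show "r h \<in> {1..<int p}" using g(2,3)[OF p0] by auto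
    have pos: "real_of_int (min (r h) (int p - r h)) > 0" using g(2,3)[OF p0] by auto
    have "ech p (2 * \<gamma> * int h) \<noteq> 1" using nd p0 by (simp add: ech_eq_1_iff)
    then have "cmod (\<Sum>j<N - h. ech p (2 * \<gamma> * int h) ^ j) \<le> 2 / cmod (1 - ech p (2 * \<gamma> * int h))"
      by (intro norm_geometric_ech_le) auto
    also have "\<dots> \<le> 2 / (4 / real p * real_of_int (min (r h) (int p - r h)))"
    proof (intro divide_left_mono mult_pos_pos)
      show "0 < cmod (1 - ech p (2 * \<gamma> * int h))"
        by (rule less_le_trans[OF _ g(1)[OF p0]]) (use pos p0 in \<open>simp add: field_simps\<close>)
    qed (use g(1)[OF p0] pos p0 in auto)
    also have "\<dots> = real p / 2 * (1 / real_of_int (min (r h) (int p - r h)))"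
      by simp
    finally show "cmod (\<Sum>j<N - h. ee (f (j + h) - f j)) \<le> real p / 2 * (1 / real_of_int (min (r h) (int p - r h)))"
      by (simp only: *)
  qed
  have inj: "inj_on r {1..<N}"
    unfolding r_def by (rule inj_on_subset[OF prime_multiples_distinct[OF p(1) p2]]) (use N in auto)
  have "(\<Sum>h\<in>{1..<N}. cmod (\<Sum>j<N - h. ee (f (j + h) - f j)))
      \<le> (\<Sum>h\<in>{1..<N}. real p / 2 * (1 / real_of_int (min (r h) (int p - r h))))"
    by (intro sum_mono each)
  also have "\<dots> = real p / 2 * (\<Sum>r\<in>r ` {1..<N}. 1 / real_of_int (min r (int p - r)))"
    unfolding sum.reindex[OF inj] sum_distrib_left by simp
  also have "\<dots> \<le> real p / 2 * (\<Sum>r\<in>{1..<int p}. 1 / real_of_int (min r (int p - r)))"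
    using rh by (intro mult_left_mono sum_mono2) auto
  also have "\<dots> \<le> real p / 2 * (2 * (1 + ln (real p)))"
    using p by (intro mult_left_mono sum_inverse_min_residue_le) auto
  also have "\<dots> = real p * (1 + ln (real p))"
    by simp
  finally have "(\<Sum>h\<in>{1..<N}. cmod (\<Sum>j<N - h. ee (f (j + h) - f j))) \<le> real p * (1 + ln (real p))" .
  moreover have "real N \<le> real p * (1 + ln (real p))"
    using mult_mono[of "real N" "real p" 1 "1 + ln (real p)"] N lp by simp
  ultimately show ?thesis
    using norm_sum_ee_squared_le[of f N] unfolding f_def by simp
qed

text \<open>One differencing lowers the degree by one and multiplies the leading coefficient by (d +
  1) h. This factor is prime to p as long as d + 1 and h are positive and below p, so a leading
  coefficient of the form \<gamma>/p keeps its shape down to degree two.\<close>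

lemma poly_phase_difference:
  fixes a :: "nat \<Rightarrow> real" and h :: real
  obtains b where "\<And>x. (\<Sum>i\<le>Suc d. a i * (x + h) ^ i) - (\<Sum>i\<le>Suc d. a i * x ^ i) = (\<Sum>i\<le>d. b i * x ^ i)"
    and "b d = real (Suc d) * h * a (Suc d)"
proof -
  define b where "b l = (\<Sum>i\<in>{l<..Suc d}. a i * real (i choose l) * h ^ (i - l))" for l
  have "(\<Sum>i\<le>Suc d. a i * (x + h) ^ i) - (\<Sum>i\<le>Suc d. a i * x ^ i) = (\<Sum>i\<le>d. b i * x ^ i)" for x
  proof -
    have pw: "(x + h) ^ i - x ^ i = (\<Sum>l<i. real (i choose l) * x ^ l * h ^ (i - l))" for i
      by (simp add: binomial_ring flip: lessThan_Suc_atMost)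
    have "(\<Sum>i\<le>Suc d. a i * (x + h) ^ i) - (\<Sum>i\<le>Suc d. a i * x ^ i)
      = (\<Sum>i\<le>Suc d. a i * ((x + h) ^ i - x ^ i))"
      by (simp only: sum_subtractf right_diff_distrib)
    also have "\<dots> = (\<Sum>i\<le>Suc d. \<Sum>l<i. a i * real (i choose l) * h ^ (i - l) * x ^ l)"
      by (simp only: pw sum_distrib_left mult_ac)
    also have "\<dots> = (\<Sum>l\<le>d. \<Sum>i\<in>{l<..Suc d}. a i * real (i choose l) * h ^ (i - l) * x ^ l)"
      by (subst sum.Sigma, simp, simp, subst sum.Sigma, simp, simp)
        (rule sum.reindex_bij_witness[of _ "\<lambda>(x,y). (y,x)" "\<lambda>(x,y). (y,x)"], auto)
    also have "\<dots> = (\<Sum>i\<le>d. b i * x ^ i)"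
      by (simp only: b_def sum_distrib_right)
    finally show ?thesis .
  qed
  moreover have "b d = real (Suc d) * h * a (Suc d)"
  proof -
    have "{d<..Suc d} = {Suc d}" by auto
    then show ?thesis by (simp add: b_def)
  qed
  ultimately show ?thesis using that by blast
qed

lemma one_plus_ln_le_powr:
  fixes x \<epsilon> :: real
  assumes "x \<ge> 1" "\<epsilon> > 0" "\<epsilon> \<le> 1"
  shows "1 + ln x \<le> 2 / \<epsilon> * x powr \<epsilon>"
proof -
  have "ln x \<le> x powr \<epsilon> / \<epsilon>"
    using assms by (intro ln_powr_bound) auto
  moreover have "1 \<le> x powr \<epsilon>"
    using assms by (intro ge_one_powr_ge_zero) auto
  then have "1 \<le> x powr \<epsilon> / \<epsilon>"
    using assms by (simp add: field_simps)
  ultimately show ?thesis by simp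
qed

text \<open>Induction on the degree d + 2: a saving p^(-\<delta>) in the differenced sums bounds
  |S|^2 by a multiple of p^(2/3) p^(2/3 - \<delta>), so S saves p^(-\<delta>/2). The length p^(2/3)
  is large enough for the quadratic bound to beat the trivial one, and below p, so that no lag h is
  divisible by p. The real shift X is left free for the later dissection into blocks.\<close>

lemma weyl_short:
  "\<exists>C>0. \<exists>\<delta>>0. \<delta> \<le> 1 / 9 \<and> (\<forall>p \<gamma> a X N. prime (p::nat) \<longrightarrow> p > d + 2 \<longrightarrow> \<not> int p dvd \<gamma> \<longrightarrow>
     a (d + 2) = real_of_int \<gamma> / real p \<longrightarrow> real N \<le> real p powr (2/3) \<longrightarrow>
     cmod (\<Sum>j<N. ee (\<Sum>i\<le>d + 2. a i * (X + real j) ^ i)) \<le> C * real p powr (2/3 - \<delta>))"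
proof (induction d)
  case 0
  \<comment> \<open>54 = 3 * 18, where 18 = 2/(1/9) is the price of replacing 1 + ln p by p^(1/9).
    The exponent is (1 + 1/9)/2 = 2/3 - 1/9.\<close>
  have "cmod (\<Sum>j<N. ee (\<Sum>i\<le>0 + 2. a i * (X + real j) ^ i)) \<le> sqrt 54 * real p powr (2/3 - 1/9)"
    if p: "prime (p::nat)" "p > 0 + 2" and \<gamma>: "\<not> int p dvd \<gamma>" "a (0 + 2) = real_of_int \<gamma> / real p"
      and N: "real N \<le> real p powr (2/3)" for p \<gamma> a X N
  proof -
    have "real p powr (2/3) \<le> real p powr 1"
      using p by (intro powr_mono) auto
    then have Np: "N \<le> p" using N by simp
    have e: "(\<Sum>i\<le>0 + 2. a i * (X + real j) ^ i)
        = a 0 + a 1 * (X + real j) + real_of_int \<gamma> / real p * (X + real j)\<^sup>2" for j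
      using \<gamma>(2) by (simp add: numeral_2_eq_2)
    have "(cmod (\<Sum>j<N. ee (\<Sum>i\<le>0 + 2. a i * (X + real j) ^ i)))\<^sup>2 \<le> 3 * real p * (1 + ln (real p))"
      unfolding e using quadratic_ee_sum_bound[OF p(1) _ \<gamma>(1) Np] p(2) by simp
    also have "\<dots> \<le> 3 * real p * (2 / (1/9) * real p powr (1/9))"
      using p by (intro mult_left_mono one_plus_ln_le_powr) auto
    also have "\<dots> = 54 * (real p powr 1 * real p powr (1/9))"
      using p by simp
    also have "\<dots> = 54 * (real p powr (2/3 - 1/9) * real p powr (2/3 - 1/9))"
      unfolding powr_add[symmetric] by simp
    also have "\<dots> = (sqrt 54 * real p powr (2/3 - 1/9))\<^sup>2"
      by (simp add: power_mult_distrib power2_eq_square)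
    finally show ?thesis
      by (rule power2_le_imp_le) simp
  qed
  then show ?case
    by (intro exI[of _ "sqrt 54"] exI[of _ "1/9::real"] conjI allI impI) (assumption | simp)+
next
  case (Suc d)
  then obtain C \<delta> where C: "C > 0" and \<delta>: "\<delta> > 0" "\<delta> \<le> 1/9" and
    IH: "\<And>p \<gamma> a X N. prime (p::nat) \<Longrightarrow> p > d + 2 \<Longrightarrow> \<not> int p dvd \<gamma> \<Longrightarrow>
     a (d + 2) = real_of_int \<gamma> / real p \<Longrightarrow> real N \<le> real p powr (2/3) \<Longrightarrow>
     cmod (\<Sum>j<N. ee (\<Sum>i\<le>d + 2. a i * (X + real j) ^ i)) \<le> C * real p powr (2/3 - \<delta>)"
    by blast
  have "cmod (\<Sum>j<N. ee (\<Sum>i\<le>Suc d + 2. a i * (X + real j) ^ i)) \<le> sqrt (1 + 2 * C) * real p powr (2/3 - \<delta> / 2)"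
    if p: "prime (p::nat)" "p > Suc d + 2" and \<gamma>: "\<not> int p dvd \<gamma>" "a (Suc d + 2) = real_of_int \<gamma> / real p"
      and N: "real N \<le> real p powr (2/3)" for p \<gamma> a X N
  proof -
    have "real p powr (2/3) \<le> real p powr 1"
      using p by (intro powr_mono) auto
    then have Np: "N \<le> p" using N by simp
    define f where "f j = (\<Sum>i\<le>Suc d + 2. a i * (X + real j) ^ i)" for j :: nat
    have each: "cmod (\<Sum>j<N - h. ee (f (j + h) - f j)) \<le> C * real p powr (2/3 - \<delta>)"
      if h: "h \<in> {1..<N}" for h
    proof -
      obtain b where b: "\<And>x. (\<Sum>i\<le>Suc (d + 2). a i * (x + real h) ^ i) - (\<Sum>i\<le>Suc (d + 2). a i * x ^ i) = (\<Sum>i\<le>d + 2. b i * x ^ i)"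
        and bd: "b (d + 2) = real (Suc (d + 2)) * real h * a (Suc (d + 2))"
        using poly_phase_difference[where d = "d + 2" and a = a and h = "real h"] by blast
      have eq: "f (j + h) - f j = (\<Sum>i\<le>d + 2. b i * (X + real j) ^ i)" for j
        using b[of "X + real j"] by (simp add: f_def add.assoc)
      have "\<not> p dvd Suc (d + 2)" "\<not> p dvd h"
        using p h Np by (auto dest!: dvd_imp_le)
      then have "\<not> int p dvd int (Suc (d + 2)) * int h * \<gamma>"
        using p \<gamma> by (simp add: prime_dvd_mult_iff del: of_nat_Suc)
      moreover have "b (d + 2) = real_of_int (int (Suc (d + 2)) * int h * \<gamma>) / real p"
        using bd \<gamma>(2) by simp
      moreover have "real (N - h) \<le> real p powr (2/3)" using N by linarith
      ultimately show ?thesis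
        unfolding eq using p by (intro IH[of p "int (Suc (d + 2)) * int h * \<gamma>"]) auto
    qed
    have "(cmod (\<Sum>j<N. ee (f j)))\<^sup>2 \<le> real N + 2 * (\<Sum>h\<in>{1..<N}. cmod (\<Sum>j<N - h. ee (f (j + h) - f j)))"
      by (rule norm_sum_ee_squared_le)
    also have "\<dots> \<le> real N + 2 * (\<Sum>h\<in>{1..<N}. C * real p powr (2/3 - \<delta>))"
      by (intro add_left_mono mult_left_mono sum_mono each) auto
    also have "\<dots> \<le> real p powr (2/3) + 2 * (real p powr (2/3) * (C * real p powr (2/3 - \<delta>)))"
      using N C by (intro add_mono mult_left_mono) (auto intro!: mult_right_mono)
    \<comment> \<open>The diagonal term is absorbed into the size of the off-diagonal ones; \<delta>
      \<le> 1/9 leaves ample room for this.\<close>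
    also have "\<dots> \<le> real p powr (2/3 + (2/3 - \<delta>)) + 2 * (real p powr (2/3) * (C * real p powr (2/3 - \<delta>)))"
      using p \<delta> by (intro add_right_mono powr_mono) auto
    also have "\<dots> = (1 + 2 * C) * (real p powr (2/3 - \<delta> / 2) * real p powr (2/3 - \<delta> / 2))"
      by (simp add: algebra_simps flip: powr_add)
    also have "\<dots> = (sqrt (1 + 2 * C) * real p powr (2/3 - \<delta> / 2))\<^sup>2"
      using C by (simp add: power_mult_distrib power2_eq_square)
    finally show ?thesis
      unfolding f_def by (rule power2_le_imp_le) (use C in simp)
  qed
  then show ?case
    using C \<delta> by (intro exI[of _ "sqrt (1 + 2 * C)"] exI[of _ "\<delta> / 2"] conjI allI impI) (assumption | simp)+
qed

text \<open>The range is cut into blocks whose length is the floor of p^(2/3). A block is a short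
  sum with another X, because translating the variable leaves the coefficients \<open>a\<close>
  alone. The last, incomplete block accounts for the summand p^(2/3).\<close>

lemma weyl_long:
  "\<exists>C>0. \<exists>\<delta>>0. \<delta> \<le> 1 / 9 \<and> (\<forall>p \<gamma> a X N. prime (p::nat) \<longrightarrow> p > d + 2 \<longrightarrow> \<not> int p dvd \<gamma> \<longrightarrow>
     a (d + 2) = real_of_int \<gamma> / real p \<longrightarrow>
     cmod (\<Sum>j<N. ee (\<Sum>i\<le>d + 2. a i * (X + real j) ^ i)) \<le> C * (real N + real p powr (2/3)) * real p powr (- \<delta>))"
proof -
  obtain C \<delta> where C: "C > 0" and \<delta>: "\<delta> > 0" "\<delta> \<le> 1/9" and
    short: "\<And>p \<gamma> a X N. prime (p::nat) \<Longrightarrow> p > d + 2 \<Longrightarrow> \<not> int p dvd \<gamma> \<Longrightarrow>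
     a (d + 2) = real_of_int \<gamma> / real p \<Longrightarrow> real N \<le> real p powr (2/3) \<Longrightarrow>
     cmod (\<Sum>j<N. ee (\<Sum>i\<le>d + 2. a i * (X + real j) ^ i)) \<le> C * real p powr (2/3 - \<delta>)"
    using weyl_short[of d] by blast
  have "cmod (\<Sum>j<N. ee (\<Sum>i\<le>d + 2. a i * (X + real j) ^ i)) \<le> (2 * C) * (real N + real p powr (2/3)) * real p powr (- \<delta>)"
    if p: "prime (p::nat)" "p > d + 2" and \<gamma>: "\<not> int p dvd \<gamma>" "a (d + 2) = real_of_int \<gamma> / real p" for p \<gamma> a X N
  proof -
    define P where "P = real p powr (2/3)"
    define T where "T = nat \<lfloor>P\<rfloor>"
    have P1: "P \<ge> 1" using p by (auto simp: P_def intro!: ge_one_powr_ge_zero)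
    have "real T = of_int \<lfloor>P\<rfloor>" "\<lfloor>P\<rfloor> \<ge> 1" "real T \<ge> 1" using P1 by (auto simp: T_def le_nat_iff)
    then have T: "T > 0" "real T \<le> P" "P \<le> 2 * real T"
      by linarith+
    define W where "W = C * real p powr (2/3 - \<delta>)"
    have W0: "W \<ge> 0" using C by (simp add: W_def)
    have "cmod (\<Sum>j<N. ee (\<Sum>i\<le>d + 2. a i * (X + real j) ^ i)) \<le> (real N / real T + 1) * W"
    proof (induction N arbitrary: X rule: less_induct)
      case (less N)
      show ?case
      proof (cases "N \<le> T")
        case True
        then have "cmod (\<Sum>j<N. ee (\<Sum>i\<le>d + 2. a i * (X + real j) ^ i)) \<le> 1 * W"
          unfolding W_def mult_1 using T by (intro short[where p = p and \<gamma> = \<gamma> and a = a, OF p \<gamma>]) (simp add: P_def)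
        also have "\<dots> \<le> (real N / real T + 1) * W"
          using W0 by (intro mult_right_mono) auto
        finally show ?thesis .
      next
        case False
        define M where "M = N - T"
        have N: "N = T + M" "M < N" using False T by (auto simp: M_def)
        let ?g = "\<lambda>X j. ee (\<Sum>i\<le>d + 2. a i * (X + real j) ^ i)"
        have "(\<Sum>j<N. ?g X j) = (\<Sum>j<T. ?g X j) + (\<Sum>j<M. ?g X (T + j))"
          unfolding N(1) by (rule sum_lessThan_split)
        also have "(\<Sum>j<M. ?g X (T + j)) = (\<Sum>j<M. ?g (X + real T) j)"
          by (simp add: add.assoc)
        finally have "cmod (\<Sum>j<N. ?g X j) \<le> cmod (\<Sum>j<T. ?g X j) + cmod (\<Sum>j<M. ?g (X + real T) j)"
          by (simp add: norm_triangle_ineq)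
        also have "\<dots> \<le> W + (real M / real T + 1) * W"
          unfolding W_def by (intro add_mono less.IH[OF N(2), unfolded W_def] short[where p = p and \<gamma> = \<gamma> and a = a, OF p \<gamma>]) (use T in \<open>simp add: P_def\<close>)
        also have "\<dots> = (real N / real T + 1) * W"
          using T by (simp add: N(1) field_simps)
        finally show ?thesis .
      qed
    qed
    also have "real N / real T \<le> real N / (P / 2)"
      using T P1 by (intro divide_left_mono) auto
    then have "(real N / real T + 1) * W \<le> (real N / (P / 2) + 1) * W"
      using W0 by (intro mult_right_mono) auto
    also have "\<dots> = (2 * real N + P) * (W / P)"
      using P1 by (simp add: field_simps)
    also have "real p powr (2/3 - \<delta>) = P * real p powr (- \<delta>)"
      by (simp add: P_def flip: powr_add)
    then have "W / P = C * real p powr (- \<delta>)"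
      using P1 by (simp add: W_def)
    also have "(2 * real N + P) * (C * real p powr (- \<delta>)) \<le> (2 * real N + 2 * P) * (C * real p powr (- \<delta>))"
      using C P1 by (intro mult_right_mono) auto
    finally show ?thesis unfolding P_def by (simp add: algebra_simps)
  qed
  then show ?thesis using C \<delta> by (intro exI[of _ "2 * C"] exI[of _ \<delta>] conjI allI impI) (assumption | simp)+
qed

section \<open>Kloosterman sums modulo prime powers\<close>

lemma modular_inverse_unique:
  fixes m q x :: int
  assumes "[m * x = 1] (mod q)"
  shows "[modular_inverse q m = x] (mod q)"
proof -
  have "coprime m q"
    using assms by (metis cong_imp_coprime cong_sym coprime_1_left coprime_mult_left_iff)
  then have "[m * modular_inverse q m = m * x] (mod q)"
    using cong_modular_inverse1 assms cong_sym cong_trans by blast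
  then show ?thesis
    using \<open>coprime m q\<close> by (simp add: cong_mult_lcancel)
qed

lemma modular_inverse_cong:
  fixes m n q :: int
  assumes "[m = n] (mod q)" "coprime m q"
  shows "[modular_inverse q m = modular_inverse q n] (mod q)"
proof (rule modular_inverse_unique)
  have "coprime n q" using assms cong_imp_coprime by blast
  then have "[n * modular_inverse q n = 1] (mod q)" by (rule cong_modular_inverse1)
  then show "[m * modular_inverse q n = 1] (mod q)"
    using assms(1) by (meson cong_scalar_right cong_trans)
qed

text \<open>The summand e((u m + b/m)/q) of S(u,b;q), extended by 0 to non-units so that it becomes
  a function on all residues and can be summed over arbitrary intervals.\<close>

definition kl_term :: "nat \<Rightarrow> int \<Rightarrow> int \<Rightarrow> int \<Rightarrow> complex" where
  "kl_term q u b m = (if coprime m (int q) then ech q (u * m + b * modular_inverse (int q) m) else 0)"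

definition kl :: "nat \<Rightarrow> int \<Rightarrow> int \<Rightarrow> complex" where
  "kl q u b = (\<Sum>m\<in>{0..<int q}. kl_term q u b m)"

lemma kl_term_cong:
  assumes "[m = n] (mod int q)"
  shows "kl_term q u b m = kl_term q u b n"
proof -
  have "coprime m (int q) \<longleftrightarrow> coprime n (int q)"
    using assms cong_imp_coprime cong_sym by blast
  moreover have "ech q (u * m + b * modular_inverse (int q) m) = ech q (u * n + b * modular_inverse (int q) n)"
    if "coprime m (int q)"
    using assms that by (intro ech_cong cong_add cong_scalar_left modular_inverse_cong)
  ultimately show ?thesis by (simp add: kl_term_def)
qed

lemma kl_term_eqI:
  assumes "coprime m (int q)" "[m * x = 1] (mod int q)" "[u * m + b * x = n] (mod int q)"
  shows "kl_term q u b m = ech q n"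
proof -
  have "[u * m + b * modular_inverse (int q) m = u * m + b * x] (mod int q)"
    using modular_inverse_unique[OF assms(2)] by (intro cong_add cong_scalar_left cong_refl)
  then have "ech q (u * m + b * modular_inverse (int q) m) = ech q n"
    using assms(3) by (intro ech_cong) (rule cong_trans)
  then show ?thesis using assms(1) by (simp add: kl_term_def)
qed

text \<open>Averaging over the substitutions \<open>m \<mapsto> m (1 + p\<^sup>\<sigma> y)\<close> isolates the stationary points.\<close>

lemma kl_localise:
  fixes p :: nat
  assumes p: "p > 0" and "\<sigma> + \<tau> = k" "\<tau> \<le> \<sigma>" "\<sigma> > 0"
  shows "kl (p ^ k) u b = (\<Sum>m\<in>{0..<int (p ^ k)}.
    if [u * m = b * modular_inverse (int (p ^ k)) m] (mod int (p ^ \<tau>)) then kl_term (p ^ k) u b m else 0)"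
proof -
  define q where "q = p ^ k"
  define R where "R = p ^ \<tau>"
  define s where "s = int (p ^ \<sigma>)"
  have q: "int q = s * int R" "q > 0" "R > 0"
    using assms by (auto simp: q_def R_def s_def simp flip: power_add)
  \<comment> \<open>Since 2 \<sigma> \<ge> k, the increment s = p^\<sigma> squares to 0 modulo q. So
    1 + s y is a unit with inverse 1 - s y, and the substitution changes the phase linearly in
    y.\<close>
  have "int q dvd s * s"
    unfolding q_def s_def using assms by (simp flip: power_add add: le_imp_power_dvd)
  then have ss: "[1 - s * s * (y * y) = 1] (mod int q)" for y
    by (simp add: cong_iff_dvd_diff)
  let ?c = "\<lambda>m. u * m - b * modular_inverse (int q) m"
  have shift: "kl_term q u b (m * (1 + s * y)) = kl_term q u b m * ech R (y * ?c m)" for m y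
  proof -
    have "[(1 + s * y) * (1 - s * y) = 1] (mod int q)"
      using ss[of y] by (simp add: algebra_simps)
    then have cy: "coprime (1 + s * y) (int q)"
      by (metis cong_imp_coprime cong_sym coprime_1_left coprime_mult_left_iff)
    show ?thesis
    proof (cases "coprime m (int q)")
      case False
      then show ?thesis by (simp add: kl_term_def)
    next
      case True
      let ?x = "modular_inverse (int q) m"
      have "[m * (1 + s * y) * (?x * (1 - s * y)) = (m * ?x) * ((1 + s * y) * (1 - s * y))] (mod int q)"
        by (simp add: mult_ac)
      also have "[(m * ?x) * ((1 + s * y) * (1 - s * y)) = 1 * 1] (mod int q)"
        using True ss[of y] by (intro cong_mult cong_modular_inverse1) (simp_all add: algebra_simps)
      finally have "kl_term q u b (m * (1 + s * y)) =
        ech q (u * (m * (1 + s * y)) + b * (?x * (1 - s * y)))"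
        using True cy by (intro kl_term_eqI) auto
      also have "u * (m * (1 + s * y)) + b * (?x * (1 - s * y)) = (u * m + b * ?x) + s * (y * ?c m)"
        by (simp add: algebra_simps)
      also have "ech q \<dots> = ech q (u * m + b * ?x) * ech (p ^ \<sigma> * R) (s * (y * ?c m))"
        using assms by (simp add: ech_add q_def R_def power_add flip: assms(2))
      also have "ech (p ^ \<sigma> * R) (s * (y * ?c m)) = ech R (y * ?c m)"
        unfolding s_def using p by (intro ech_scale) auto
      finally show ?thesis using True by (simp add: kl_term_def)
    qed
  qed
  have each: "kl q u b = (\<Sum>m\<in>{0..<int q}. kl_term q u b m * ech R (y * ?c m))" for y
  proof -
    have "[(1 + s * y) * (1 - s * y) = 1] (mod int q)"
      using ss[of y] by (simp add: algebra_simps)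
    then have cy: "coprime (1 + s * y) (int q)"
      by (metis cong_imp_coprime cong_sym coprime_1_left coprime_mult_left_iff)
    show ?thesis
      unfolding kl_def shift[symmetric]
      by (rule sum_residues_reindex[symmetric, where f = "kl_term q u b"])
        (use q cy in \<open>auto intro: kl_term_cong simp: cong_mult_rcancel\<close>)
  qed
  \<comment> \<open>All R substitutions give the same sum. Averaging over them is orthogonality
    modulo R = p^\<tau>, which keeps exactly the m with u m = b/m modulo R.\<close>
  have "of_nat R * kl q u b = (\<Sum>y<R. kl q u b)" by simp
  also have "\<dots> = (\<Sum>y<R. \<Sum>m\<in>{0..<int q}. kl_term q u b m * ech R (int y * ?c m))"
    by (intro sum.cong refl each)
  also have "\<dots> = (\<Sum>m\<in>{0..<int q}. kl_term q u b m * (\<Sum>y<R. ech R (int y * ?c m)))"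
    by (subst sum.swap) (simp only: sum_distrib_left)
  also have "\<dots> = (\<Sum>m\<in>{0..<int q}. of_nat R *
      (if [u * m = b * modular_inverse (int q) m] (mod int R) then kl_term q u b m else 0))"
    using q by (intro sum.cong refl) (simp add: sum_ech_orthogonal cong_iff_dvd_diff)
  finally have "of_nat R * kl q u b = of_nat R * (\<Sum>m\<in>{0..<int q}.
      (if [u * m = b * modular_inverse (int q) m] (mod int R) then kl_term q u b m else 0))"
    by (simp only: sum_distrib_left)
  then show ?thesis
    unfolding q_def[symmetric] R_def[symmetric] using q by (simp only: mult_cancel_left of_nat_eq_0_iff) simp
qed

lemma cong_power_imp_cong:
  fixes p :: nat
  assumes "[x = y] (mod int (p ^ k))" "l \<le> k"
  shows "[x = y] (mod int (p ^ l))"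
  by (rule cong_dvd_modulus[OF assms(1)]) (use assms(2) in \<open>simp add: le_imp_power_dvd\<close>)

text \<open>A nonzero sum has a stationary point, and the condition u m = b/m modulo p^(k div 2)
  reduces to u m^2 = b modulo p because k div 2 \<ge> 1. Multiplied by u, this exhibits b u as a
  square modulo p.\<close>

lemma kl_nonzeroE:
  fixes p :: nat
  assumes "p > 0" "k \<ge> 2" "kl (p ^ k) u b \<noteq> 0"
  obtains m where "coprime m (int p)" "[u * m * m = b] (mod int p)"
proof -
  have "kl (p ^ k) u b = (\<Sum>m\<in>{0..<int (p ^ k)}.
    if [u * m = b * modular_inverse (int (p ^ k)) m] (mod int (p ^ (k div 2))) then kl_term (p ^ k) u b m else 0)"
    using assms by (intro kl_localise[where \<sigma> = "k - k div 2"]) auto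
  with assms(3) obtain m where *: "[u * m = b * modular_inverse (int (p ^ k)) m] (mod int (p ^ (k div 2)))"
    "kl_term (p ^ k) u b m \<noteq> 0"
    using that by (auto elim!: sum.not_neutral_contains_not_neutral split: if_splits)
  have m: "coprime m (int (p ^ k))" using *(2) by (auto simp: kl_term_def split: if_splits)
  have "[u * m = b * modular_inverse (int (p ^ k)) m] (mod int (p ^ 1))"
    by (rule cong_power_imp_cong[OF *(1)]) (use assms in auto)
  then have "[u * m * m = b * (modular_inverse (int (p ^ k)) m * m)] (mod int p)"
    by (simp add: cong_scalar_right flip: mult.assoc)
  also have "[modular_inverse (int (p ^ k)) m * m = 1] (mod int (p ^ 1))"
    by (rule cong_power_imp_cong[OF cong_modular_inverse2[OF m]]) (use assms in auto)
  then have "[b * (modular_inverse (int (p ^ k)) m * m) = b * 1] (mod int p)"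
    by (intro cong_scalar_left) simp
  finally have "[u * m * m = b] (mod int p)" by simp
  moreover have "coprime m (int p)" using m assms by simp
  ultimately show ?thesis using that by blast
qed

text \<open>If p divides u but not b, then u m^2 = b has no solution modulo p, so there is no
  stationary point. In particular the frequency u = 0 drops out of every completed sum.\<close>

lemma kl_eq_0:
  fixes p :: nat
  assumes "prime p" "k \<ge> 2" "int p dvd u" "\<not> int p dvd b"
  shows "kl (p ^ k) u b = 0"
proof (rule ccontr)
  assume "kl (p ^ k) u b \<noteq> 0"
  then obtain m where "[u * m * m = b] (mod int p)"
    using assms kl_nonzeroE[of p k u b] prime_gt_0_nat by metis
  then show False using assms by (meson cong_dvd_iff dvd_mult2)
qed

section \<open>Square roots modulo p^k and reduction to the sums S(r,r)\<close>

lemma hensel_sqrt: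
  fixes p :: nat
  assumes p: "prime p" "odd p" and c: "\<not> int p dvd c" and s: "[s\<^sup>2 = c] (mod int p)"
  shows "\<exists>r. [r\<^sup>2 = c] (mod int (p ^ Suc k))"
proof (induction k)
  case 0
  then show ?case using s by auto
next
  case (Suc k)
  then obtain r where r: "[r\<^sup>2 = c] (mod int (p ^ Suc k))" by blast
  define P where "P = int (p ^ Suc k)"
  obtain e where e: "c = r\<^sup>2 + P * e"
    using r unfolding cong_iff_lin P_def by blast
  have "\<not> int p dvd 2 * r"
  proof
    assume "int p dvd 2 * r"
    then have "int p dvd 2 \<or> int p dvd r" using p by (simp add: prime_dvd_mult_iff)
    moreover have "\<not> int p dvd 2"
      using p by (metis int_dvd_int_iff of_nat_numeral prime_odd_nat primes_dvd_imp_eq two_is_prime_nat)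
    ultimately have "int p dvd r\<^sup>2 + P * e"
      by (simp add: P_def power2_eq_square)
    then show False using c e by simp
  qed
  then have "coprime (2 * r) (int p)"
    using p prime_imp_coprime[of "int p" "2 * r"] by (simp add: coprime_commute)
  \<comment> \<open>The Newton correction: (r + P y)^2 agrees with r^2 + 2 r y P modulo P^2, so y
    has to solve 2 r y = e modulo p, where 2 r is invertible because p is odd.\<close>
  then obtain y where y: "[2 * r * y = e] (mod int p)"
    by (metis cong_modular_inverse1 cong_scalar_right mult.assoc mult_1)
  then obtain l where l: "e = 2 * r * y + int p * l"
    unfolding cong_iff_lin by blast
  have "c - (r + P * y)\<^sup>2 = P * int p * l - P * P * y\<^sup>2"
    by (simp add: e l power2_eq_square algebra_simps)
  also have "int (p ^ Suc (Suc k)) dvd \<dots>"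
  proof (rule dvd_diff)
    have "P * int p dvd P * int p * l" by (rule dvd_triv_left)
    then show "int (p ^ Suc (Suc k)) dvd P * int p * l"
      by (simp only: P_def of_nat_mult power_Suc mult_ac)
    have "int p dvd P" by (simp add: P_def)
    then have "P * int p dvd P * P * y\<^sup>2" by (intro dvd_mult2 mult_dvd_mono dvd_refl)
    then show "int (p ^ Suc (Suc k)) dvd P * P * y\<^sup>2"
      by (simp only: P_def of_nat_mult power_Suc mult_ac)
  qed
  finally have "[(r + P * y)\<^sup>2 = c] (mod int (p ^ Suc (Suc k)))"
    by (subst cong_sym_eq) (simp only: cong_iff_dvd_diff)
  then show ?case by blast
qed

lemma coprime_prime_power_iff:
  assumes "prime p" "k > 0"
  shows "coprime x (int (p ^ k)) \<longleftrightarrow> \<not> int p dvd x"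
proof -
  have "coprime x (int p) \<longleftrightarrow> \<not> int p dvd x"
    using assms prime_imp_coprime[of "int p" x] by (auto simp: coprime_commute coprime_absorb_right)
  moreover have "coprime x (int (p ^ k)) \<longleftrightarrow> coprime x (int p)"
    unfolding of_nat_power coprime_power_right_iff using assms(2) by blast
  ultimately show ?thesis by blast
qed

text \<open>Substituting m = (r/u) z turns u m + b/m into r z + (b u/r)/z, and b u/r = r. With both
  coefficients equal, the stationary points sit at z = 1 and z = -1.\<close>

lemma kl_square:
  fixes p :: nat
  assumes p: "prime p" and b: "\<not> int p dvd b" and u: "\<not> int p dvd u"
    and r: "[r\<^sup>2 = b * u] (mod int (p ^ k))" and k: "k > 0"
  shows "kl (p ^ k) u b = kl (p ^ k) r r"
proof -
  define q where "q = p ^ k"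
  have cop: "coprime x (int q) \<longleftrightarrow> \<not> int p dvd x" for x
    unfolding q_def by (rule coprime_prime_power_iff[OF p k])
  have q0: "q > 0" using p by (simp add: q_def prime_gt_0_nat)
  have "int p dvd int (p ^ k)" using k by simp
  then have "[r\<^sup>2 = b * u] (mod int p)" using r by (rule cong_dvd_modulus[rotated])
  then have rn: "\<not> int p dvd r"
    using p b u by (metis cong_dvd_iff dvd_power pos2 prime_dvd_mult_iff prime_nat_int_transfer
        dvd_mult2 power2_eq_square)
  define v where "v = modular_inverse (int q) u"
  define w where "w = modular_inverse (int q) r"
  have uv: "[u * v = 1] (mod int q)" and rw: "[r * w = 1] (mod int q)"
    unfolding v_def w_def using u rn by (auto intro!: cong_modular_inverse1 simp: cop)
  have cv: "coprime v (int q)"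
    using u unfolding v_def by (intro coprime_modular_inverse) (simp add: cop)
  have cr: "coprime r (int q)" by (simp add: cop rn)
  have sub: "kl_term q u b (r * v * z) = kl_term q r r z" for z
  proof (cases "coprime z (int q)")
    case False
    then show ?thesis by (simp add: kl_term_def)
  next
    case True
    let ?x = "modular_inverse (int q) z"
    have zx: "[z * ?x = 1] (mod int q)" using True by (rule cong_modular_inverse1)
    have "kl_term q u b (r * v * z) = ech q (r * z + r * ?x)"
    proof (rule kl_term_eqI[where x = "w * u * ?x"])
      show "coprime (r * v * z) (int q)" using True cv cr by simp
      have "[(r * w) * (u * v) * (z * ?x) = 1 * 1 * 1] (mod int q)"
        by (intro cong_mult uv rw zx)
      then show "[r * v * z * (w * u * ?x) = 1] (mod int q)" by (simp add: mult_ac)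
      have "[(u * v) * (r * z) = 1 * (r * z)] (mod int q)"
        by (intro cong_mult uv cong_refl)
      moreover have "[(b * u) * (w * ?x) = r\<^sup>2 * (w * ?x)] (mod int q)"
        using r by (intro cong_scalar_right) (simp add: q_def cong_sym)
      moreover have "[(r * w) * (r * ?x) = 1 * (r * ?x)] (mod int q)"
        by (intro cong_mult rw cong_refl)
      ultimately have "[(u * v) * (r * z) + (b * u) * (w * ?x) = 1 * (r * z) + 1 * (r * ?x)] (mod int q)"
        by (intro cong_add) (auto simp: power2_eq_square mult_ac intro: cong_trans)
      then show "[u * (r * v * z) + b * (w * u * ?x) = r * z + r * ?x] (mod int q)"
        by (simp add: mult_ac)
    qed
    then show ?thesis using True by (simp add: kl_term_def)
  qed
  have "kl q u b = (\<Sum>z\<in>{0..<int q}. kl_term q u b (r * v * z))"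
    unfolding kl_def
    by (rule sum_residues_reindex[symmetric]) (use q0 cv cr in \<open>auto intro: kl_term_cong simp: cong_mult_lcancel\<close>)
  also have "\<dots> = kl q r r" unfolding sub kl_def ..
  finally show ?thesis unfolding q_def .
qed

text \<open>The factor below depends on \<open>r\<close> modulo \<open>p\<close> only, so it is constant in \<open>t\<close> along \<open>u = u0 + p t\<close>.\<close>

definition gauss :: "nat \<Rightarrow> nat \<Rightarrow> int \<Rightarrow> complex" where
  "gauss p k r = (\<Sum>y\<in>{0..<int (p ^ (k - k div 2))}. ech (p ^ (k mod 2)) (r * y\<^sup>2))"

lemma gauss_cong:
  assumes "[r = s] (mod int p)"
  shows "gauss p k r = gauss p k s"
proof -
  have "[r = s] (mod int (p ^ (k mod 2)))"
    using assms by (cases "even k") (auto simp: even_iff_mod_2_eq_zero odd_iff_mod_2_eq_one)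
  then show ?thesis
    unfolding gauss_def by (intro sum.cong refl ech_cong cong_scalar_right)
qed

text \<open>Expanding the square with y = z + h makes the phase linear in z, so only the h divisible
  by P = p^(k mod 2) survive. This treats both parities together: for even k every term is 1, for
  odd k the sum is p^(k div 2) copies of the quadratic Gauss sum modulo p.\<close>

lemma norm_gauss:
  assumes p: "prime p" "odd p" and r: "\<not> int p dvd r" and k: "k > 0"
  shows "cmod (gauss p k r) = sqrt (real (p ^ k))"
proof -
  define Q where "Q = p ^ (k - k div 2)"
  define P where "P = p ^ (k mod 2)"
  define e where "e = p ^ (k - k div 2 - k mod 2)"
  have ke: "k mod 2 \<le> k - k div 2" "k - k div 2 - k mod 2 + (k - k div 2) = k" using k by presburger+
  have Q: "Q = e * P" using ke unfolding Q_def e_def P_def by (simp flip: power_add)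
  have pos: "Q > 0" "P > 0" "e > 0" using p by (auto simp: Q_def P_def e_def prime_gt_0_nat)
  have g: "gauss p k r = (\<Sum>y\<in>{0..<int Q}. ech P (r * y\<^sup>2))"
    by (simp add: gauss_def Q_def P_def)
  have c2r: "coprime (2 * r) (int P)"
  proof -
    have "\<not> int p dvd 2"
      using p by (metis int_dvd_int_iff of_nat_numeral prime_odd_nat primes_dvd_imp_eq two_is_prime_nat)
    then have "\<not> int p dvd 2 * r" using p r by (simp add: prime_dvd_mult_iff)
    then have "coprime (2 * r) (int p)"
      using p prime_imp_coprime[of "int p" "2 * r"] by (simp add: coprime_commute)
    then show ?thesis by (simp add: P_def)
  qed
  have shift: "(\<Sum>y\<in>{0..<int Q}. ech P (r * y\<^sup>2)) = (\<Sum>h\<in>{0..<int Q}. ech P (r * (z + h)\<^sup>2))" for z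
  proof (rule sum_residues_reindex[symmetric, where g = "\<lambda>h. z + h"])
    fix m n assume "[m = n] (mod int Q)"
    then have "[m = n] (mod int P)" by (rule cong_dvd_modulus) (simp add: Q)
    then show "ech P (r * m\<^sup>2) = ech P (r * n\<^sup>2)" by (intro ech_cong cong_scalar_left cong_pow)
  qed (use pos in \<open>auto simp: cong_add_lcancel\<close>)
  have inner: "(\<Sum>z\<in>{0..<int Q}. ech P (z * (2 * r * h))) = (if int P dvd h then of_nat Q else 0)" for h
  proof -
    have "(\<Sum>z\<in>{0..<int Q}. ech P (z * (2 * r * h))) = (\<Sum>z<Q. ech P (int z * (2 * r * h)))"
      by (rule sum_interval_int[symmetric])
    \<comment> \<open>The range of z consists of e periods of a character modulo P; written as a
      character modulo Q = e P it becomes one complete range for orthogonality.\<close>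
    also have "\<dots> = (\<Sum>z<Q. ech Q (int z * (int e * (2 * r * h))))"
      unfolding Q by (intro sum.cong refl) (subst ech_scale[OF pos(3), symmetric], simp only: mult_ac)
    also have "\<dots> = (if int Q dvd int e * (2 * r * h) then of_nat Q else 0)"
      using pos by (intro sum_ech_orthogonal) auto
    also have "int Q dvd int e * (2 * r * h) \<longleftrightarrow> int P dvd (2 * r) * h"
      using pos by (simp add: Q)
    also have "\<dots> \<longleftrightarrow> int P dvd h"
      using c2r by (simp add: coprime_dvd_mult_right_iff coprime_commute)
    finally show ?thesis .
  qed
  have "gauss p k r * cnj (gauss p k r) = (\<Sum>z\<in>{0..<int Q}. (\<Sum>y\<in>{0..<int Q}. ech P (r * y\<^sup>2)) * cnj (ech P (r * z\<^sup>2)))"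
    by (simp add: g sum_distrib_left)
  also have "\<dots> = (\<Sum>z\<in>{0..<int Q}. \<Sum>h\<in>{0..<int Q}. ech P (r * (z + h)\<^sup>2) * cnj (ech P (r * z\<^sup>2)))"
    by (intro sum.cong refl) (subst shift, rule sum_distrib_right)
  also have "\<dots> = (\<Sum>z\<in>{0..<int Q}. \<Sum>h\<in>{0..<int Q}. ech P (r * h\<^sup>2) * ech P (z * (2 * r * h)))"
    unfolding ech_minus[symmetric] ech_add[symmetric]
    by (intro sum.cong refl arg_cong[of _ _ "ech P"]) (simp add: power2_eq_square algebra_simps)
  also have "\<dots> = (\<Sum>h\<in>{0..<int Q}. ech P (r * h\<^sup>2) * (\<Sum>z\<in>{0..<int Q}. ech P (z * (2 * r * h))))"
    by (subst sum.swap) (simp only: sum_distrib_left)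
  also have "\<dots> = (\<Sum>h\<in>{0..<int Q}. if int P dvd h then of_nat Q else 0)"
  proof (intro sum.cong refl)
    fix h assume "h \<in> {0..<int Q}"
    have "ech P (r * h\<^sup>2) = 1" if "int P dvd h"
      using that by (intro ech_cong_0) (simp add: power2_eq_square)
    then show "ech P (r * h\<^sup>2) * (\<Sum>z\<in>{0..<int Q}. ech P (z * (2 * r * h))) = (if int P dvd h then of_nat Q else 0)"
      by (simp add: inner)
  qed
  also have "\<dots> = (\<Sum>h\<in>{h\<in>{0..<int Q}. int P dvd h}. of_nat Q)"
    by (rule sum.inter_filter[symmetric]) simp
  also have "\<dots> = (\<Sum>h\<in>{0..<int e}. of_nat Q)"
    by (rule sum.reindex_bij_witness[of _ "\<lambda>h. h * int P" "\<lambda>h. h div int P"])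
      (use pos in \<open>auto simp: Q zero_le_mult_iff elim!: dvdE\<close>)
  also have "\<dots> = of_nat (e * Q)" by simp
  also have "e * Q = p ^ k" unfolding e_def Q_def using ke by (simp flip: power_add)
  finally have "gauss p k r * cnj (gauss p k r) = of_nat (p ^ k)" .
  then have "complex_of_real ((cmod (gauss p k r))\<^sup>2) = complex_of_real (real (p ^ k))"
    unfolding complex_norm_square by simp
  then have "(cmod (gauss p k r))\<^sup>2 = real (p ^ k)" by (simp only: of_real_eq_iff)
  then show ?thesis by (metis norm_ge_zero real_sqrt_unique)
qed

text \<open>Stationary points of r (z + 1/z) satisfy z^2 = 1 modulo R = p^(k div 2). As p is odd, it
  cannot divide both z - 1 and z + 1, so z is 1 or -1 modulo R. At z = 1 + R y the phase is 2 r + r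
  R^2 y^2 modulo q, since q divides R^3 by k \<le> 3 (k div 2). The quotient q / R^2 = p^(k mod 2)
  is the modulus of the Gauss sum.\<close>

lemma kl_diag:
  assumes p: "prime p" "odd p" and r: "\<not> int p dvd r" and k: "k \<ge> 2"
  shows "kl (p ^ k) r r = ech (p ^ k) (2 * r) * gauss p k r + ech (p ^ k) (- (2 * r)) * gauss p k (- r)"
proof -
  define q where "q = p ^ k"
  define \<tau> where "\<tau> = k div 2"
  define Q where "Q = p ^ (k - \<tau>)"
  define R where "R = p ^ \<tau>"
  have \<tau>: "\<tau> > 0" "\<tau> \<le> k - \<tau>" "k - \<tau> + \<tau> = k" "k mod 2 + 2 * \<tau> = k" "k \<le> 3 * \<tau>" using k unfolding \<tau>_def by presburger+
  have q: "q = Q * R" "q > 0" "Q > 0" "R > 0"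
    using p \<tau> by (auto simp: q_def Q_def R_def prime_gt_0_nat simp flip: power_add)
  have Rp: "p dvd R" using \<tau> by (simp add: R_def)
  have p2: "\<not> int p dvd 2"
    using p by (metis int_dvd_int_iff of_nat_numeral prime_odd_nat primes_dvd_imp_eq two_is_prime_nat)
  have copq: "coprime x (int q) \<longleftrightarrow> \<not> int p dvd x" for x
    unfolding q_def using p k by (intro coprime_prime_power_iff) auto
  have copR: "coprime x (int R) \<longleftrightarrow> \<not> int p dvd x" for x
    unfolding R_def using p \<tau> by (intro coprime_prime_power_iff) auto
  have unit: "\<not> int p dvd z" if "[z = s] (mod int R)" "s = 1 \<or> s = -1" for z s
  proof -
    have "int p dvd int R" using Rp by simp
    then have "[z = s] (mod int p)" using that cong_dvd_modulus by blast
    then have "int p dvd z \<longleftrightarrow> int p dvd s" by (rule cong_dvd_iff)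
    then show ?thesis using that p by (auto simp: not_prime_unit)
  qed
  have stat: "[r * z = r * modular_inverse (int q) z] (mod int R) \<longleftrightarrow> [z = 1] (mod int R) \<or> [z = -1] (mod int R)"
    if z: "\<not> int p dvd z" for z
  proof -
    let ?x = "modular_inverse (int q) z"
    have "int R dvd int q" by (simp add: q)
    have zx: "[z * ?x = 1] (mod int R)"
      by (rule cong_dvd_modulus[OF cong_modular_inverse1[of z "int q"]]) (use z copq[of z] in \<open>simp_all add: q(1)\<close>)
    have "[r * z = r * ?x] (mod int R) \<longleftrightarrow> [z = ?x] (mod int R)"
      using r by (intro cong_mult_lcancel) (simp add: copR)
    also have "\<dots> \<longleftrightarrow> [z * z = z * ?x] (mod int R)"
      using z by (intro cong_mult_lcancel[symmetric]) (simp add: copR)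
    also have "\<dots> \<longleftrightarrow> [z * z = 1] (mod int R)"
      using zx by (meson cong_sym cong_trans)
    also have "\<dots> \<longleftrightarrow> int R dvd (z - 1) * (z + 1)"
      by (simp add: cong_iff_dvd_diff algebra_simps)
    also have "\<dots> \<longleftrightarrow> int R dvd z - 1 \<or> int R dvd z + 1"
    proof
      assume *: "int R dvd (z - 1) * (z + 1)"
      have "\<not> (int p dvd z - 1 \<and> int p dvd z + 1)"
      proof
        assume "int p dvd z - 1 \<and> int p dvd z + 1"
        then have "int p dvd (z + 1) - (z - 1)" by (meson dvd_diff)
        then show False using p2 by simp
      qed
      then consider "coprime (z - 1) (int R)" | "coprime (z + 1) (int R)"
        using copR[of "z - 1"] copR[of "z + 1"] by blast
      then show "int R dvd z - 1 \<or> int R dvd z + 1"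
        using * by cases (auto simp: coprime_dvd_mult_right_iff coprime_dvd_mult_left_iff coprime_commute)
    qed auto
    finally show ?thesis by (simp add: cong_iff_dvd_diff)
  qed
  have excl: "\<not> ([z = 1] (mod int R) \<and> [z = -1] (mod int R))" for z
  proof
    assume *: "[z = 1] (mod int R) \<and> [z = -1] (mod int R)"
    then have "[1 = -1] (mod int R)" by (meson cong_sym cong_trans)
    then have "int R dvd 2" by (simp add: cong_iff_dvd_diff)
    then show False using Rp p2 by (meson dvd_trans int_dvd_int_iff of_nat_dvd_iff)
  qed
  \<comment> \<open>Stated for arbitrary s because the neighbourhood of z = -1 is reduced to it by z
    -> -z, with s = -r.\<close>
  have near: "(\<Sum>z\<in>{0..<int q}. if [z = 1] (mod int R) then kl_term q s s z else 0)
      = ech q (2 * s) * gauss p k s" for s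
  proof -
    have "(\<Sum>z\<in>{0..<int q}. if [z = 1] (mod int R) then kl_term q s s z else 0)
        = (\<Sum>z\<in>{z\<in>{0..<int q}. [z = 1] (mod int R)}. kl_term q s s z)"
      by (rule sum.inter_filter[symmetric]) simp
    also have "\<dots> = (\<Sum>y\<in>{0..<int Q}. kl_term q s s (1 + int R * y))"
    proof (cases "R = 1")
      case True
      then have "\<tau> = 0" using p by (auto simp: R_def prime_gt_Suc_0_nat)
      then show ?thesis using \<tau> by simp
    next
      case False
      then have R1: "int R > 1" using q by simp
      have bd: "1 + int R * y < int q" "0 \<le> 1 + int R * y" if "y \<in> {0..<int Q}" for y
      proof -
        have "int R * (y + 1) \<le> int R * int Q" using that by (intro mult_left_mono) auto
        then show "1 + int R * y < int q" using R1 by (simp add: q algebra_simps)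
        show "0 \<le> 1 + int R * y" using that by simp
      qed
      show ?thesis
      proof (rule sum.reindex_bij_witness[of _ "\<lambda>y. 1 + int R * y" "\<lambda>z. (z - 1) div int R"])
        fix z assume z: "z \<in> {z \<in> {0..<int q}. [z = 1] (mod int R)}"
        then obtain y where y: "z = 1 + int R * y" by (metis (mono_tags) cong_iff_lin cong_sym mem_Collect_eq)
        have "y \<ge> 0"
        proof (rule ccontr)
          assume "\<not> y \<ge> 0"
          then have "int R * y \<le> int R * (-1)" by (intro mult_left_mono) auto
          then show False using z y R1 by simp
        qed
        moreover have "y < int Q"
        proof (rule ccontr)
          assume "\<not> y < int Q"
          then have "int R * int Q \<le> int R * y" by (intro mult_left_mono) auto
          moreover have "1 + int R * y < int R * int Q" using z y by (simp add: q mult.commute)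
          ultimately show False by simp
        qed
        ultimately show "(z - 1) div int R \<in> {0..<int Q}" "1 + int R * ((z - 1) div int R) = z"
          "kl_term q s s (1 + int R * ((z - 1) div int R)) = kl_term q s s z"
          using R1 by (simp_all add: y)
      qed (use bd R1 in \<open>auto simp: cong_iff_dvd_diff\<close>)
    qed
    also have "\<dots> = (\<Sum>y\<in>{0..<int Q}. ech q (2 * s) * ech (p ^ (k mod 2)) (s * y\<^sup>2))"
    proof (intro sum.cong refl)
      fix y
      define z where "z = 1 + int R * y"
      have zR: "[z = 1] (mod int R)" by (simp add: z_def cong_iff_dvd_diff)
      then have cz: "coprime z (int q)" using unit copq by blast
      define x where "x = modular_inverse (int q) z"
      have zx: "[z * x = 1] (mod int q)" unfolding x_def using cz by (rule cong_modular_inverse1)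
      have "[z * x = 1] (mod int R)" by (rule cong_dvd_modulus[OF zx]) (simp add: q)
      moreover have "[z * x = 1 * x] (mod int R)" using zR by (rule cong_scalar_right)
      ultimately have xR: "[x = 1] (mod int R)" by (metis cong_sym cong_trans mult_1)
      then obtain v where v: "x = 1 + int R * v" by (metis cong_iff_lin cong_sym)
      have "int (p ^ k) dvd int (p ^ (3 * \<tau>))"
        using \<tau> by (intro of_nat_dvd_iff[THEN iffD2] le_imp_power_dvd) auto
      also have "int (p ^ (3 * \<tau>)) = int R * int R * int R"
        by (simp add: R_def numeral_3_eq_3 power_add)
      finally have Rk: "int q dvd int R * int R * int R" by (simp only: q_def)
      \<comment> \<open>An exact identity in place of an expansion of 1/z: with x = 1 + R v the
        inverse of z, the error is a multiple of 1 - z x, which is 0 modulo q, plus a term carrying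
        R^3.\<close>
      have "s * z + s * x - (2 * s + int R * int R * (s * y\<^sup>2))
          = s * (z - 2) * (1 - z * x) + int R * int R * int R * (s * v * y\<^sup>2)"
        unfolding z_def v by (simp add: power2_eq_square algebra_simps)
      moreover have "int q dvd 1 - z * x"
        using cong_sym[OF zx] by (simp add: cong_iff_dvd_diff)
      ultimately have "[s * z + s * x = 2 * s + int R * int R * (s * y\<^sup>2)] (mod int q)"
        unfolding cong_iff_dvd_diff using Rk by (metis dvd_add dvd_mult dvd_mult2)
      then have "kl_term q s s z = ech q (2 * s + int R * int R * (s * y\<^sup>2))"
        by (intro kl_term_eqI[OF cz zx])
      also have "\<dots> = ech q (2 * s) * ech (R * R * p ^ (k mod 2)) (int (R * R) * (s * y\<^sup>2))"
      proof -
        have "q = R * R * p ^ (k mod 2)"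
          unfolding q_def R_def using \<tau>(4) by (metis mult.commute mult_2 power_add)
        then show ?thesis by (simp add: ech_add)
      qed
      also have "ech (R * R * p ^ (k mod 2)) (int (R * R) * (s * y\<^sup>2)) = ech (p ^ (k mod 2)) (s * y\<^sup>2)"
        using q by (intro ech_scale) simp
      finally show "kl_term q s s (1 + int R * y) = ech q (2 * s) * ech (p ^ (k mod 2)) (s * y\<^sup>2)"
        by (simp only: z_def)
    qed
    also have "\<dots> = ech q (2 * s) * gauss p k s"
      by (simp add: gauss_def Q_def \<tau>_def sum_distrib_left)
    finally show ?thesis .
  qed
  have "kl q r r = (\<Sum>z\<in>{0..<int q}. if [r * z = r * modular_inverse (int q) z] (mod int R) then kl_term q r r z else 0)"
    unfolding q_def R_def using \<tau> p by (intro kl_localise[where \<sigma> = "k - \<tau>"]) (auto simp: prime_gt_0_nat)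
  also have "\<dots> = (\<Sum>z\<in>{0..<int q}. (if [z = 1] (mod int R) then kl_term q r r z else 0) +
      (if [z = -1] (mod int R) then kl_term q r r z else 0))"
  proof (intro sum.cong refl)
    fix z
    show "(if [r * z = r * modular_inverse (int q) z] (mod int R) then kl_term q r r z else 0) =
      (if [z = 1] (mod int R) then kl_term q r r z else 0) + (if [z = -1] (mod int R) then kl_term q r r z else 0)"
    proof (cases "int p dvd z")
      case True
      then show ?thesis by (simp add: kl_term_def copq)
    next
      case False
      show ?thesis unfolding stat[OF False] using excl[of z] by auto
    qed
  qed
  also have "\<dots> = ech q (2 * r) * gauss p k r + (\<Sum>z\<in>{0..<int q}. if [z = -1] (mod int R) then kl_term q r r z else 0)"
    unfolding sum.distrib near ..
  also have "(\<Sum>z\<in>{0..<int q}. if [z = -1] (mod int R) then kl_term q r r z else 0)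
      = (\<Sum>z\<in>{0..<int q}. if [- z = -1] (mod int R) then kl_term q r r (- z) else 0)"
  proof (rule sum_residues_reindex[symmetric, where g = uminus])
    fix m n :: int
    assume *: "[m = n] (mod int q)"
    then have "[m = n] (mod int R)" by (rule cong_dvd_modulus) (simp add: q)
    then have "[m = -1] (mod int R) \<longleftrightarrow> [n = -1] (mod int R)" by (meson cong_sym cong_trans)
    then show "(if [m = -1] (mod int R) then kl_term q r r m else 0) = (if [n = -1] (mod int R) then kl_term q r r n else 0)"
      using kl_term_cong[OF *] by simp
  qed (use q in \<open>auto simp: cong_minus_minus_iff\<close>)
  also have "\<dots> = (\<Sum>z\<in>{0..<int q}. if [z = 1] (mod int R) then kl_term q (- r) (- r) z else 0)"
  proof (intro sum.cong refl if_cong)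
    fix z
    show "kl_term q r r (- z) = kl_term q (- r) (- r) z"
    proof (cases "coprime z (int q)")
      case True
      have "kl_term q r r (- z) = ech q (- r * z + - r * modular_inverse (int q) z)"
        using True cong_modular_inverse1[OF True]
        by (intro kl_term_eqI[where x = "- modular_inverse (int q) z"]) auto
      then show ?thesis using True by (simp add: kl_term_def)
    qed (simp add: kl_term_def)
  qed (simp only: cong_minus_minus_iff)
  also have "\<dots> = ech q (2 * (- r)) * gauss p k (- r)" by (rule near)
  finally show ?thesis by (simp add: q_def)
qed

section \<open>Cancellation between Kloosterman sums\<close>

text \<open>The n-th derivative of sqrt(1 + 2x) at 0. It is a product of odd integers of absolute
  value below 2n, hence prime to every prime p > 2n.\<close>

definition odd_prod :: "nat \<Rightarrow> int" where "odd_prod n = (\<Prod>l<n. 1 - 2 * int l)"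

lemma odd_prod_gbinomial: "real_of_int (odd_prod n) = 2 ^ n * fact n * ((1/2) gchoose n)"
proof -
  have "real_of_int (odd_prod n) = (\<Prod>l<n. 2 * (1/2 - real l))"
    by (simp add: odd_prod_def)
  also have "\<dots> = 2 ^ n * (\<Prod>l<n. 1/2 - real l)"
    by (simp only: prod.distrib prod_constant card_lessThan)
  finally show ?thesis
    by (simp add: gbinomial_prod_rev atLeast0LessThan)
qed

text \<open>The square of the binomial series of \<open>sqrt (1 + 2 x)\<close>, with denominators cleared.\<close>

lemma odd_prod_convolution:
  "(\<Sum>i\<le>m. int (m choose i) * odd_prod i * odd_prod (m - i)) = (if m = 0 then 1 else if m = 1 then 2 else 0)"
proof -
  have "real_of_int (\<Sum>i\<le>m. int (m choose i) * odd_prod i * odd_prod (m - i))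
    = (\<Sum>i\<le>m. 2 ^ m * fact m * ((1/2 gchoose i) * (1/2 gchoose (m - i))))"
    unfolding of_int_sum
  proof (intro sum.cong refl)
    fix i assume "i \<in> {..m}"
    then have i: "i \<le> m" by simp
    have "fact m = (fact i * fact (m - i) * real (m choose i))"
      using binomial_fact_lemma[OF i] by (metis of_nat_fact of_nat_mult)
    moreover have "(2::real) ^ m = 2 ^ i * 2 ^ (m - i)" using i by (simp flip: power_add)
    ultimately show "real_of_int (int (m choose i) * odd_prod i * odd_prod (m - i))
      = 2 ^ m * fact m * ((1/2 gchoose i) * (1/2 gchoose (m - i)))"
      by (simp add: odd_prod_gbinomial)
  qed
  also have "\<dots> = 2 ^ m * fact m * (1 gchoose m)"
    using gbinomial_Vandermonde[of "1/2 :: real" "1/2" m] by (simp add: atLeast0AtMost flip: sum_distrib_left)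
  also have "\<dots> = real_of_int (if m = 0 then 1 else if m = 1 then 2 else 0)"
  proof -
    have "(1 gchoose m :: real) = real (1 choose m)" by (simp add: binomial_gbinomial)
    moreover have "1 choose m = 0" if "m > 1" using that by (rule binomial_eq_0)
    ultimately show ?thesis by auto
  qed
  finally show ?thesis by (simp only: of_int_eq_iff)
qed

text \<open>The root is r0 sqrt(1 + x/u0) with x = p t, expanded by the binomial series. Terms of
  degree at least k vanish because p^k divides x^k, and for p > 2k the denominators that remain,
  factorials below k! and powers of 2 u0, are units.\<close>

lemma sqrt_series_mod_prime_power:
  fixes p :: nat
  assumes p: "prime p" "p > 2 * k" "k \<ge> 2" and u0: "\<not> int p dvd u0" and r0: "\<not> int p dvd r0"
    and sq: "[r0\<^sup>2 = b * u0] (mod int (p ^ k))"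
  obtains c :: "nat \<Rightarrow> int" where "[c 0 = r0] (mod int p)" "\<not> int p dvd c (k - 1)"
    "\<And>t. [(\<Sum>i<k. c i * (int p * t) ^ i)\<^sup>2 = b * (u0 + int p * t)] (mod int (p ^ k))"
proof -
  define q where "q = int (p ^ k)"
  have k0: "k > 0" using p by simp
  note cop = coprime_prime_power_iff[OF p(1) k0, folded q_def]
  have pq: "int p dvd q" using k0 by (simp add: q_def)
  have pp: "prime (int p)" using p by simp
  have p2: "\<not> int p dvd 2" using p by (auto dest!: zdvd_imp_le)
  define f where "f i = modular_inverse q (fact i)" for i
  have cf: "coprime (fact i) q" if "i < k" for i
  proof -
    have "\<not> p dvd fact i" using p that by (simp add: prime_dvd_fact_iff)
    then have "\<not> int p dvd fact i" by (metis int_dvd_int_iff of_nat_fact)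
    then show ?thesis by (simp add: cop)
  qed
  have f: "[fact i * f i = 1] (mod q)" if "i < k" for i
    unfolding f_def using cf[OF that] by (rule cong_modular_inverse1)
  have "\<not> int p dvd 2 * u0" using p2 u0 pp by (simp add: prime_dvd_mult_iff)
  define w where "w = modular_inverse q (2 * u0)"
  have w: "[2 * u0 * w = 1] (mod q)"
    unfolding w_def using \<open>\<not> int p dvd 2 * u0\<close> by (intro cong_modular_inverse1) (simp add: cop)
  \<comment> \<open>Taylor coefficients of r0 sqrt(1 + 2 y) at y = x/(2 u0): here \<open>f i\<close>
    stands for 1/i! and \<open>w\<close> for 1/(2 u0).\<close>
  define c where "c i = r0 * odd_prod i * f i * w ^ i" for i
  have unit: "\<not> int p dvd y" if "[x * y = 1] (mod q)" for x y
  proof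
    assume "int p dvd y"
    moreover have "[x * y = 1] (mod int p)" by (rule cong_dvd_modulus[OF that pq])
    ultimately have "int p dvd 1" by (meson cong_dvd_iff dvd_mult)
    then show False using p by (simp add: zdvd1_eq)
  qed
  have "[c 0 = r0] (mod q)"
    using cong_scalar_left[OF f[of 0], of r0] k0 by (simp add: c_def odd_prod_def)
  then have 1: "[c 0 = r0] (mod int p)" by (rule cong_dvd_modulus[OF _ pq])
  have "\<not> int p dvd odd_prod (k - 1)"
  proof
    assume "int p dvd odd_prod (k - 1)"
    then obtain l where l: "l < k - 1" "int p dvd 1 - 2 * int l"
      unfolding odd_prod_def using pp by (auto simp: prime_dvd_prod_iff)
    have "1 - 2 * int l \<noteq> 0" by presburger
    then have "int p \<le> \<bar>1 - 2 * int l\<bar>" using l dvd_imp_le_int by (metis abs_of_nat)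
    then show False using l p by linarith
  qed
  moreover have "\<not> int p dvd f (k - 1)" using unit[OF f[of "k - 1"]] k0 by simp
  moreover have "\<not> int p dvd w ^ (k - 1)" using unit[OF w] pp prime_dvd_power by blast
  ultimately have 2: "\<not> int p dvd c (k - 1)"
    using r0 pp by (simp add: c_def prime_dvd_mult_iff)
  \<comment> \<open>The coefficient of y^m in the square of the series for sqrt(1 + 2 y). After
    multiplication by the unit m! the convolution identity shows that it is the coefficient of 1 + 2
    y.\<close>
  define S where "S m = (\<Sum>i\<le>m. odd_prod i * odd_prod (m - i) * (f i * f (m - i)))" for m
  have S: "[S m = (if m = 0 then 1 else if m = 1 then 2 else 0)] (mod q)" if m: "m < k" for m
  proof -
    have "[fact m * S m = (\<Sum>i\<le>m. int (m choose i) * odd_prod i * odd_prod (m - i))] (mod q)"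
      unfolding S_def sum_distrib_left
    proof (rule cong_sum)
      fix i assume "i \<in> {..m}"
      then have i: "i \<le> m" by simp
      have "fact m = (fact i * fact (m - i) * int (m choose i))"
        using binomial_fact_lemma[OF i] by (metis of_nat_fact of_nat_mult)
      then have "fact m * (odd_prod i * odd_prod (m - i) * (f i * f (m - i)))
        = (fact i * f i) * (fact (m - i) * f (m - i)) * (int (m choose i) * odd_prod i * odd_prod (m - i))"
        by (simp add: mult_ac)
      moreover have "[(fact i * f i) * (fact (m - i) * f (m - i)) * (int (m choose i) * odd_prod i * odd_prod (m - i))
        = 1 * 1 * (int (m choose i) * odd_prod i * odd_prod (m - i))] (mod q)"
        using i m by (intro cong_mult f cong_refl) auto
      ultimately show "[fact m * (odd_prod i * odd_prod (m - i) * (f i * f (m - i))) =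
        int (m choose i) * odd_prod i * odd_prod (m - i)] (mod q)" by (simp only: mult_1)
    qed
    then have *: "[fact m * S m = (if m = 0 then 1 else if m = 1 then 2 else 0)] (mod q)"
      unfolding odd_prod_convolution .
    have "[fact m * S m = fact m * (if m = 0 then 1 else if m = 1 then 2 else 0)] (mod q)"
      using * by (auto split: if_splits)
    then show ?thesis using cf[OF m] by (simp only: cong_mult_lcancel)
  qed
  have "[(\<Sum>i<k. c i * (int p * t) ^ i)\<^sup>2 = b * (u0 + int p * t)] (mod q)" for t
  proof -
    define x where "x = int p * t"
    \<comment> \<open>Total degree at least k means divisibility by p^k. So the square of the
      polynomial may be restricted to the triangle i + j < k, where it agrees with the square of the
      full series.\<close>
    have big: "[c i * x ^ i * (c j * x ^ j) = 0] (mod q)" if "i + j \<ge> k" for i j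
    proof -
      have "int p ^ k dvd x ^ (i + j)"
        using that unfolding x_def by (metis dvd_power_le dvd_triv_left)
      then have "q dvd c i * c j * x ^ (i + j)" by (simp add: q_def)
      then show ?thesis by (simp add: cong_0_iff power_add mult_ac)
    qed
    have "(\<Sum>i<k. c i * x ^ i)\<^sup>2 = (\<Sum>(i,j)\<in>{..<k} \<times> {..<k}. c i * x ^ i * (c j * x ^ j))"
      by (simp add: power2_eq_square sum_product sum.cartesian_product)
    also have "[\<dots> = (\<Sum>(i,j)\<in>{..<k} \<times> {..<k}. if i + j < k then c i * x ^ i * (c j * x ^ j) else 0)] (mod q)"
      by (rule cong_sum) (auto intro!: big simp: not_less)
    also have "(\<Sum>(i,j)\<in>{..<k} \<times> {..<k}. if i + j < k then c i * x ^ i * (c j * x ^ j) else 0)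
        = (\<Sum>(i,j)\<in>{(i,j). i + j < k}. c i * x ^ i * (c j * x ^ j))"
      by (rule sum.mono_neutral_cong_right) (auto split: if_splits)
    also have "\<dots> = (\<Sum>m<k. \<Sum>i\<le>m. c i * x ^ i * (c (m - i) * x ^ (m - i)))"
      by (rule sum.triangle_reindex)
    also have "\<dots> = (\<Sum>m<k. r0\<^sup>2 * (w * x) ^ m * S m)"
    proof (rule sum.cong[OF refl])
      fix m
      have "c i * x ^ i * (c (m - i) * x ^ (m - i)) =
        r0\<^sup>2 * (w * x) ^ m * (odd_prod i * odd_prod (m - i) * (f i * f (m - i)))" if "i \<le> m" for i
      proof -
        have "(w * x) ^ m = (w * x) ^ i * (w * x) ^ (m - i)" using that by (simp flip: power_add)
        then show ?thesis by (simp add: c_def power_mult_distrib power2_eq_square mult_ac)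
      qed
      then show "(\<Sum>i\<le>m. c i * x ^ i * (c (m - i) * x ^ (m - i))) = r0\<^sup>2 * (w * x) ^ m * S m"
        by (simp add: S_def sum_distrib_left)
    qed
    also have "[\<dots> = (\<Sum>m<k. r0\<^sup>2 * (w * x) ^ m * (if m = 0 then 1 else if m = 1 then 2 else 0))] (mod q)"
      by (intro cong_sum cong_scalar_left S) auto
    also have "(\<Sum>m<k. r0\<^sup>2 * (w * x) ^ m * (if m = 0 then 1 else if m = 1 then 2 else 0))
        = (\<Sum>m\<in>{0,1}. r0\<^sup>2 * (w * x) ^ m * (if m = 0 then 1 else if m = 1 then 2 else 0))"
      by (rule sum.mono_neutral_right) (use p(3) in auto)
    also have "\<dots> = r0\<^sup>2 * (1 + 2 * w * x)" by (simp add: algebra_simps)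
    also have "[\<dots> = b * u0 * (1 + 2 * w * x)] (mod q)"
      using sq by (intro cong_scalar_right) (simp add: q_def)
    also have "b * u0 * (1 + 2 * w * x) = b * u0 + b * x * (2 * u0 * w)" by (simp add: algebra_simps)
    also have "[\<dots> = b * u0 + b * x * 1] (mod q)"
      by (intro cong_add cong_refl cong_scalar_left w)
    finally show ?thesis by (simp add: x_def algebra_simps)
  qed
  then show ?thesis using that 1 2 unfolding q_def by blast
qed

text \<open>Within one class of u modulo p either every sum vanishes, or b u is a unit square
  throughout, with a root that is polynomial in t. In the second case each Kloosterman sum is two
  exponentials with constant Gauss factors, and each exponential yields a Weyl sum of degree k - 1.
  The twist by \<theta> anticipates the Fourier coefficients of an interval; it changes only the
  coefficients of degree 0 and 1.\<close>

lemma kl_class_sum_bound: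
  assumes k: "k \<ge> 4"
  shows "\<exists>C>0. \<exists>\<delta>>0. \<delta> \<le> 1 / 9 \<and> (\<forall>p u0 b (\<theta>::real) N. prime (p::nat) \<longrightarrow> p > 2 * k \<longrightarrow> \<not> int p dvd b \<longrightarrow>
     cmod (\<Sum>t<N. ee (\<theta> * (of_int u0 + real p * real t)) * kl (p ^ k) (u0 + int p * int t) b)
       \<le> C * sqrt (real (p ^ k)) * (real N + real p powr (2/3)) * real p powr (- \<delta>))"
proof -
  define d where "d = k - 3"
  have d: "k - 1 = d + 2" "d \<ge> 1" "k = Suc (d + 2)" using k by (auto simp: d_def)
  obtain C \<delta> where C: "C > 0" and \<delta>: "\<delta> > 0" "\<delta> \<le> 1/9" and
    weyl: "\<And>p \<gamma> a X N. prime (p::nat) \<Longrightarrow> p > d + 2 \<Longrightarrow> \<not> int p dvd \<gamma> \<Longrightarrow>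
     a (d + 2) = real_of_int \<gamma> / real p \<Longrightarrow>
     cmod (\<Sum>j<N. ee (\<Sum>i\<le>d + 2. a i * (X + real j) ^ i)) \<le> C * (real N + real p powr (2/3)) * real p powr (- \<delta>)"
    using weyl_long[of d] by blast
  have "cmod (\<Sum>t<N. ee (\<theta> * (of_int u0 + real p * real t)) * kl (p ^ k) (u0 + int p * int t) b)
       \<le> (2 * C) * sqrt (real (p ^ k)) * (real N + real p powr (2/3)) * real p powr (- \<delta>)"
    if p: "prime p" "p > 2 * k" and b: "\<not> int p dvd b" for p u0 b N and \<theta> :: real
  proof (cases "\<forall>t. kl (p ^ k) (u0 + int p * int t) b = 0")
    case True
    then show ?thesis using C by simp
  next
    case False
    \<comment> \<open>One nonvanishing sum suffices: it makes b u a square modulo p, and this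
      depends only on the class of u modulo p.\<close>
    then obtain t0 where t0: "kl (p ^ k) (u0 + int p * int t0) b \<noteq> 0" by blast
    define q where "q = p ^ k"
    have odd: "odd p" using p k by (intro prime_odd_nat) auto
    have pp: "prime (int p)" using p by simp
    have p0: "p > 0" using p by simp
    have cu: "[u0 + int p * int t = u0] (mod int p)" for t by (simp add: cong_iff_dvd_diff)
    have k2: "k \<ge> 2" "k > 0" using k by auto
    have u0: "\<not> int p dvd u0 + int p * int t" for t
    proof -
      have "\<not> int p dvd u0 + int p * int t0" using kl_eq_0[OF p(1) k2(1) _ b] t0 by blast
      then show ?thesis using cu cong_dvd_iff by metis
    qed
    \<comment> \<open>From u0 m^2 = b modulo p it follows that u0 m is a square root of b u0 modulo
      p, the starting point for lifting.\<close>
    obtain m where m: "[(u0 + int p * int t0) * m * m = b] (mod int p)"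
      using kl_nonzeroE[OF p0 k2(1) t0] by blast
    have "[(u0 * m)\<^sup>2 = u0 * (u0 * m * m)] (mod int p)" by (simp add: power2_eq_square mult_ac)
    also have "[u0 * (u0 * m * m) = u0 * ((u0 + int p * int t0) * m * m)] (mod int p)"
      by (intro cong_scalar_left cong_scalar_right cong_sym[OF cu])
    also have "[u0 * ((u0 + int p * int t0) * m * m) = u0 * b] (mod int p)"
      using m by (rule cong_scalar_left)
    finally have "[(u0 * m)\<^sup>2 = b * u0] (mod int p)" by (simp add: mult.commute)
    moreover have bu: "\<not> int p dvd b * u0" using b u0[of 0] pp by (simp add: prime_dvd_mult_iff)
    ultimately obtain r0 where r0: "[r0\<^sup>2 = b * u0] (mod int (p ^ k))"
      using hensel_sqrt[OF p(1) odd, of "b * u0" "u0 * m" "k - 1"] k2 by auto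
    have "[r0\<^sup>2 = b * u0] (mod int p)" by (rule cong_dvd_modulus[OF r0]) (use k2 in auto)
    then have r0n: "\<not> int p dvd r0"
      using bu by (metis cong_dvd_iff dvd_mult2 power2_eq_square)
    obtain c where c: "[c 0 = r0] (mod int p)" "\<not> int p dvd c (k - 1)"
      "\<And>t. [(\<Sum>i<k. c i * (int p * t) ^ i)\<^sup>2 = b * (u0 + int p * t)] (mod int (p ^ k))"
      using sqrt_series_mod_prime_power[OF p k2(1) _ r0n r0] u0[of 0] by auto
    define G where "G t = (\<Sum>i<k. c i * (int p * t) ^ i)" for t
    have Gp: "[G t = r0] (mod int p)" for t
    proof -
      have "[G t = (\<Sum>i<k. if i = 0 then c 0 else 0)] (mod int p)"
        unfolding G_def
        by (rule cong_sum) (auto simp: cong_0_iff prime_dvd_mult_iff[OF pp] prime_dvd_power_iff[OF pp])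
      also have "(\<Sum>i<k. if i = 0 then c 0 else 0) = c 0" using k2 by simp
      finally show ?thesis using c(1) cong_trans by blast
    qed
    have Gn: "\<not> int p dvd G t" for t using Gp[of t] r0n cong_dvd_iff by blast
    have klG: "kl q (u0 + int p * int t) b = ech q (2 * G (int t)) * gauss p k r0 + ech q (- (2 * G (int t))) * gauss p k (- r0)" for t
    proof -
      have "kl q (u0 + int p * int t) b = kl q (G (int t)) (G (int t))"
        unfolding q_def G_def by (rule kl_square[OF p(1) b u0 c(3) k2(2)])
      also have "\<dots> = ech q (2 * G (int t)) * gauss p k (G (int t)) + ech q (- (2 * G (int t))) * gauss p k (- G (int t))"
        unfolding q_def by (rule kl_diag[OF p(1) odd Gn k2(1)])
      also have "gauss p k (G (int t)) = gauss p k r0" by (rule gauss_cong[OF Gp])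
      also have "gauss p k (- G (int t)) = gauss p k (- r0)"
        by (rule gauss_cong) (simp add: cong_minus_minus_iff Gp)
      finally show ?thesis .
    qed
    have phase: "cmod (\<Sum>t<N. ee (\<theta> * (of_int u0 + real p * real t)) * ech q (s * (2 * G (int t))))
        \<le> C * (real N + real p powr (2/3)) * real p powr (- \<delta>)" if s: "s = 1 \<or> s = -1" for s :: int
    proof -
      define a where "a i = of_int (s * 2 * c i) * real p ^ i / real q
        + (if i = 0 then \<theta> * of_int u0 else if i = 1 then \<theta> * real p else 0)" for i
      have "ee (\<theta> * (of_int u0 + real p * real t)) * ech q (s * (2 * G (int t)))
          = ee (\<Sum>i\<le>d + 2. a i * (0 + real t) ^ i)" for t
      proof -
        have "(\<Sum>i\<le>d + 2. a i * (0 + real t) ^ i) = (\<Sum>i\<le>d + 2. of_int (s * 2 * c i) * real p ^ i / real q * real t ^ i)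
            + (\<Sum>i\<le>d + 2. (if i = 0 then \<theta> * of_int u0 else if i = 1 then \<theta> * real p else 0) * real t ^ i)"
          by (simp add: a_def distrib_right sum.distrib)
        also have "(\<Sum>i\<le>d + 2. (if i = 0 then \<theta> * of_int u0 else if i = 1 then \<theta> * real p else 0) * real t ^ i)
            = (\<Sum>i\<in>{0,1}. (if i = 0 then \<theta> * of_int u0 else if i = 1 then \<theta> * real p else 0) * real t ^ i)"
          by (rule sum.mono_neutral_right) auto
        also have "\<dots> = \<theta> * (of_int u0 + real p * real t)" by (simp add: algebra_simps)
        also have "(\<Sum>i\<le>d + 2. of_int (s * 2 * c i) * real p ^ i / real q * real t ^ i)
            = of_int (s * (2 * G (int t))) / real q"
          unfolding G_def d(3) lessThan_Suc_atMost of_int_mult of_int_sum sum_distrib_left sum_divide_distrib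
          by (intro sum.cong refl) (simp add: power_mult_distrib)
        finally show ?thesis by (simp only: ee_add ech_def mult.commute)
      qed
      moreover have "cmod (\<Sum>t<N. ee (\<Sum>i\<le>d + 2. a i * (0 + real t) ^ i)) \<le> C * (real N + real p powr (2/3)) * real p powr (- \<delta>)"
      proof (rule weyl)
        show "prime p" "d + 2 < p" using p d by auto
        have "\<not> int p dvd 2" using p k by (auto dest!: zdvd_imp_le)
        moreover have "\<not> int p dvd s" using s p by auto
        ultimately show "\<not> int p dvd s * 2 * c (k - 1)"
          using c(2) pp by (simp add: prime_dvd_mult_iff)
        have "real q = real p ^ (d + 2) * real p" by (simp add: q_def d(3) mult.commute)
        then show "a (d + 2) = real_of_int (s * 2 * c (k - 1)) / real p"
          using d p0 by (simp add: a_def)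
      qed
      ultimately show ?thesis by simp
    qed
    have g: "cmod (gauss p k r0) = sqrt (real q)" "cmod (gauss p k (- r0)) = sqrt (real q)"
      unfolding q_def using r0n by (auto intro!: norm_gauss[OF p(1) odd _ k2(2)] simp del: of_nat_power)
    have "(\<Sum>t<N. ee (\<theta> * (of_int u0 + real p * real t)) * kl q (u0 + int p * int t) b)
      = gauss p k r0 * (\<Sum>t<N. ee (\<theta> * (of_int u0 + real p * real t)) * ech q (1 * (2 * G (int t))))
      + gauss p k (- r0) * (\<Sum>t<N. ee (\<theta> * (of_int u0 + real p * real t)) * ech q (-1 * (2 * G (int t))))"
      unfolding klG sum_distrib_left sum.distrib[symmetric] by (intro sum.cong refl) (simp add: algebra_simps)
    also have "cmod \<dots> \<le> cmod (gauss p k r0) * (C * (real N + real p powr (2/3)) * real p powr (- \<delta>))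
        + cmod (gauss p k (- r0)) * (C * (real N + real p powr (2/3)) * real p powr (- \<delta>))"
      by (rule norm_triangle_le, rule add_mono; unfold norm_mult, intro mult_left_mono phase; simp)
    finally show ?thesis unfolding g by (simp add: q_def algebra_simps)
  qed
  then show ?thesis using C \<delta> by (intro exI[of _ "2 * C"] exI[of _ \<delta>] conjI allI impI) (assumption | simp)+
qed

text \<open>The inner bound is the ceiling of (L - \<rho>)/p, the number of j < L in the class of
  \<rho>. Adding p - 1 before subtracting \<rho> < p keeps the subtraction of natural numbers from
  truncating.\<close>

lemma sum_residue_classes:
  fixes g :: "nat \<Rightarrow> 'a :: comm_monoid_add"
  assumes p: "p > 0"
  shows "(\<Sum>j<L. g j) = (\<Sum>\<rho><p. \<Sum>t<(L + p - 1 - \<rho>) div p. g (\<rho> + p * t))"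
proof -
  have lt: "t < (L + p - 1 - \<rho>) div p \<longleftrightarrow> \<rho> + p * t < L" if "\<rho> < p" for \<rho> t
  proof -
    have "t < (L + p - 1 - \<rho>) div p \<longleftrightarrow> Suc t * p \<le> L + p - 1 - \<rho>"
      using p by (simp only: less_eq_div_iff_mult_less_eq Suc_le_eq[symmetric])
    also have "\<dots> \<longleftrightarrow> \<rho> + p * t < L" using that by (auto simp: mult.commute)
    finally show ?thesis .
  qed
  have "(\<Sum>\<rho><p. \<Sum>t<(L + p - 1 - \<rho>) div p. g (\<rho> + p * t))
    = (\<Sum>(\<rho>,t)\<in>(SIGMA \<rho>:{..<p}. {..<(L + p - 1 - \<rho>) div p}). g (\<rho> + p * t))"
    by (rule sum.Sigma) auto
  also have "\<dots> = (\<Sum>j<L. g j)"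
    by (rule sum.reindex_bij_witness[of _ "\<lambda>j. (j mod p, j div p)" "\<lambda>(\<rho>,t). \<rho> + p * t"])
      (use p lt in auto)
  finally show ?thesis ..
qed

text \<open>Each of the p residue classes has at most L/p + 1 terms, and the fixed cost p^(2/3) of a
  class is paid p times, which makes p^(5/3).\<close>

lemma kl_interval_sum_bound:
  assumes k: "k \<ge> 4"
  shows "\<exists>C>0. \<exists>\<delta>>0. \<delta> \<le> 1 / 9 \<and> (\<forall>p u0 b (\<theta>::real) L. prime (p::nat) \<longrightarrow> p > 2 * k \<longrightarrow> \<not> int p dvd b \<longrightarrow>
     cmod (\<Sum>j<L. ee (\<theta> * (of_int u0 + real j)) * kl (p ^ k) (u0 + int j) b)
       \<le> C * sqrt (real (p ^ k)) * (real L + real p powr (5/3)) * real p powr (- \<delta>))"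
proof -
  obtain C \<delta> where C: "C > 0" and \<delta>: "\<delta> > 0" "\<delta> \<le> 1/9" and
    cls: "\<And>p u0 b (\<theta>::real) N. prime (p::nat) \<Longrightarrow> p > 2 * k \<Longrightarrow> \<not> int p dvd b \<Longrightarrow>
     cmod (\<Sum>t<N. ee (\<theta> * (of_int u0 + real p * real t)) * kl (p ^ k) (u0 + int p * int t) b)
       \<le> C * sqrt (real (p ^ k)) * (real N + real p powr (2/3)) * real p powr (- \<delta>)"
    using kl_class_sum_bound[OF k] by blast
  have "cmod (\<Sum>j<L. ee (\<theta> * (of_int u0 + real j)) * kl (p ^ k) (u0 + int j) b)
       \<le> (2 * C) * sqrt (real (p ^ k)) * (real L + real p powr (5/3)) * real p powr (- \<delta>)"
    if p: "prime p" "p > 2 * k" and b: "\<not> int p dvd b" for p u0 b L and \<theta> :: real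
  proof -
    have p0: "p > 0" using p by simp
    define K where "K = C * sqrt (real (p ^ k)) * real p powr (- \<delta>)"
    have K0: "K \<ge> 0" using C by (simp add: K_def)
    have gen: "x \<le> C * S * n * D \<Longrightarrow> x \<le> C * S * D * n" for x S n D :: real
      by (simp add: mult_ac)
    let ?N = "\<lambda>\<rho>. (L + p - 1 - \<rho>) div p"
    have N: "real (?N \<rho>) \<le> real L / real p + 1" for \<rho>
    proof -
      have "p * ?N \<rho> \<le> L + p" by (rule order_trans[OF times_div_less_eq_dividend]) simp
      then have "real p * real (?N \<rho>) \<le> real L + real p" by (metis of_nat_add of_nat_le_iff of_nat_mult)
      then show ?thesis using p0 by (simp add: field_simps)
    qed
    have split: "(\<Sum>j<L. ee (\<theta> * (of_int u0 + real j)) * kl (p ^ k) (u0 + int j) b)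
      = (\<Sum>\<rho><p. \<Sum>t<?N \<rho>. ee (\<theta> * (of_int (u0 + int \<rho>) + real p * real t)) * kl (p ^ k) (u0 + int \<rho> + int p * int t) b)"
      by (subst sum_residue_classes[OF p0]) (simp add: add.assoc)
    have "cmod (\<Sum>j<L. ee (\<theta> * (of_int u0 + real j)) * kl (p ^ k) (u0 + int j) b)
      \<le> (\<Sum>\<rho><p. cmod (\<Sum>t<?N \<rho>. ee (\<theta> * (of_int (u0 + int \<rho>) + real p * real t)) * kl (p ^ k) (u0 + int \<rho> + int p * int t) b))"
      unfolding split by (rule norm_sum)
    also have "\<dots> \<le> (\<Sum>\<rho><p. K * (real L / real p + 1 + real p powr (2/3)))"
    proof (rule sum_mono)
      fix \<rho>
      have "cmod (\<Sum>t<?N \<rho>. ee (\<theta> * (of_int (u0 + int \<rho>) + real p * real t)) * kl (p ^ k) (u0 + int \<rho> + int p * int t) b)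
        \<le> K * (real (?N \<rho>) + real p powr (2/3))"
        unfolding K_def
        by (rule gen) (rule cls[OF p b])
      also have "\<dots> \<le> K * (real L / real p + 1 + real p powr (2/3))"
        using N K0 by (intro mult_left_mono add_right_mono) auto
      finally show "cmod (\<Sum>t<?N \<rho>. ee (\<theta> * (of_int (u0 + int \<rho>) + real p * real t)) * kl (p ^ k) (u0 + int \<rho> + int p * int t) b)
        \<le> K * (real L / real p + 1 + real p powr (2/3))" .
    qed
    also have "\<dots> = K * (real L + real p + real p * real p powr (2/3))"
      using p0 by (simp add: algebra_simps)
    also have "real p * real p powr (2/3) = real p powr (5/3)"
      using p0 by (simp add: powr_mult_base)
    also have "K * (real L + real p + real p powr (5/3)) \<le> K * (2 * (real L + real p powr (5/3)))"
    proof (intro mult_left_mono K0)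
      have "real p powr 1 \<le> real p powr (5/3)" using p0 by (intro powr_mono) auto
      then show "real L + real p + real p powr (5/3) \<le> 2 * (real L + real p powr (5/3))" by simp
    qed
    also have "K * (2 * (real L + real p powr (5/3)))
        = (2 * C) * sqrt (real (p ^ k)) * (real L + real p powr (5/3)) * real p powr (- \<delta>)"
      unfolding K_def by simp
    finally show ?thesis .
  qed
  then show ?thesis using C \<delta> by (intro exI[of _ "2 * C"] exI[of _ \<delta>] conjI allI impI) (assumption | simp)+
qed

text \<open>Unless the sum vanishes, it is made of two stationary contributions, each a Gauss sum of
  modulus sqrt q. Multiples u of p are covered because their sums are 0.\<close>

lemma norm_kl_le:
  assumes p: "prime p" "odd p" and k: "k \<ge> 2" and b: "\<not> int p dvd b"
  shows "cmod (kl (p ^ k) u b) \<le> 2 * sqrt (real (p ^ k))"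
proof (cases "kl (p ^ k) u b = 0")
  case False
  have pp: "prime (int p)" and p0: "p > 0" and k0: "k > 0" using p k by (simp_all add: prime_gt_0_nat)
  have u: "\<not> int p dvd u" using kl_eq_0[OF p(1) k _ b] False by blast
  obtain m where m: "[u * m * m = b] (mod int p)"
    using kl_nonzeroE[OF p0 k False] by blast
  have "[(u * m)\<^sup>2 = u * (u * m * m)] (mod int p)" by (simp add: power2_eq_square mult_ac)
  also have "[u * (u * m * m) = u * b] (mod int p)" using m by (rule cong_scalar_left)
  finally have "[(u * m)\<^sup>2 = b * u] (mod int p)" by (simp add: mult.commute)
  moreover have bu: "\<not> int p dvd b * u" using b u pp by (simp add: prime_dvd_mult_iff)
  ultimately obtain r where r: "[r\<^sup>2 = b * u] (mod int (p ^ k))"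
    using hensel_sqrt[OF p, of "b * u" "u * m" "k - 1"] k0 by auto
  have "[r\<^sup>2 = b * u] (mod int p)" by (rule cong_dvd_modulus[OF r]) (use k0 in auto)
  then have rn: "\<not> int p dvd r"
    using bu by (metis cong_dvd_iff dvd_mult2 power2_eq_square)
  have g: "cmod (gauss p k r) = sqrt (real (p ^ k))" "cmod (gauss p k (- r)) = sqrt (real (p ^ k))"
    using rn by (auto intro!: norm_gauss[OF p _ k0] simp del: of_nat_power)
  have "kl (p ^ k) u b = ech (p ^ k) (2 * r) * gauss p k r + ech (p ^ k) (- (2 * r)) * gauss p k (- r)"
    unfolding kl_square[OF p(1) b u r k0] by (rule kl_diag[OF p rn k])
  also have "cmod \<dots> \<le> cmod (ech (p ^ k) (2 * r) * gauss p k r) + cmod (ech (p ^ k) (- (2 * r)) * gauss p k (- r))"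
    by (rule norm_triangle_ineq)
  finally show ?thesis by (simp only: norm_mult norm_ech g)
qed simp

section \<open>Incomplete Kloosterman sums\<close>

definition kl_inc :: "nat \<Rightarrow> int \<Rightarrow> int \<Rightarrow> nat \<Rightarrow> complex" where
  "kl_inc q b X A = (\<Sum>j<A. kl_term q 0 b (X + int j))"

text \<open>The Fourier coefficient at \<open>u\<close> of the interval \<open>{X..<X + A}\<close> modulo \<open>q\<close>.\<close>

definition box_coeff :: "nat \<Rightarrow> int \<Rightarrow> nat \<Rightarrow> int \<Rightarrow> complex" where
  "box_coeff q X A u = (\<Sum>j<A. ech q (- (u * (X + int j)))) / of_nat q"

lemma kl_term_eq: "kl_term q u b m = ech q (u * m) * kl_term q 0 b m"
  by (simp add: kl_term_def ech_add)

lemma sum_residues_pick: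
  fixes f :: "int \<Rightarrow> 'a :: comm_monoid_add"
  assumes "q > 0" and f: "\<And>m n. [m = n] (mod int q) \<Longrightarrow> f m = f n"
  shows "(\<Sum>m\<in>{0..<int q}. if int q dvd m - n then f m else 0) = f n"
proof -
  have "(\<Sum>m\<in>{0..<int q}. if int q dvd m - n then f m else 0) = (\<Sum>m\<in>{0..<int q}. if m = n mod int q then f m else 0)"
  proof (intro sum.cong refl if_cong)
    fix m assume "m \<in> {0..<int q}"
    then have "m mod int q = m" by simp
    then show "int q dvd m - n \<longleftrightarrow> m = n mod int q"
      unfolding cong_iff_dvd_diff[symmetric] Cong.cong_def by simp
  qed
  also have "\<dots> = f (n mod int q)" using assms(1) by simp
  also have "\<dots> = f n" by (rule f) (simp add: Cong.cong_def)
  finally show ?thesis .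
qed

text \<open>Fourier inversion modulo q. The interval may be longer than q; \<open>box_coeff\<close>
  then counts residues with multiplicity.\<close>

lemma kl_inc_completion:
  assumes q: "q > 0"
  shows "kl_inc q b X A = (\<Sum>u\<in>{0..<int q}. box_coeff q X A u * kl q u b)"
proof -
  have orth: "(\<Sum>u\<in>{0..<int q}. ech q (- (u * n)) * ech q (u * m)) = (if int q dvd m - n then of_nat q else 0)" for m n
  proof -
    have "(\<Sum>u\<in>{0..<int q}. ech q (- (u * n)) * ech q (u * m)) = (\<Sum>u\<in>{0..<int q}. ech q (u * (m - n)))"
      unfolding ech_add[symmetric] by (simp add: algebra_simps)
    also have "\<dots> = (\<Sum>u<q. ech q (int u * (m - n)))" by (rule sum_interval_int[symmetric])
    finally show ?thesis using sum_ech_orthogonal[OF q] by simp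
  qed
  have "of_nat q * (\<Sum>u\<in>{0..<int q}. box_coeff q X A u * kl q u b)
    = (\<Sum>u\<in>{0..<int q}. \<Sum>j<A. \<Sum>m\<in>{0..<int q}. ech q (- (u * (X + int j))) * ech q (u * m) * kl_term q 0 b m)"
    using q unfolding sum_distrib_left
  proof (intro sum.cong refl)
    fix u
    show "of_nat q * (box_coeff q X A u * kl q u b)
      = (\<Sum>j<A. \<Sum>m\<in>{0..<int q}. ech q (- (u * (X + int j))) * ech q (u * m) * kl_term q 0 b m)"
      unfolding box_coeff_def kl_def kl_term_eq[of q u] using q
      by (simp add: sum_product mult.assoc)
  qed
  also have "\<dots> = (\<Sum>j<A. \<Sum>u\<in>{0..<int q}. \<Sum>m\<in>{0..<int q}. ech q (- (u * (X + int j))) * ech q (u * m) * kl_term q 0 b m)"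
    by (rule sum.swap)
  also have "\<dots> = (\<Sum>j<A. \<Sum>m\<in>{0..<int q}. \<Sum>u\<in>{0..<int q}. ech q (- (u * (X + int j))) * ech q (u * m) * kl_term q 0 b m)"
    by (rule sum.cong[OF refl], rule sum.swap)
  also have "\<dots> = (\<Sum>j<A. \<Sum>m\<in>{0..<int q}. of_nat q * (if int q dvd m - (X + int j) then kl_term q 0 b m else 0))"
    unfolding sum_distrib_right[symmetric] orth by (intro sum.cong refl) simp
  also have "\<dots> = of_nat q * kl_inc q b X A"
    unfolding sum_distrib_left[symmetric] kl_inc_def
    by (subst sum_residues_pick[OF q]) (auto intro: kl_term_cong)
  finally show ?thesis using q by simp
qed

lemma norm_box_coeff_le:
  assumes "q > 0"
  shows "cmod (box_coeff q X A u) \<le> real A / real q"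
proof -
  have "cmod (\<Sum>j<A. ech q (- (u * (X + int j)))) \<le> (\<Sum>j<A. cmod (ech q (- (u * (X + int j)))))"
    by (rule norm_sum)
  then show ?thesis using assms by (simp add: box_coeff_def norm_divide divide_right_mono)
qed

lemma box_coeff_geometric:
  assumes "q > 0" "\<not> int q dvd u"
  shows "box_coeff q X A u = (ech q (- (u * X)) - ech q (- (u * (X + int A)))) / (1 - ech q (- u)) / of_nat q"
proof -
  have ne: "ech q (- u) \<noteq> 1" using assms by (simp add: ech_eq_1_iff)
  have "(\<Sum>j<A. ech q (- (u * (X + int j)))) = ech q (- (u * X)) * (\<Sum>j<A. ech q (- u) ^ j)"
    unfolding sum_distrib_left
  proof (intro sum.cong refl)
    fix j
    have "- (u * (X + int j)) = - (u * X) + int j * (- u)" by (simp add: algebra_simps)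
    then show "ech q (- (u * (X + int j))) = ech q (- (u * X)) * ech q (- u) ^ j"
      by (simp only: ech_add ech_mult_nat)
  qed
  also have "\<dots> = ech q (- (u * X)) * ((1 - ech q (- u) ^ A) / (1 - ech q (- u)))"
    using ne by (simp add: sum_gp_strict)
  also have "\<dots> = (ech q (- (u * X)) - ech q (- (u * X)) * ech q (- u) ^ A) / (1 - ech q (- u))"
    by (simp add: algebra_simps)
  also have "ech q (- (u * X)) * ech q (- u) ^ A = ech q (- (u * (X + int A)))"
    unfolding ech_mult_nat[symmetric] ech_add[symmetric] by (simp add: algebra_simps)
  finally show ?thesis by (simp add: box_coeff_def)
qed

lemma norm_box_coeff_le_inverse:
  assumes u: "u \<in> {1..<int q}"
  shows "cmod (box_coeff q X A u) \<le> 1 / (2 * real_of_int (min u (int q - u)))"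
proof -
  have q: "q > 0" using u by auto
  have nd: "\<not> int q dvd u" "\<not> int q dvd - u" using u by (auto dest: zdvd_imp_le)
  have "(- u) mod int q = int q - u" using u by (simp add: zmod_zminus1_eq_if)
  then have ge: "cmod (1 - ech q (- u)) \<ge> 4 / real q * real_of_int (min u (int q - u))"
    using norm_one_minus_ech_ge(1)[OF nd(2) q] by (simp add: min.commute)
  have pos: "4 / real q * real_of_int (min u (int q - u)) > 0" using u q by auto
  have "cmod (ech q (- (u * X)) - ech q (- (u * (X + int A)))) \<le> 2"
    using norm_triangle_ineq4[of "ech q (- (u * X))"] by (metis norm_ech one_add_one)
  then have "cmod (box_coeff q X A u) \<le> 2 / cmod (1 - ech q (- u)) / real q"
    unfolding box_coeff_geometric[OF q nd(1)] norm_divide by (simp add: divide_right_mono)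
  also have "\<dots> \<le> 2 / (4 / real q * real_of_int (min u (int q - u))) / real q"
    by (intro divide_right_mono divide_left_mono[OF ge] mult_pos_pos[OF less_le_trans[OF pos ge] pos]) auto
  also have "\<dots> = 1 / (2 * real_of_int (min u (int q - u)))" using q by simp
  finally show ?thesis .
qed

text \<open>The Polya-Vinogradov argument: complete sums are at most 2 sqrt q and the coefficients
  add up to a logarithm. The length A does not enter because the frequency 0, the only one whose
  coefficient grows with A, carries a vanishing Kloosterman sum.\<close>

lemma kl_inc_weak:
  assumes p: "prime p" "odd p" and k: "k \<ge> 2" and b: "\<not> int p dvd b"
  shows "cmod (kl_inc (p ^ k) b X A) \<le> 2 * sqrt (real (p ^ k)) * (1 + ln (real (p ^ k)))"
proof -
  define q where "q = p ^ k"
  have "p ^ 1 \<le> q" unfolding q_def using prime_gt_0_nat[OF p(1)] k by (intro power_increasing) auto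
  then have q: "q > 1" using prime_ge_2_nat[OF p(1)] by simp
  have "kl_inc q b X A = (\<Sum>u\<in>{0..<int q}. box_coeff q X A u * kl q u b)"
    using q by (intro kl_inc_completion) auto
  also have "\<dots> = (\<Sum>u\<in>{1..<int q}. box_coeff q X A u * kl q u b)"
  proof (rule sum.mono_neutral_right)
    have "kl q 0 b = 0" unfolding q_def using kl_eq_0[OF p(1) k _ b, of 0] by simp
    moreover have "{0..<int q} - {1..<int q} \<subseteq> {0}" by auto
    ultimately show "\<forall>u\<in>{0..<int q} - {1..<int q}. box_coeff q X A u * kl q u b = 0" by auto
  qed auto
  also have "cmod \<dots> \<le> (\<Sum>u\<in>{1..<int q}. 1 / (2 * real_of_int (min u (int q - u))) * (2 * sqrt (real q)))"
  proof (rule sum_norm_le)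
    fix u assume "u \<in> {1..<int q}"
    then show "cmod (box_coeff q X A u * kl q u b) \<le> 1 / (2 * real_of_int (min u (int q - u))) * (2 * sqrt (real q))"
      unfolding norm_mult
      by (intro mult_mono norm_box_coeff_le_inverse norm_kl_le[OF p k b, folded q_def]) auto
  qed
  also have "\<dots> = sqrt (real q) * (\<Sum>u\<in>{1..<int q}. 1 / real_of_int (min u (int q - u)))"
    unfolding sum_distrib_left by (intro sum.cong refl) simp
  also have "\<dots> \<le> sqrt (real q) * (2 * (1 + ln (real q)))"
    by (intro mult_left_mono sum_inverse_min_residue_le q) auto
  also have "\<dots> = 2 * sqrt (real q) * (1 + ln (real q))" by simp
  finally show ?thesis unfolding q_def .
qed

section \<open>Cancellation in the completed sum\<close>

lemma abel_summation:
  fixes g w :: "nat \<Rightarrow> complex"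
  shows "(\<Sum>j<n. g j * w j) = (\<Sum>j<n. g j) * w n + (\<Sum>j<n. (\<Sum>i<Suc j. g i) * (w j - w (Suc j)))"
  by (induction n) (simp_all add: algebra_simps)

text \<open>The frequencies are cut at p^(5/3). Below the cut averaging over u gains nothing, and
  the bounds A/q and 2 sqrt q are used termwise. Above it the coefficient is the difference of e(-u
  X/q) and e(-u (X + A)/q), divided by q (1 - e(-u/q)). The characters become the twist \<theta>;
  the factor 1/(1 - e(-u/q)), of size q/u with increments of size q/u^2, is removed by partial
  summation. Only half a period is treated because this factor grows again near q.\<close>

lemma kl_box_half_bound:
  assumes k: "k \<ge> 4"
  shows "\<exists>C>0. \<exists>\<delta>>0. \<delta> \<le> 1 / 9 \<and> (\<forall>p b X A H. prime (p::nat) \<longrightarrow> p > 2 * k \<longrightarrow> \<not> int p dvd b \<longrightarrow> 2 * H < p ^ k \<longrightarrow>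
     cmod (\<Sum>j<H. box_coeff (p ^ k) X A (int (Suc j)) * kl (p ^ k) (int (Suc j)) b)
       \<le> C * (1 + ln (real (p ^ k))) * (real A * real p powr (5/3) / sqrt (real (p ^ k)) + sqrt (real (p ^ k)) * real p powr (- \<delta>)))"
proof -
  obtain C \<delta> where C: "C > 0" and \<delta>: "\<delta> > 0" "\<delta> \<le> 1/9" and
    interval: "\<And>p u0 b (\<theta>::real) L. prime (p::nat) \<Longrightarrow> p > 2 * k \<Longrightarrow> \<not> int p dvd b \<Longrightarrow>
     cmod (\<Sum>j<L. ee (\<theta> * (of_int u0 + real j)) * kl (p ^ k) (u0 + int j) b)
       \<le> C * sqrt (real (p ^ k)) * (real L + real p powr (5/3)) * real p powr (- \<delta>)"
    using kl_interval_sum_bound[OF k] by blast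
  have "cmod (\<Sum>j<H. box_coeff (p ^ k) X A (int (Suc j)) * kl (p ^ k) (int (Suc j)) b)
       \<le> (4 + 10 * C) * (1 + ln (real (p ^ k))) * (real A * real p powr (5/3) / sqrt (real (p ^ k)) + sqrt (real (p ^ k)) * real p powr (- \<delta>))"
    if p: "prime p" "p > 2 * k" and b: "\<not> int p dvd b" and H: "2 * H < p ^ k" for p b X A H
  proof -
    define q where "q = p ^ k"
    define P where "P = real p powr (5/3)"
    define K where "K = C * sqrt (real q) * real p powr (- \<delta>)"
    define U where "U = min H (nat \<lceil>P\<rceil>)"
    define n where "n = H - U"
    have odd: "odd p" using p k by (intro prime_odd_nat) auto
    have q: "q > 0" using p by (simp add: q_def)
    have q1: "q \<ge> 9"
    proof -
      have "9 \<le> p" using p k by simp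
      also have "p ^ 1 \<le> p ^ k" using p k by (intro power_increasing) auto
      finally show ?thesis by (simp add: q_def)
    qed
    have K0: "K \<ge> 0" using C by (simp add: K_def)
    have P1: "P \<ge> 1" using p by (auto simp: P_def intro!: ge_one_powr_ge_zero)
    have lnq: "ln (real q) \<ge> 0" using q by simp
    let ?B = "\<lambda>j. box_coeff q X A (int (Suc j)) * kl q (int (Suc j)) b"
    have low: "cmod (\<Sum>j<U. ?B j) \<le> 4 * (real A * P / sqrt (real q))"
    proof -
      have "cmod (\<Sum>j<U. ?B j) \<le> (\<Sum>j<U. real A / real q * (2 * sqrt (real q)))"
      proof (rule sum_norm_le)
        fix j
        have "cmod (kl q (int (Suc j)) b) \<le> 2 * sqrt (real q)"
          unfolding q_def using k by (intro norm_kl_le p odd b) simp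
        then show "cmod (?B j) \<le> real A / real q * (2 * sqrt (real q))"
          unfolding norm_mult by (intro mult_mono norm_box_coeff_le q) auto
      qed
      also have "\<dots> = real U * (2 * (real A / sqrt (real q)))"
        using q by (simp add: field_simps)
      also have "\<dots> \<le> (2 * P) * (2 * (real A / sqrt (real q)))"
      proof (intro mult_right_mono)
        have "real U \<le> real (nat \<lceil>P\<rceil>)" by (simp add: U_def)
        also have "\<dots> \<le> 2 * P" using P1 by linarith
        finally show "real U \<le> 2 * P" .
      qed auto
      also have "\<dots> = 4 * (real A * P / sqrt (real q))" by simp
      finally show ?thesis .
    qed
    have high: "cmod (\<Sum>j<n. ?B (U + j)) \<le> 10 * K * (1 + ln (real q))"
    proof (cases "n = 0")
      case True
      then show ?thesis using K0 lnq by simp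
    next
      case False
      \<comment> \<open>A nonempty upper range means that H exceeds the cut, so U \<ge> p^(5/3)
        absorbs the fixed cost of every partial sum.\<close>
      then have UP: "real U \<ge> P" "U + n = H" unfolding n_def U_def using P1 by linarith+
      define \<omega> where "\<omega> j = 1 / (1 - ech q (- int (Suc (U + j))))" for j
      have \<omega>: "cmod (\<omega> j) \<le> real q / (2 * real (Suc (U + j)))" "ech q (- int (Suc (U + j))) \<noteq> 1" if "j \<le> n" for j
      proof -
        define u where "u = int (Suc (U + j))"
        \<comment> \<open>Partial summation evaluates \<omega> also at j = n, where u = H + 1 may
          exceed q/2. The bound 3 u \<le> 2 q still gives u \<le> 2 min(u, q - u).\<close>
        have ub: "u \<ge> 1" "3 * u \<le> 2 * int q" "u < int q"
        proof -
          have "U + j \<le> H" using that UP by linarith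
          then show "u \<ge> 1" "3 * u \<le> 2 * int q" "u < int q"
            using H[folded q_def] q1 unfolding u_def by simp_all
        qed
        have nd: "\<not> int q dvd - u" using ub by (auto dest: zdvd_imp_le)
        show "ech q (- int (Suc (U + j))) \<noteq> 1" using nd q unfolding u_def[symmetric] by (simp add: ech_eq_1_iff)
        have "(- u) mod int q = int q - u" using ub by (simp add: zmod_zminus1_eq_if)
        then have ge: "cmod (1 - ech q (- u)) \<ge> 4 / real q * real_of_int (min u (int q - u))"
          using norm_one_minus_ech_ge(1)[OF nd q] by (simp add: min.commute)
        have "u \<le> 2 * min u (int q - u)" using ub by (simp add: min_def)
        then have "real_of_int u \<le> real_of_int (2 * min u (int q - u))" by (simp only: of_int_le_iff)
        then have "real_of_int u / 2 \<le> real_of_int (min u (int q - u))" unfolding of_int_mult by simp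
        then have "4 / real q * (real_of_int u / 2) \<le> 4 / real q * real_of_int (min u (int q - u))"
          by (intro mult_left_mono) auto
        then have le: "2 * real_of_int u / real q \<le> cmod (1 - ech q (- u))" using ge by simp
        have pos: "2 * real_of_int u / real q > 0" using ub q by simp
        have "1 / cmod (1 - ech q (- u)) \<le> 1 / (2 * real_of_int u / real q)"
          by (rule divide_left_mono[OF le _ mult_pos_pos[OF less_le_trans[OF pos le] pos]]) simp
        then show "cmod (\<omega> j) \<le> real q / (2 * real (Suc (U + j)))"
          by (simp add: \<omega>_def norm_divide u_def)
      qed
      have d\<omega>: "cmod (\<omega> j - \<omega> (Suc j)) \<le> 2 * real q / (real (Suc (U + j)))\<^sup>2" if "j < n" for j
      proof -
        let ?z = "ech q (- int (Suc (U + j)))" and ?z' = "ech q (- int (Suc (U + Suc j)))"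
        \<comment> \<open>1/(1 - z) - 1/(1 - z') = (z - z')/((1 - z)(1 - z')), and neighbouring
          characters differ by at most 2 pi/q \<le> 8/q.\<close>
        have diff: "\<omega> j - \<omega> (Suc j) = (?z - ?z') * (\<omega> j * \<omega> (Suc j))"
          using \<omega>(2)[of j] \<omega>(2)[of "Suc j"] that by (simp add: \<omega>_def field_simps)
        have "?z' = ?z * ech q (- 1)"
          unfolding ech_add[symmetric] by simp
        then have "?z - ?z' = ?z * (1 - ech q (- 1))" by (simp add: algebra_simps)
        then have "cmod (?z - ?z') = cmod (1 - ee (- 1 / real q))"
          by (simp add: norm_mult ech_def)
        also have "cmod (1 - ee (- 1 / real q)) \<le> 2 * pi * \<bar>- 1 / real q\<bar>"
          by (rule norm_one_minus_ee_le)
        also have "2 * pi * \<bar>- 1 / real q\<bar> \<le> 8 / real q"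
          using pi_less_4 q by (simp add: divide_right_mono)
        finally have "cmod (\<omega> j - \<omega> (Suc j)) \<le> 8 / real q * (cmod (\<omega> j) * cmod (\<omega> (Suc j)))"
          unfolding diff norm_mult by (intro mult_right_mono) auto
        also have "\<dots> \<le> 8 / real q * ((real q / (2 * real (Suc (U + j)))) * (real q / (2 * real (Suc (U + j)))))"
        proof (intro mult_left_mono mult_mono)
          have "cmod (\<omega> (Suc j)) \<le> real q / (2 * real (Suc (U + Suc j)))" using that by (intro \<omega>(1)) simp
          also have "\<dots> \<le> real q / (2 * real (Suc (U + j)))" by (intro divide_left_mono) auto
          finally show "cmod (\<omega> (Suc j)) \<le> real q / (2 * real (Suc (U + j)))" .
        qed (use that \<omega>(1)[of j] in auto)
        also have "\<dots> = 2 * real q / (real (Suc (U + j)))\<^sup>2"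
        proof -
          have gen: "8 / Q * (Q / (2 * x) * (Q / (2 * x))) = 2 * Q / x\<^sup>2" if "Q > 0" "x > 0" for Q x :: real
            using that by (simp add: power2_eq_square field_simps)
          show ?thesis by (rule gen) (use q in auto)
        qed
        finally show ?thesis .
      qed
      \<comment> \<open>Applied below with Y = X and Y = X + A, the two ends of the
        interval.\<close>
      have part: "cmod (\<Sum>j<n. ech q (- (int (Suc (U + j)) * Y)) * kl q (int (Suc (U + j))) b * \<omega> j)
          \<le> 5 * K * real q * (1 + ln (real q))" for Y
      proof -
        define g where "g j = ech q (- (int (Suc (U + j)) * Y)) * kl q (int (Suc (U + j))) b" for j
        have G: "cmod (\<Sum>j<L. g j) \<le> K * real (U + L)" for L
        proof -
          have geq: "g j = ee (- of_int Y / real q * (of_int (int (Suc U)) + real j)) * kl q (int (Suc U) + int j) b" for j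
          proof -
            have e1: "real_of_int (- (int (Suc (U + j)) * Y)) / real q = - of_int Y / real q * (of_int (int (Suc U)) + real j)"
              using q by (simp add: field_simps)
            have e2: "int (Suc (U + j)) = int (Suc U) + int j" by simp
            show ?thesis unfolding g_def ech_def e1 by (simp only: e2)
          qed
          have "cmod (\<Sum>j<L. g j) \<le> C * sqrt (real q) * (real L + P) * real p powr (- \<delta>)"
            unfolding geq P_def by (rule interval[OF p b, folded q_def])
          also have "\<dots> = K * (real L + P)" by (simp add: K_def)
          also have "\<dots> \<le> K * real (U + L)" using UP K0 by (intro mult_left_mono) auto
          finally show ?thesis .
        qed
        have "cmod (\<Sum>j<n. g j * \<omega> j) \<le> cmod (\<Sum>j<n. g j) * cmod (\<omega> n)
            + (\<Sum>j<n. cmod (\<Sum>i<Suc j. g i) * cmod (\<omega> j - \<omega> (Suc j)))"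
          unfolding abel_summation[of g] norm_mult[symmetric]
          by (rule norm_triangle_le, rule add_left_mono, rule norm_sum)
        also have "cmod (\<Sum>j<n. g j) * cmod (\<omega> n) \<le> (K * real (U + n)) * (real q / (2 * real (Suc (U + n))))"
          using G \<omega>(1)[of n] K0 by (intro mult_mono) auto
        also have "\<dots> = (K * real q) * (real (U + n) / (2 * real (Suc (U + n))))" by simp
        also have "\<dots> \<le> (K * real q) * 1"
          using K0 by (intro mult_left_mono) auto
        also have "(\<Sum>j<n. cmod (\<Sum>i<Suc j. g i) * cmod (\<omega> j - \<omega> (Suc j)))
            \<le> (\<Sum>j<n. (K * real (Suc (U + j))) * (2 * real q / (real (Suc (U + j)))\<^sup>2))"
        proof (intro sum_mono mult_mono)
          fix j assume "j \<in> {..<n}"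
          then show "cmod (\<omega> j - \<omega> (Suc j)) \<le> 2 * real q / (real (Suc (U + j)))\<^sup>2" by (intro d\<omega>) simp
          show "cmod (\<Sum>i<Suc j. g i) \<le> K * real (Suc (U + j))" using G[of "Suc j"] by (simp only: add_Suc_right)
        qed (use K0 in auto)
        also have "\<dots> = 2 * K * real q * (\<Sum>j<n. 1 / real (Suc (U + j)))"
          unfolding sum_distrib_left by (intro sum.cong refl) (simp add: power2_eq_square)
        also have "(\<Sum>j<n. 1 / real (Suc (U + j))) = (\<Sum>i\<in>{Suc U..U + n}. 1 / real i)"
          by (rule sum.reindex_bij_witness[of _ "\<lambda>i. i - Suc U" "\<lambda>j. Suc (U + j)"]) auto
        also have "\<dots> \<le> (\<Sum>i\<in>{1..q}. 1 / real i)"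
          using UP H by (intro sum_mono2) (auto simp: q_def)
        also have "\<dots> \<le> 1 + ln (real q)" using q by (rule harm_le_one_plus_ln)
        finally have "cmod (\<Sum>j<n. g j * \<omega> j) \<le> K * real q * 1 + 2 * K * real q * (1 + ln (real q))"
          using K0 by (simp add: mult_left_mono)
        also have "\<dots> \<le> 5 * K * real q * (1 + ln (real q))"
          using K0 lnq mult_nonneg_nonneg[of "K * real q" "ln (real q)"] by (simp add: algebra_simps)
        finally show ?thesis by (simp add: g_def)
      qed
      have "?B (U + j) = (ech q (- (int (Suc (U + j)) * X)) * kl q (int (Suc (U + j))) b * \<omega> j
          - ech q (- (int (Suc (U + j)) * (X + int A))) * kl q (int (Suc (U + j))) b * \<omega> j) / of_nat q" if "j < n" for j
      proof -
        have nd: "\<not> int q dvd int (Suc (U + j))"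
          using \<omega>(2)[of j] that q by (simp add: ech_eq_1_iff del: of_nat_Suc)
        have gen: "(a - c) / d / Q * e = (a * e * (1 / d) - c * e * (1 / d)) / Q" for a c d e Q :: complex
          by (simp add: divide_inverse algebra_simps)
        show ?thesis unfolding \<omega>_def box_coeff_geometric[OF q nd] by (rule gen)
      qed
      then have "(\<Sum>j<n. ?B (U + j)) = ((\<Sum>j<n. ech q (- (int (Suc (U + j)) * X)) * kl q (int (Suc (U + j))) b * \<omega> j)
          - (\<Sum>j<n. ech q (- (int (Suc (U + j)) * (X + int A))) * kl q (int (Suc (U + j))) b * \<omega> j)) / of_nat q"
        unfolding sum_subtractf[symmetric] sum_divide_distrib by (intro sum.cong) auto
      also have "cmod \<dots> \<le> (5 * K * real q * (1 + ln (real q)) + 5 * K * real q * (1 + ln (real q))) / real q"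
        unfolding norm_divide norm_of_nat
        by (intro divide_right_mono order_trans[OF norm_triangle_ineq4] add_mono part) auto
      also have "\<dots> = 10 * K * (1 + ln (real q))" using q by (simp add: field_simps)
      finally show ?thesis .
    qed
    have "(\<Sum>j<H. ?B j) = (\<Sum>j<U. ?B j) + (\<Sum>j<n. ?B (U + j))"
    proof -
      have "H = U + n" by (simp add: n_def U_def)
      then show ?thesis by (simp only: sum_lessThan_split)
    qed
    also have "cmod \<dots> \<le> 4 * (real A * P / sqrt (real q)) + 10 * K * (1 + ln (real q))"
      by (rule norm_triangle_le[OF add_mono[OF low high]])
    also have "\<dots> \<le> (4 + 10 * C) * (1 + ln (real q)) * (real A * P / sqrt (real q)) + (4 + 10 * C) * (1 + ln (real q)) * (sqrt (real q) * real p powr (- \<delta>))"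
    proof (rule add_mono)
      have "4 * 1 \<le> (4 + 10 * C) * (1 + ln (real q))" using C lnq by (intro mult_mono) auto
      then show "4 * (real A * P / sqrt (real q)) \<le> (4 + 10 * C) * (1 + ln (real q)) * (real A * P / sqrt (real q))"
        using P1 by (intro mult_right_mono) auto
      have "10 * K * (1 + ln (real q)) = 10 * C * (1 + ln (real q)) * (sqrt (real q) * real p powr (- \<delta>))"
        by (simp add: K_def)
      also have "\<dots> \<le> (4 + 10 * C) * (1 + ln (real q)) * (sqrt (real q) * real p powr (- \<delta>))"
        using C lnq by (intro mult_right_mono) auto
      finally show "10 * K * (1 + ln (real q)) \<le> (4 + 10 * C) * (1 + ln (real q)) * (sqrt (real q) * real p powr (- \<delta>))" .
    qed
    finally show ?thesis by (simp add: q_def P_def algebra_simps)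
  qed
  then show ?thesis using C \<delta> by (intro exI[of _ "4 + 10 * C"] exI[of _ \<delta>] conjI allI impI) (assumption | simp)+
qed

lemma box_coeff_minus: "box_coeff q X A (- u) = cnj (box_coeff q X A u)"
  by (simp add: box_coeff_def ech_minus)

lemma kl_minus: "kl q (- u) b = cnj (kl q u (- b))"
proof -
  have "kl_term q (- u) b m = cnj (kl_term q u (- b) m)" for m
    using ech_minus[of q "u * m - b * modular_inverse (int q) m"] by (simp add: kl_term_def algebra_simps)
  then show ?thesis by (simp add: kl_def)
qed

lemma kl_term_cong_coeff:
  assumes "[u = v] (mod int q)" "[b = c] (mod int q)"
  shows "kl_term q u b m = kl_term q v c m"
  using assms by (auto simp: kl_term_def intro!: ech_cong cong_add cong_scalar_right)

lemma box_coeff_cong: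
  assumes "[u = v] (mod int q)"
  shows "box_coeff q X A u = box_coeff q X A v"
proof -
  have "ech q (- (u * x)) = ech q (- (v * x))" for x
    using assms by (intro ech_cong) (simp add: cong_minus_minus_iff cong_scalar_right)
  then show ?thesis by (simp add: box_coeff_def)
qed

text \<open>Frequencies above q/2 are negatives of those below, so the upper half of the completed
  sum is the conjugate of a lower half belonging to -b. Primes p \<le> 2k are out of reach of the
  Weyl argument, but for them p^(-\<delta>) is bounded below and the weak estimate is
  enough.\<close>

lemma kl_inc_strong:
  assumes k: "k \<ge> 4"
  shows "\<exists>C>0. \<exists>\<delta>>0. \<delta> \<le> 1 / 9 \<and> (\<forall>p b X A. prime (p::nat) \<longrightarrow> odd p \<longrightarrow> \<not> int p dvd b \<longrightarrow>
     cmod (kl_inc (p ^ k) b X A)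
       \<le> C * (1 + ln (real (p ^ k))) * (real A * real p powr (5/3) / sqrt (real (p ^ k)) + sqrt (real (p ^ k)) * real p powr (- \<delta>)))"
proof -
  obtain C \<delta> where C: "C > 0" and \<delta>: "\<delta> > 0" "\<delta> \<le> 1/9" and
    half: "\<And>p b X A H. prime (p::nat) \<Longrightarrow> p > 2 * k \<Longrightarrow> \<not> int p dvd b \<Longrightarrow> 2 * H < p ^ k \<Longrightarrow>
     cmod (\<Sum>j<H. box_coeff (p ^ k) X A (int (Suc j)) * kl (p ^ k) (int (Suc j)) b)
       \<le> C * (1 + ln (real (p ^ k))) * (real A * real p powr (5/3) / sqrt (real (p ^ k)) + sqrt (real (p ^ k)) * real p powr (- \<delta>))"
    using kl_box_half_bound[OF k] by blast
  \<comment> \<open>2 C for the two halves of the period, and 2 (2k)^\<delta> to pay for p^\<delta>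
    when p \<le> 2k.\<close>
  define D where "D = 2 * C + 2 * real (2 * k) powr \<delta>"
  have D: "D > 0" "D \<ge> 2 * C" "D \<ge> 2 * real (2 * k) powr \<delta>" using C by (auto simp: D_def intro: add_pos_nonneg)
  have "cmod (kl_inc (p ^ k) b X A)
       \<le> D * (1 + ln (real (p ^ k))) * (real A * real p powr (5/3) / sqrt (real (p ^ k)) + sqrt (real (p ^ k)) * real p powr (- \<delta>))"
    if p: "prime p" "odd p" and b: "\<not> int p dvd b" for p b X A
  proof -
    define q where "q = p ^ k"
    define E where "E = real A * real p powr (5/3) / sqrt (real q) + sqrt (real q) * real p powr (- \<delta>)"
    have p0: "p > 0" using p by (simp add: prime_gt_0_nat)
    then have q0: "q > 0" by (simp add: q_def)
    have k2: "k \<ge> 2" using k by simp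
    have lnq: "ln (real q) \<ge> 0" using q0 by simp
    have E: "E \<ge> sqrt (real q) * real p powr (- \<delta>)" "E \<ge> 0" by (simp_all add: E_def)
    show ?thesis
    proof (cases "p > 2 * k")
      case True
      define H where "H = q div 2"
      have "odd q" using p by (simp add: q_def)
      then have H: "q = 2 * H + 1" unfolding H_def by (metis odd_two_times_div_two_succ)
      let ?f = "\<lambda>u b. box_coeff q X A u * kl q u b"
      have "kl q 0 b = 0" unfolding q_def using kl_eq_0[OF p(1) k2 _ b, of 0] by simp
      then have "kl_inc q b X A = (\<Sum>u\<in>{1..<int q}. ?f u b)"
        unfolding kl_inc_completion[OF q0]
      proof (intro sum.mono_neutral_right)
        assume "kl q 0 b = 0"
        moreover have "{0..<int q} - {1..<int q} \<subseteq> {0}" by auto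
        ultimately show "\<forall>u\<in>{0..<int q} - {1..<int q}. ?f u b = 0" by auto
      qed auto
      also have "{1..<int q} = {1..int H} \<union> {int H + 1..<int q}" using H by auto
      also have "(\<Sum>u\<in>\<dots>. ?f u b) = (\<Sum>u\<in>{1..int H}. ?f u b) + (\<Sum>u\<in>{int H + 1..<int q}. ?f u b)"
        by (rule sum.union_disjoint) auto
      also have "(\<Sum>u\<in>{1..int H}. ?f u b) = (\<Sum>j<H. ?f (int (Suc j)) b)"
        by (rule sum.reindex_bij_witness[of _ "\<lambda>j. int (Suc j)" "\<lambda>u. nat u - 1"]) auto
      also have "(\<Sum>u\<in>{int H + 1..<int q}. ?f u b) = (\<Sum>j<H. cnj (?f (int (Suc j)) (- b)))"
      proof (rule sum.reindex_bij_witness[of _ "\<lambda>j. int q - int (Suc j)" "\<lambda>u. nat (int q - u) - 1"])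
        fix u assume u: "u \<in> {int H + 1..<int q}"
        define v where "v = int q - u"
        have "int (Suc (nat (int q - u) - 1)) = v" using u by (simp add: v_def)
        moreover have c: "[u = - v] (mod int q)" by (simp add: v_def cong_iff_dvd_diff)
        have "kl q u b = kl q (- v) b"
          unfolding kl_def by (intro sum.cong refl kl_term_cong_coeff c cong_refl)
        then have "?f u b = cnj (?f v (- b))"
          by (simp add: box_coeff_cong[OF c] box_coeff_minus kl_minus)
        ultimately show "cnj (?f (int (Suc (nat (int q - u) - 1))) (- b)) = ?f u b" by simp
      qed (use H in auto)
      also have "\<dots> = cnj (\<Sum>j<H. ?f (int (Suc j)) (- b))" by (rule cnj_sum[symmetric])
      finally have eq: "kl_inc q b X A = (\<Sum>j<H. ?f (int (Suc j)) b) + cnj (\<Sum>j<H. ?f (int (Suc j)) (- b))" .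
      have H2: "2 * H < p ^ k" using H by (simp add: q_def)
      have "cmod (kl_inc q b X A) \<le> C * (1 + ln (real q)) * E + C * (1 + ln (real q)) * E"
        unfolding eq
      proof (rule norm_triangle_le, rule add_mono)
        show "cmod (\<Sum>j<H. ?f (int (Suc j)) b) \<le> C * (1 + ln (real q)) * E"
          unfolding E_def q_def by (rule half[OF p(1) True b H2])
        have "\<not> int p dvd - b" using b by simp
        then show "cmod (cnj (\<Sum>j<H. ?f (int (Suc j)) (- b))) \<le> C * (1 + ln (real q)) * E"
          unfolding E_def q_def complex_mod_cnj by (rule half[OF p(1) True _ H2])
      qed
      also have "\<dots> = 2 * C * ((1 + ln (real q)) * E)" by simp
      also have "\<dots> \<le> D * ((1 + ln (real q)) * E)"
        using D lnq E by (intro mult_right_mono) auto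
      finally show ?thesis by (simp add: E_def q_def mult.assoc)
    next
      case False
      have "cmod (kl_inc q b X A) \<le> 2 * sqrt (real q) * (1 + ln (real q))"
        unfolding q_def by (rule kl_inc_weak[OF p k2 b])
      also have "\<dots> = 2 * (real p powr \<delta> * real p powr (- \<delta>)) * sqrt (real q) * (1 + ln (real q))"
        using p0 by (simp flip: powr_add)
      also have "\<dots> = (2 * real p powr \<delta>) * ((1 + ln (real q)) * (sqrt (real q) * real p powr (- \<delta>)))"
        by simp
      also have "\<dots> \<le> D * ((1 + ln (real q)) * E)"
      proof (intro mult_mono mult_left_mono E)
        have "real p powr \<delta> \<le> real (2 * k) powr \<delta>"
          using False \<delta> by (intro powr_mono2) (auto simp flip: of_nat_mult)
        then show "2 * real p powr \<delta> \<le> D" using D by simp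
      qed (use D lnq in auto)
      finally show ?thesis by (simp add: E_def q_def mult.assoc)
    qed
  qed
  then show ?thesis using D \<delta> by (intro exI[of _ D] exI[of _ \<delta>] conjI allI impI) (assumption | simp)+
qed

section \<open>The discrepancy of a box\<close>

text \<open>The indicator of the class a minus its mean over the reduced residues, so that the
  expected value is already subtracted in every sum of it. For a prime to q its total over a period
  is 0 along each row m n with m fixed.\<close>

definition wt :: "nat \<Rightarrow> int \<Rightarrow> int \<Rightarrow> real" where
  "wt q a l = (if [l = a] (mod int q) then 1 else 0) - (if coprime l (int q) then 1 / real (totient q) else 0)"

definition disc :: "nat \<Rightarrow> int \<Rightarrow> int \<Rightarrow> nat \<Rightarrow> int \<Rightarrow> nat \<Rightarrow> real" where
  "disc q a X A Y B = (\<Sum>i<A. \<Sum>j<B. wt q a ((X + int i) * (Y + int j)))"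

lemma wt_cong:
  assumes "[m = n] (mod int q)"
  shows "wt q a m = wt q a n"
proof -
  have "coprime m (int q) \<longleftrightarrow> coprime n (int q)"
    using assms cong_imp_coprime cong_sym by blast
  moreover have "[m = a] (mod int q) \<longleftrightarrow> [n = a] (mod int q)"
    using assms by (meson cong_sym cong_trans)
  ultimately show ?thesis by (simp add: wt_def)
qed

lemma wt_unit:
  assumes "coprime m (int q)"
  shows "wt q a (m * n) = wt q (a * modular_inverse (int q) m) n"
proof -
  have mx: "[modular_inverse (int q) m * m = 1] (mod int q)" "[m * modular_inverse (int q) m = 1] (mod int q)"
    using assms by (rule cong_modular_inverse2, rule cong_modular_inverse1)
  have "[m * n = a] (mod int q) \<longleftrightarrow> [n = a * modular_inverse (int q) m] (mod int q)"
  proof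
    assume "[m * n = a] (mod int q)"
    then have "[m * n * modular_inverse (int q) m = a * modular_inverse (int q) m] (mod int q)"
      by (rule cong_scalar_right)
    moreover have "[n * (m * modular_inverse (int q) m) = n * 1] (mod int q)"
      using mx(2) by (rule cong_scalar_left)
    ultimately show "[n = a * modular_inverse (int q) m] (mod int q)"
      by (simp add: mult_ac) (meson cong_sym cong_trans)
  next
    assume "[n = a * modular_inverse (int q) m] (mod int q)"
    then have "[m * n = m * (a * modular_inverse (int q) m)] (mod int q)" by (rule cong_scalar_left)
    moreover have "[a * (m * modular_inverse (int q) m) = a * 1] (mod int q)"
      using mx(2) by (rule cong_scalar_left)
    ultimately show "[m * n = a] (mod int q)"
      by (simp add: mult_ac) (meson cong_sym cong_trans)
  qed
  moreover have "coprime (m * n) (int q) \<longleftrightarrow> coprime n (int q)" using assms by simp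
  ultimately show ?thesis by (simp add: wt_def)
qed

lemma wt_nonunit:
  assumes "coprime a (int q)" "\<not> coprime m (int q)"
  shows "wt q a (m * n) = 0"
proof -
  have "\<not> [m * n = a] (mod int q)"
    using assms by (metis cong_imp_coprime cong_sym coprime_mult_left_iff)
  then show ?thesis using assms by (simp add: wt_def)
qed

lemma card_coprime_residues: "q > 0 \<Longrightarrow> (\<Sum>r\<in>{0..<int q}. if coprime r (int q) then 1 else 0) = real (totient q)"
proof -
  assume q: "q > 0"
  have "(\<Sum>r\<in>{0..<int q}. if coprime r (int q) then 1 else 0) = real (card {r\<in>{0..<int q}. coprime r (int q)})"
    by (simp flip: sum.inter_filter)
  also have "card {r\<in>{0..<int q}. coprime r (int q)} = card (totatives q)"
  \<comment> \<open>For q = 1 the only residue is 0, whereas \<open>totatives 1\<close> is {1};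
    equal representatives match only for q > 1.\<close>
  proof (cases "q = 1")
    case True
    have "{r\<in>{0..<int q}. coprime r (int q)} = {0}" using True by auto
    then show ?thesis using True by simp
  next
    case False
    show ?thesis
    proof (rule bij_betw_same_card[of nat], rule bij_betwI[where g = int])
      show "nat \<in> {r \<in> {0..<int q}. coprime r (int q)} \<rightarrow> totatives q"
      proof
        fix r assume r: "r \<in> {r \<in> {0..<int q}. coprime r (int q)}"
        then obtain n where n: "r = int n" using nonneg_int_cases by auto
        have "n \<noteq> 0"
        proof
          assume "n = 0"
          then have "coprime 0 (int q)" using r n by simp
          then show False using False by simp
        qed
        show "nat r \<in> totatives q" using r n \<open>n \<noteq> 0\<close> by (auto simp: totatives_def)
      qed
      show "int \<in> totatives q \<rightarrow> {r \<in> {0..<int q}. coprime r (int q)}"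
      proof
        fix n assume "n \<in> totatives q"
        then have n: "n > 0" "n \<le> q" "coprime n q" by (auto simp: totatives_def)
        moreover have "n \<noteq> q" using n(3) False by auto
        ultimately show "int n \<in> {r \<in> {0..<int q}. coprime r (int q)}" by simp
      qed
    qed auto
  qed
  finally show ?thesis by (simp add: totient_def)
qed

lemma sum_wt_residues:
  assumes "q > 0"
  shows "(\<Sum>r\<in>{0..<int q}. wt q a r) = 0" "(\<Sum>r\<in>{0..<int q}. \<bar>wt q a r\<bar>) \<le> 2"
proof -
  have t: "totient q > 0" using assms by simp
  have 1: "(\<Sum>r\<in>{0..<int q}. if [r = a] (mod int q) then 1 else 0) = (1 :: real)"
    using sum_residues_pick[OF assms, of "\<lambda>_. 1 :: real" a] by (simp add: cong_iff_dvd_diff)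
  have 2: "(\<Sum>r\<in>{0..<int q}. if coprime r (int q) then 1 / real (totient q) else 0) = 1"
  proof -
    have "(\<Sum>r\<in>{0..<int q}. if coprime r (int q) then 1 / real (totient q) else 0)
      = 1 / real (totient q) * (\<Sum>r\<in>{0..<int q}. if coprime r (int q) then 1 else 0)"
      unfolding sum_distrib_left by (intro sum.cong refl) simp
    then show ?thesis using t by (simp add: card_coprime_residues[OF assms])
  qed
  show "(\<Sum>r\<in>{0..<int q}. wt q a r) = 0"
    unfolding wt_def sum_subtractf 1 2 by simp
  have "(\<Sum>r\<in>{0..<int q}. \<bar>wt q a r\<bar>) \<le> (\<Sum>r\<in>{0..<int q}. (if [r = a] (mod int q) then 1 else 0)
      + (if coprime r (int q) then 1 / real (totient q) else 0))"
  proof (intro sum_mono)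
    fix r
    show "\<bar>wt q a r\<bar> \<le> (if [r = a] (mod int q) then 1 else 0) + (if coprime r (int q) then 1 / real (totient q) else 0)"
      unfolding wt_def by (rule order_trans[OF abs_triangle_ineq4]) simp
  qed
  also have "\<dots> = 2" unfolding sum.distrib 1 2 by simp
  finally show "(\<Sum>r\<in>{0..<int q}. \<bar>wt q a r\<bar>) \<le> 2" .
qed

text \<open>Whole periods cancel, so only part of one period is left and the number of terms
  disappears from the bound.\<close>

lemma periodic_sum_bound:
  fixes g :: "int \<Rightarrow> real"
  assumes q: "q > 0" and g: "\<And>m n. [m = n] (mod int q) \<Longrightarrow> g m = g n" and 0: "(\<Sum>r\<in>{0..<int q}. g r) = 0"
  shows "\<bar>\<Sum>j<N. g (Y + int j)\<bar> \<le> (\<Sum>r\<in>{0..<int q}. \<bar>g r\<bar>)"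
proof (induction N arbitrary: Y rule: less_induct)
  case (less N)
  have full: "(\<Sum>j<q. f (Y + int j)) = (\<Sum>r\<in>{0..<int q}. f r)"
    if f: "\<And>m n. [m = n] (mod int q) \<Longrightarrow> f m = f n" for f :: "int \<Rightarrow> real"
  proof -
    have "(\<Sum>j<q. f (Y + int j)) = (\<Sum>r\<in>{0..<int q}. f (Y + r))" by (rule sum_interval_int)
    also have "\<dots> = (\<Sum>r\<in>{0..<int q}. f r)"
      by (rule sum_residues_reindex[OF q]) (auto intro: f simp: cong_add_lcancel)
    finally show ?thesis .
  qed
  show ?case
  proof (cases "N < q")
    case True
    have "\<bar>\<Sum>j<N. g (Y + int j)\<bar> \<le> (\<Sum>j<N. \<bar>g (Y + int j)\<bar>)" by (rule sum_abs)
    also have "\<dots> \<le> (\<Sum>j<q. \<bar>g (Y + int j)\<bar>)" using True by (intro sum_mono2) auto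
    also have "\<dots> = (\<Sum>r\<in>{0..<int q}. \<bar>g r\<bar>)"
      by (rule full) (simp add: g cong: arg_cong[where f = abs])
    finally show ?thesis .
  next
    case False
    then have N: "N = q + (N - q)" by simp
    have "(\<Sum>j<N. g (Y + int j)) = (\<Sum>j<q. g (Y + int j)) + (\<Sum>j<N - q. g (Y + int (q + j)))"
      by (subst N) (rule sum_lessThan_split)
    also have "\<dots> = (\<Sum>j<N - q. g ((Y + int q) + int j))"
      using full[of g, OF g] 0 by (simp add: add.assoc)
    finally show ?thesis using less.IH[of "N - q" "Y + int q"] False q by simp
  qed
qed

lemma disc_trivial_bound:
  assumes q: "q > 0" and a: "coprime a (int q)"
  shows "\<bar>disc q a X A Y B\<bar> \<le> 2 * real q"
proof -
  define f where "f m = (\<Sum>j<B. wt q a (m * (Y + int j)))" for m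
  have fc: "f m = f n" if "[m = n] (mod int q)" for m n
    unfolding f_def using that by (intro sum.cong refl wt_cong cong_scalar_right)
  have zero: "(\<Sum>m\<in>{0..<int q}. wt q a (m * n)) = 0" for n
  proof (cases "coprime n (int q)")
    case True
    then show ?thesis
      using sum_wt_residues(1)[OF q] by (simp add: wt_unit mult.commute[of _ n])
  next
    case False
    then show ?thesis using wt_nonunit[OF a False] by (simp add: mult.commute[of _ n])
  qed
  have f0: "(\<Sum>m\<in>{0..<int q}. f m) = 0"
    unfolding f_def by (subst sum.swap) (simp add: zero)
  have f2: "\<bar>f m\<bar> \<le> 2" for m
  proof (cases "coprime m (int q)")
    case True
    have "\<bar>f m\<bar> \<le> (\<Sum>r\<in>{0..<int q}. \<bar>wt q (a * modular_inverse (int q) m) r\<bar>)"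
      unfolding f_def wt_unit[OF True]
      by (rule periodic_sum_bound[OF q]) (auto intro: wt_cong simp: sum_wt_residues(1)[OF q])
    also have "\<dots> \<le> 2" by (rule sum_wt_residues(2)[OF q])
    finally show ?thesis .
  next
    case False
    then show ?thesis using wt_nonunit[OF a False] by (simp add: f_def)
  qed
  have "\<bar>disc q a X A Y B\<bar> = \<bar>\<Sum>i<A. f (X + int i)\<bar>" by (simp add: disc_def f_def)
  also have "\<dots> \<le> (\<Sum>r\<in>{0..<int q}. \<bar>f r\<bar>)" by (rule periodic_sum_bound[OF q fc f0])
  also have "\<dots> \<le> (\<Sum>r\<in>{0..<int q}. 2)" by (intro sum_mono f2)
  finally show ?thesis by simp
qed

text \<open>In the difference the terms for coprime residues cancel, which avoids Ramanujan sums.\<close>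

lemma wt_step:
  fixes p :: nat
  assumes p: "prime p" and k: "k > 0"
  shows "complex_of_real (wt (p ^ Suc k) a l - wt (p ^ k) a l / real p)
    = (\<Sum>v\<in>{v\<in>{..<p ^ Suc k}. \<not> p dvd v}. ech (p ^ Suc k) (int v * (l - a))) / of_nat (p ^ Suc k)"
proof -
  define q where "q = p ^ Suc k"
  define r where "r = p ^ k"
  have p0: "p > 0" using p by (simp add: prime_gt_0_nat)
  have q: "q = p * r" "q > 0" "r > 0" using p0 by (auto simp: q_def r_def)
  \<comment> \<open>This makes 1/phi(q) equal to 1/(p phi(r)), so the two density terms cancel after
    division by p.\<close>
  have "totient q = p * totient r"
    using totient_prime_power_Suc[OF p, of k] totient_prime_power_Suc[OF p, of "k - 1"] k
    by (cases k) (simp_all add: q_def r_def)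
  moreover have "coprime l (int q) \<longleftrightarrow> coprime l (int r)"
    unfolding q_def r_def using coprime_prime_power_iff[OF p, of "Suc k" l] coprime_prime_power_iff[OF p k, of l] by simp
  ultimately have "wt q a l - wt r a l / real p
      = (if [l = a] (mod int q) then 1 else 0) - (if [l = a] (mod int r) then 1 else 0) / real p"
    by (simp add: wt_def diff_divide_distrib mult.commute)
  then have lhs: "complex_of_real (wt q a l - wt r a l / real p)
    = (if int q dvd l - a then 1 else 0) - (if int r dvd l - a then 1 else 0) / of_nat p"
    by (simp add: cong_iff_dvd_diff)
  \<comment> \<open>The frequency p v modulo q is the frequency v modulo r, so the multiples of p
    reproduce the indicator modulo r.\<close>
  have "(\<Sum>v\<in>{..<q}. ech q (int v * (l - a)))
    = (\<Sum>v\<in>{v\<in>{..<q}. \<not> p dvd v}. ech q (int v * (l - a))) + (\<Sum>v\<in>{v\<in>{..<q}. p dvd v}. ech q (int v * (l - a)))"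
    by (subst sum.union_disjoint[symmetric]) (auto intro: sum.cong)
  moreover have "(\<Sum>v\<in>{v\<in>{..<q}. p dvd v}. ech q (int v * (l - a))) = (\<Sum>v<r. ech q (int (p * v) * (l - a)))"
    by (rule sum.reindex_bij_witness[of _ "\<lambda>v. p * v" "\<lambda>v. v div p"]) (use p0 q in \<open>auto elim!: dvdE\<close>)
  moreover have "\<dots> = (\<Sum>v<r. ech r (int v * (l - a)))"
    unfolding q by (intro sum.cong refl) (use ech_scale[OF p0, of r] in \<open>simp add: mult.assoc\<close>)
  ultimately have "(\<Sum>v\<in>{v\<in>{..<q}. \<not> p dvd v}. ech q (int v * (l - a)))
      = (if int q dvd l - a then of_nat q else 0) - (if int r dvd l - a then of_nat r else 0)"
    using sum_ech_orthogonal[OF q(2), of "l - a"] sum_ech_orthogonal[OF q(3), of "l - a"] by (simp add: algebra_simps)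
  then have "(\<Sum>v\<in>{v\<in>{..<q}. \<not> p dvd v}. ech q (int v * (l - a))) / of_nat q
      = (if int q dvd l - a then 1 else 0) - (if int r dvd l - a then 1 else 0) / of_nat p"
    using q p0 by (auto simp: diff_divide_distrib)
  then show ?thesis using lhs by (simp add: q_def r_def)
qed

text \<open>Only frequencies v prime to p remain in the difference. For each of them the sum over n
  is geometric, and the resulting factors 1/min(v, q - v) add up to a logarithm. The sum over m is
  an incomplete Kloosterman sum with b = -v a, still prime to p, so one bound K serves all
  v.\<close>

lemma disc_step:
  fixes p :: nat
  assumes p: "prime p" and k: "k > 0" and a: "\<not> int p dvd a"
    and K: "\<And>b. \<not> int p dvd b \<Longrightarrow> cmod (kl_inc (p ^ Suc k) b X A) \<le> K"
  shows "\<bar>disc (p ^ Suc k) a X A Y B\<bar> \<le> \<bar>disc (p ^ k) a X A Y B\<bar> / real p + (1 + ln (real (p ^ Suc k))) * K"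
proof -
  define q where "q = p ^ Suc k"
  define r where "r = p ^ k"
  have p0: "p > 0" using p by (simp add: prime_gt_0_nat)
  have q: "q = p * r" "q > 0" "r > 0" using p0 by (auto simp: q_def r_def)
  have "p ^ 1 \<le> q" unfolding q_def using p0 by (intro power_increasing) auto
  then have q1: "q > 1" using prime_ge_2_nat[OF p] by simp
  have copq: "coprime x (int q) \<longleftrightarrow> \<not> int p dvd x" for x
    unfolding q_def by (rule coprime_prime_power_iff[OF p]) simp
  have copr: "coprime x (int r) \<longleftrightarrow> \<not> int p dvd x" for x
    unfolding r_def by (rule coprime_prime_power_iff[OF p k])
  let ?V = "{v\<in>{..<q}. \<not> p dvd v}"
  have K0: "K \<ge> 0" using order_trans[OF norm_ge_zero K[OF a]] .
  have point: "complex_of_real (wt q a (m * n) - wt r a (m * n) / real p)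
    = (\<Sum>v\<in>?V. ech q (int v * n) * kl_term q 0 (- (int v * a)) m) / of_nat q" for m n
  proof (cases "int p dvd m")
    case True
    then show ?thesis
      using wt_nonunit[of a q m n] wt_nonunit[of a r m n] a by (simp add: copq copr kl_term_def)
  next
    case False
    let ?x = "modular_inverse (int q) m"
    have "[m * ?x = 1] (mod int q)" using False copq by (intro cong_modular_inverse1) blast
    \<comment> \<open>The inverse modulo q also serves modulo r, so both weights can be expressed
      with the same residue a/m.\<close>
    then have "[m * ?x = 1] (mod int r)" by (rule cong_dvd_modulus) (simp add: q)
    then have "[modular_inverse (int r) m = ?x] (mod int r)" by (rule modular_inverse_unique)
    then have ar: "[a * modular_inverse (int r) m = a * ?x] (mod int r)" by (rule cong_scalar_left)
    have "wt r a (m * n) = wt r (a * modular_inverse (int r) m) n"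
      using False copr by (intro wt_unit) blast
    also have "\<dots> = wt r (a * ?x) n"
    proof -
      have "[n = a * modular_inverse (int r) m] (mod int r) \<longleftrightarrow> [n = a * ?x] (mod int r)"
        using ar by (meson cong_sym cong_trans)
      then show ?thesis by (simp add: wt_def)
    qed
    finally have 1: "wt r a (m * n) = wt r (a * ?x) n" .
    have 2: "wt q a (m * n) = wt q (a * ?x) n" using False copq by (intro wt_unit) blast
    have "complex_of_real (wt q a (m * n) - wt r a (m * n) / real p)
      = (\<Sum>v\<in>?V. ech q (int v * (n - a * ?x))) / of_nat q"
      unfolding 1 2 by (rule wt_step[OF p k, folded q_def r_def])
    also have "(\<Sum>v\<in>?V. ech q (int v * (n - a * ?x))) = (\<Sum>v\<in>?V. ech q (int v * n) * kl_term q 0 (- (int v * a)) m)"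
    proof (intro sum.cong refl)
      fix v
      have "int v * (n - a * ?x) = int v * n + (0 * m + - (int v * a) * ?x)" by (simp add: algebra_simps)
      then show "ech q (int v * (n - a * ?x)) = ech q (int v * n) * kl_term q 0 (- (int v * a)) m"
        using False copq by (simp only: ech_add kl_term_def if_True not_False_eq_True)
    qed
    finally show ?thesis .
  qed
  have "complex_of_real (disc q a X A Y B - disc r a X A Y B / real p)
    = (\<Sum>i<A. \<Sum>j<B. complex_of_real (wt q a ((X + int i) * (Y + int j)) - wt r a ((X + int i) * (Y + int j)) / real p))"
    by (simp add: disc_def sum_subtractf sum_divide_distrib)
  also have "\<dots> = (\<Sum>i<A. \<Sum>j<B. \<Sum>v\<in>?V. ech q (int v * (Y + int j)) * kl_term q 0 (- (int v * a)) (X + int i) / of_nat q)"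
    unfolding point sum_divide_distrib ..
  also have "\<dots> = (\<Sum>i<A. \<Sum>v\<in>?V. \<Sum>j<B. ech q (int v * (Y + int j)) * kl_term q 0 (- (int v * a)) (X + int i) / of_nat q)"
    by (intro sum.cong refl sum.swap)
  also have "\<dots> = (\<Sum>v\<in>?V. \<Sum>i<A. \<Sum>j<B. ech q (int v * (Y + int j)) * kl_term q 0 (- (int v * a)) (X + int i) / of_nat q)"
    by (rule sum.swap)
  also have "\<dots> = (\<Sum>v\<in>?V. box_coeff q Y B (- int v) * kl_inc q (- (int v * a)) X A)"
  proof (intro sum.cong refl)
    fix v
    show "(\<Sum>i<A. \<Sum>j<B. ech q (int v * (Y + int j)) * kl_term q 0 (- (int v * a)) (X + int i) / of_nat q)
      = box_coeff q Y B (- int v) * kl_inc q (- (int v * a)) X A"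
      unfolding kl_inc_def box_coeff_def sum_divide_distrib sum_product
      by (subst sum.swap) (intro sum.cong refl, simp)
  qed
  finally have eq: "complex_of_real (disc q a X A Y B - disc r a X A Y B / real p)
    = (\<Sum>v\<in>?V. box_coeff q Y B (- int v) * kl_inc q (- (int v * a)) X A)" .
  have "\<bar>disc q a X A Y B - disc r a X A Y B / real p\<bar> = cmod (\<Sum>v\<in>?V. box_coeff q Y B (- int v) * kl_inc q (- (int v * a)) X A)"
    unfolding eq[symmetric] norm_of_real ..
  also have "\<dots> \<le> (\<Sum>v\<in>?V. 1 / (2 * real_of_int (min (int v) (int q - int v))) * K)"
  proof (rule sum_norm_le)
    fix v assume v: "v \<in> ?V"
    then have v1: "int v \<in> {1..<int q}" by (cases "v = 0") auto
    have "\<not> int p dvd - (int v * a)"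
      using v a p by (simp add: prime_dvd_mult_iff)
    then show "cmod (box_coeff q Y B (- int v) * kl_inc q (- (int v * a)) X A)
      \<le> 1 / (2 * real_of_int (min (int v) (int q - int v))) * K"
      unfolding norm_mult box_coeff_minus complex_mod_cnj
      by (intro mult_mono norm_box_coeff_le_inverse v1 K[folded q_def]) (use v in auto)
  qed
  also have "\<dots> \<le> (\<Sum>v\<in>{1..<q}. 1 / (2 * real_of_int (min (int v) (int q - int v))) * K)"
    using K0 by (intro sum_mono2) (auto simp: Suc_le_eq intro!: mult_nonneg_nonneg intro: Nat.gr0I)
  also have "\<dots> = (\<Sum>v\<in>{1..<int q}. 1 / real_of_int (min v (int q - v)) * (K / 2))"
    by (rule sum.reindex_bij_witness[of _ nat int]) auto
  also have "\<dots> = (\<Sum>v\<in>{1..<int q}. 1 / real_of_int (min v (int q - v))) * (K / 2)"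
    by (rule sum_distrib_right[symmetric])
  also have "\<dots> \<le> 2 * (1 + ln (real q)) * (K / 2)"
    using K0 by (intro mult_right_mono sum_inverse_min_residue_le q1) auto
  also have "\<dots> = (1 + ln (real q)) * K" by simp
  finally have "\<bar>disc q a X A Y B - disc r a X A Y B / real p\<bar> \<le> (1 + ln (real q)) * K" .
  moreover have "\<bar>disc q a X A Y B\<bar> \<le> \<bar>disc q a X A Y B - disc r a X A Y B / real p\<bar> + \<bar>disc r a X A Y B / real p\<bar>"
    by linarith
  ultimately show ?thesis by (simp add: q_def r_def)
qed

text \<open>Recursion on the exponent with the Polya-Vinogradov bound at each level, started from 2p
  = 2 sqrt(p^2) at modulus p. The start loses sqrt p against square-root size, hence the exponent k
  + 2 under the root for the modulus p^(k+1). The loss is affordable because this bound is later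
  divided by p.\<close>

lemma disc_weak:
  fixes p :: nat
  assumes p: "prime p" "odd p" and a: "\<not> int p dvd a"
  shows "\<bar>disc (p ^ Suc k) a X A Y B\<bar> \<le> 2 * real (Suc k) * sqrt (real (p ^ Suc (Suc k))) * (1 + ln (real (p ^ Suc k)))\<^sup>2"
proof (induction k)
  case 0
  have p1: "p > 1" using prime_ge_2_nat[OF p(1)] by simp
  have "coprime a (int (p ^ 1))" by (subst coprime_prime_power_iff[OF p(1)]) (use a in auto)
  then have "\<bar>disc (p ^ 1) a X A Y B\<bar> \<le> 2 * real (p ^ 1)"
    using p1 by (intro disc_trivial_bound) auto
  also have "\<dots> \<le> 2 * real p * (1 + ln (real p))\<^sup>2"
    using p1 by simp
  finally show ?case using p1 by (simp add: power2_eq_square)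
next
  case (Suc k)
  define L where "L = (\<lambda>k. 1 + ln (real (p ^ Suc k)))"
  define S where "S = (\<lambda>k. sqrt (real (p ^ k)))"
  have p1: "p > 1" using prime_ge_2_nat[OF p(1)] by simp
  have mono: "real (p ^ i) \<le> real (p ^ j)" if "i \<le> j" for i j
    unfolding of_nat_power using that p1 by (intro power_increasing) auto
  have pos: "real (p ^ i) > 0" for i using p1 by simp
  have L: "1 \<le> L k" "L k \<le> L (Suc k)"
    using mono[of "Suc k" "Suc (Suc k)"] mono[of 0 "Suc k"] pos[of "Suc k"]
    by (auto simp: L_def simp del: of_nat_power power_Suc intro!: ln_mono)
  have S: "0 \<le> S i" "S i \<le> S (Suc i)" for i
    using mono[of i "Suc i"] by (auto simp: S_def simp del: of_nat_power power_Suc)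
  have "\<bar>disc (p ^ Suc (Suc k)) a X A Y B\<bar> \<le> \<bar>disc (p ^ Suc k) a X A Y B\<bar> / real p
      + (1 + ln (real (p ^ Suc (Suc k)))) * (2 * sqrt (real (p ^ Suc (Suc k))) * (1 + ln (real (p ^ Suc (Suc k)))))"
    using p a by (intro disc_step kl_inc_weak) auto
  also have "\<dots> = \<bar>disc (p ^ Suc k) a X A Y B\<bar> / real p + 2 * S (Suc (Suc k)) * (L (Suc k))\<^sup>2"
    by (simp only: L_def S_def power2_eq_square mult_ac)
  also have "\<dots> \<le> \<bar>disc (p ^ Suc k) a X A Y B\<bar> / 1 + 2 * S (Suc (Suc k)) * (L (Suc k))\<^sup>2"
    using p1 by (intro add_right_mono divide_left_mono) auto
  also have "\<dots> \<le> 2 * real (Suc k) * S (Suc (Suc k)) * (L k)\<^sup>2 + 2 * S (Suc (Suc k)) * (L (Suc k))\<^sup>2"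
    using Suc.IH by (simp add: L_def S_def)
  also have "\<dots> \<le> 2 * real (Suc k) * S (Suc (Suc (Suc k))) * (L (Suc k))\<^sup>2 + 2 * S (Suc (Suc (Suc k))) * (L (Suc k))\<^sup>2"
    using L S[of "Suc (Suc k)"] by (intro add_mono mult_mono power_mono) auto
  also have "\<dots> = 2 * real (Suc (Suc k)) * S (Suc (Suc (Suc k))) * (L (Suc k))\<^sup>2"
    by (simp add: algebra_simps)
  finally show ?case unfolding L_def S_def .
qed

text \<open>Only the step from p^(k-1) to p^k uses the strong estimate. The discrepancy at the lower
  level arrives divided by p, which turns its weak bound into sqrt q / p up to logarithms.\<close>

lemma disc_bound:
  assumes k: "k \<ge> 7"
  shows "\<exists>C>0. \<exists>\<epsilon>>0. \<epsilon> \<le> 1 \<and> (\<forall>p a X A Y B. prime (p::nat) \<longrightarrow> odd p \<longrightarrow> \<not> int p dvd a \<longrightarrow>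
     \<bar>disc (p ^ k) a X A Y B\<bar> \<le> C * (real A * real (p ^ k) powr (- (1/4) - \<epsilon>) + real (p ^ k) powr (1/2 - \<epsilon>)))"
proof -
  obtain C \<delta> where C: "C > 0" and \<delta>: "\<delta> > 0" "\<delta> \<le> 1/9" and
    strong: "\<And>p b X A. prime (p::nat) \<Longrightarrow> odd p \<Longrightarrow> \<not> int p dvd b \<Longrightarrow>
     cmod (kl_inc (p ^ k) b X A)
       \<le> C * (1 + ln (real (p ^ k))) * (real A * real p powr (5/3) / sqrt (real (p ^ k)) + sqrt (real (p ^ k)) * real p powr (- \<delta>))"
    using kl_inc_strong[of k] k by auto
  \<comment> \<open>1/84 = 1/4 - 5/21 is the room in p^(5/3) q^(-1/2) \<le> q^(-1/4) at k = 7, and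
    \<delta>/k expresses p^(-\<delta>) as a power of q. Half of the gain is reserved for the squared
    logarithm.\<close>
  define \<epsilon> where "\<epsilon> = min (1/84) (\<delta> / real k) / 2"
  have \<epsilon>: "\<epsilon> > 0" "2 * \<epsilon> \<le> 1/84" "2 * \<epsilon> \<le> \<delta> / real k"
    using \<delta> k by (auto simp: \<epsilon>_def min_def)
  define D where "D = (2 * real k + C) * (4 / \<epsilon>)\<^sup>2"
  have D: "D > 0" using C \<epsilon> by (simp add: D_def add_nonneg_pos)
  have "\<bar>disc (p ^ k) a X A Y B\<bar> \<le> D * (real A * real (p ^ k) powr (- (1/4) - \<epsilon>) + real (p ^ k) powr (1/2 - \<epsilon>))"
    if p: "prime (p::nat)" "odd p" and a: "\<not> int p dvd a" for p a X A Y B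
  proof -
    define q where "q = real (p ^ k)"
    define E where "E = real A * real p powr (5/3) / sqrt q + sqrt q * real p powr (- \<delta>)"
    define L where "L = 1 + ln q"
    have p1: "p > 1" using prime_ge_2_nat[OF p(1)] by simp
    have q1: "q \<ge> 1" using p1 by (simp add: q_def)
    have pq: "real p = q powr (1 / real k)"
      using p1 k by (simp add: q_def powr_realpow[symmetric] powr_powr)
    have L1: "L \<ge> 1" using q1 by (simp add: L_def)
    have E0: "E \<ge> sqrt q * real p powr (- \<delta>)" using q1 by (simp add: E_def)
    have E00: "E \<ge> 0" using q1 by (simp add: E_def)
    obtain k' where k': "k = Suc k'" "k' = Suc (k' - 1)" using k by (cases k) auto
    have "\<bar>disc (p ^ k) a X A Y B\<bar> \<le> \<bar>disc (p ^ k') a X A Y B\<bar> / real p + (1 + ln (real (p ^ k))) * (C * L * E)"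
      unfolding k'(1)
    proof (rule disc_step[OF p(1) _ a])
      show "k' > 0" using k' by simp
      show "cmod (kl_inc (p ^ Suc k') b X A) \<le> C * L * E" if "\<not> int p dvd b" for b
        using strong[OF p that] unfolding L_def E_def q_def k'(1) .
    qed
    also have "\<dots> = \<bar>disc (p ^ k') a X A Y B\<bar> / real p + C * L\<^sup>2 * E"
      by (simp add: L_def q_def power2_eq_square)
    also have "\<bar>disc (p ^ k') a X A Y B\<bar> / real p \<le> 2 * real k * L\<^sup>2 * (sqrt q * real p powr (- \<delta>))"
    proof -
      have le: "real (p ^ k') \<le> q" unfolding q_def of_nat_power k'(1) using p1 by (intro power_increasing) auto
      have "real (p ^ k') \<ge> 1" using p1 by simp
      moreover from this have "ln (real (p ^ k')) \<le> ln q"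
        using le q1 by (subst ln_le_cancel_iff) linarith+
      ultimately have Lk: "0 \<le> 1 + ln (real (p ^ k'))" "1 + ln (real (p ^ k')) \<le> L"
        using q1 by (auto simp: L_def simp del: of_nat_power)
      have "\<bar>disc (p ^ k') a X A Y B\<bar> \<le> 2 * real k' * sqrt (real (p ^ Suc k')) * (1 + ln (real (p ^ k')))\<^sup>2"
        using disc_weak[OF p a, of "k' - 1" X A Y B] by (simp only: k'(2)[symmetric])
      also have "\<dots> \<le> 2 * real k * sqrt q * L\<^sup>2"
        unfolding q_def k'(1)[symmetric]
        using Lk by (intro mult_mono power_mono) (auto simp: k'(1))
      finally have "\<bar>disc (p ^ k') a X A Y B\<bar> / real p \<le> 2 * real k * sqrt q * L\<^sup>2 / real p"
        by (intro divide_right_mono) auto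
      also have "\<dots> = 2 * real k * L\<^sup>2 * (sqrt q * real p powr (- 1))"
        using p1 by (simp add: powr_minus divide_inverse)
      also have "\<dots> \<le> 2 * real k * L\<^sup>2 * (sqrt q * real p powr (- \<delta>))"
        using p1 \<delta> q1 by (intro mult_left_mono powr_mono) auto
      finally show ?thesis .
    qed
    also have "2 * real k * L\<^sup>2 * (sqrt q * real p powr (- \<delta>)) + C * L\<^sup>2 * E \<le> 2 * real k * L\<^sup>2 * E + C * L\<^sup>2 * E"
      using E0 by (intro add_right_mono mult_left_mono) auto
    also have "\<dots> = (2 * real k + C) * (L\<^sup>2 * E)" by (simp add: algebra_simps)
    also have "\<dots> \<le> (2 * real k + C) * ((4 / \<epsilon> * q powr (\<epsilon> / 2))\<^sup>2 * (real A * q powr (- (1/4) - 2 * \<epsilon>) + q powr (1/2 - 2 * \<epsilon>)))"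
    proof (intro mult_left_mono mult_mono power_mono)
      have "L \<le> 2 / (\<epsilon> / 2) * q powr (\<epsilon> / 2)"
        unfolding L_def using q1 \<epsilon> by (intro one_plus_ln_le_powr) auto
      then show "L \<le> 4 / \<epsilon> * q powr (\<epsilon> / 2)" by simp
      have "real p powr (5/3) / sqrt q = q powr (5 / (3 * real k) - 1/2)"
        using q1 by (simp add: pq powr_powr powr_diff powr_half_sqrt mult.commute)
      also have "\<dots> \<le> q powr (- (1/4) - 2 * \<epsilon>)"
      proof (rule powr_mono[OF _ q1])
        have "5 / (3 * real k) \<le> 5 / (3 * 7)" using k by (intro divide_left_mono) auto
        then show "5 / (3 * real k) - 1/2 \<le> - (1/4) - 2 * \<epsilon>" using \<epsilon> by simp
      qed
      finally have 1: "real p powr (5/3) / sqrt q \<le> q powr (- (1/4) - 2 * \<epsilon>)" .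
      have "sqrt q * real p powr (- \<delta>) = q powr (1/2 - \<delta> / real k)"
        using q1 by (simp add: pq powr_powr powr_half_sqrt[symmetric] flip: powr_add)
      also have "\<dots> \<le> q powr (1/2 - 2 * \<epsilon>)" using \<epsilon> by (intro powr_mono[OF _ q1]) auto
      finally have 2: "sqrt q * real p powr (- \<delta>) \<le> q powr (1/2 - 2 * \<epsilon>)" .
      show "E \<le> real A * q powr (- (1/4) - 2 * \<epsilon>) + q powr (1/2 - 2 * \<epsilon>)"
        unfolding E_def using mult_left_mono[OF 1, of "real A"] 2 by simp
    qed (use L1 C E00 q1 in auto)
    also have "\<dots> = D * (q powr \<epsilon> * (real A * q powr (- (1/4) - 2 * \<epsilon>) + q powr (1/2 - 2 * \<epsilon>)))"
    proof -
      have "(q powr (\<epsilon> / 2))\<^sup>2 = q powr \<epsilon>" by (simp add: power2_eq_square flip: powr_add)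
      then have sqr: "(4 / \<epsilon> * q powr (\<epsilon> / 2))\<^sup>2 = (4 / \<epsilon>)\<^sup>2 * q powr \<epsilon>" by (simp only: power_mult_distrib)
      show ?thesis unfolding sqr D_def by (simp only: mult.assoc)
    qed
    also have "q powr \<epsilon> * (real A * q powr (- (1/4) - 2 * \<epsilon>) + q powr (1/2 - 2 * \<epsilon>))
        = real A * q powr (- (1/4) - \<epsilon>) + q powr (1/2 - \<epsilon>)"
    proof -
      have e: "\<epsilon> + (- (1/4) - 2 * \<epsilon>) = - (1/4) - \<epsilon>" "\<epsilon> + (1/2 - 2 * \<epsilon>) = 1/2 - \<epsilon>" by simp_all
      show ?thesis unfolding distrib_left mult.left_commute[of "q powr \<epsilon>" "real A"] powr_add[symmetric] e ..
    qed
    finally show ?thesis by (simp only: q_def)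
  qed
  moreover have "\<epsilon> \<le> 1" using \<epsilon> by simp
  ultimately show ?thesis using D \<epsilon>(1) by (intro exI[of _ D] exI[of _ \<epsilon>] conjI allI impI) (assumption | simp)+
qed

section \<open>The hyperbola method\<close>

lemma sum_divisor_count:
  fixes g :: "nat \<Rightarrow> real"
  shows "(\<Sum>l\<in>{1..N}. real (card {d. d dvd l}) * g l) = (\<Sum>(m,n)\<in>{(m,n). m > 0 \<and> n > 0 \<and> m * n \<le> N}. g (m * n))"
proof -
  have "(\<Sum>l\<in>{1..N}. real (card {d. d dvd l}) * g l) = (\<Sum>l\<in>{1..N}. \<Sum>d\<in>{d. d dvd l}. g l)"
    by simp
  also have "\<dots> = (\<Sum>(l,d)\<in>(SIGMA l:{1..N}. {d. d dvd l}). g l)"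
    by (rule sum.Sigma) (auto intro: finite_divisors_nat)
  also have "\<dots> = (\<Sum>(m,n)\<in>{(m,n). m > 0 \<and> n > 0 \<and> m * n \<le> N}. g (m * n))"
    by (rule sum.reindex_bij_witness[of _ "\<lambda>(m,n). (m * n, m)" "\<lambda>(l,d). (d, l div d)"])
      (auto elim!: dvdE simp: Suc_le_eq)
  finally show ?thesis .
qed

text \<open>Y is the integer square root of N, so every pair below the hyperbola has a coordinate at
  most Y. The pairs counted twice form the full square, which is itself a box.\<close>

lemma hyperbola:
  fixes g :: "nat \<Rightarrow> real"
  assumes Y: "Y * Y \<le> N" "N < Suc Y * Suc Y"
  shows "(\<Sum>l\<in>{1..N}. real (card {d. d dvd l}) * g l)
    = 2 * (\<Sum>m\<in>{1..Y}. \<Sum>n\<in>{1..N div m}. g (m * n)) - (\<Sum>m\<in>{1..Y}. \<Sum>n\<in>{1..Y}. g (m * n))"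
proof -
  define P where "P = {(m,n). m > 0 \<and> n > 0 \<and> m * n \<le> N}"
  define P1 where "P1 = (SIGMA m:{1..Y}. {1..N div m})"
  define P2 where "P2 = prod.swap ` P1"
  have P1: "(m, n) \<in> P1 \<longleftrightarrow> (m, n) \<in> P \<and> m \<le> Y" for m n
    by (auto simp: P1_def P_def Suc_le_eq less_eq_div_iff_mult_less_eq mult.commute)
  have P2: "(m, n) \<in> P2 \<longleftrightarrow> (m, n) \<in> P \<and> n \<le> Y" for m n
    using P1[of n m] by (auto simp: P2_def P_def mult.commute)
  have cover: "m \<le> Y \<or> n \<le> Y" if "(m, n) \<in> P" for m n
  proof (rule ccontr)
    assume "\<not> (m \<le> Y \<or> n \<le> Y)"
    then have "Suc Y * Suc Y \<le> m * n" by (intro mult_le_mono) auto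
    then show False using that Y by (simp add: P_def)
  qed
  have fin: "finite P1" "finite P2" by (auto simp: P1_def P2_def)
  have "z \<in> P \<longleftrightarrow> z \<in> P1 \<union> P2" for z
    using P1[of "fst z" "snd z"] P2[of "fst z" "snd z"] cover[of "fst z" "snd z"] by auto
  then have "P = P1 \<union> P2" by blast
  then have "(\<Sum>(m,n)\<in>P. g (m * n)) = (\<Sum>(m,n)\<in>P1. g (m * n)) + (\<Sum>(m,n)\<in>P2. g (m * n)) - (\<Sum>(m,n)\<in>P1 \<inter> P2. g (m * n))"
    using sum_Un[OF fin] by simp
  moreover have "P1 \<inter> P2 = {1..Y} \<times> {1..Y}"
  proof -
    have "m * n \<le> N" if "m \<le> Y" "n \<le> Y" for m n using mult_le_mono[OF that] Y by simp
    then show ?thesis using P1 P2 by (auto simp: P_def Suc_le_eq)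
  qed
  moreover have "(\<Sum>(m,n)\<in>P2. g (m * n)) = (\<Sum>(m,n)\<in>P1. g (m * n))"
    unfolding P2_def by (subst sum.reindex) (auto simp: case_prod_unfold mult.commute)
  moreover have "(\<Sum>(m,n)\<in>P1. g (m * n)) = (\<Sum>m\<in>{1..Y}. \<Sum>n\<in>{1..N div m}. g (m * n))"
    unfolding P1_def by (rule sum.Sigma[symmetric]) auto
  moreover have "(\<Sum>(m,n)\<in>{1..Y} \<times> {1..Y}. g (m * n)) = (\<Sum>m\<in>{1..Y}. \<Sum>n\<in>{1..Y}. g (m * n))"
    by (rule sum.cartesian_product[symmetric])
  ultimately show ?thesis
    unfolding sum_divisor_count P_def[symmetric] by simp
qed

text \<open>Each strip \<open>M < m \<le> M'\<close> below the hyperbola is squeezed between two boxes; the lower bound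
  on \<open>g\<close> makes the sum over \<open>n\<close> almost monotone.\<close>

lemma strip_bound:
  fixes g :: "nat \<Rightarrow> real"
  assumes \<beta>: "\<beta> \<ge> 0" "\<And>l. g l \<ge> - \<beta>"
    and box: "\<And>M M' B. M \<le> M' \<Longrightarrow> \<bar>\<Sum>m\<in>{M<..M'}. \<Sum>n\<in>{1..B}. g (m * n)\<bar> \<le> e1 * real (M' - M) + e0"
    and M: "M < M'" "real M' \<le> (1 + \<Delta>) * real (M + 1)" and \<Delta>: "\<Delta> \<ge> 0"
  shows "\<bar>\<Sum>m\<in>{M<..M'}. \<Sum>n\<in>{1..N div m}. g (m * n)\<bar>
    \<le> e1 * real (M' - M) + e0 + \<beta> * (\<Delta> * real N * (\<Sum>m\<in>{M<..M'}. 1 / real m) + real (M' - M))"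
proof -
  define f where "f m B = (\<Sum>n\<in>{1..B}. g (m * n))" for m B
  define lo where "lo = N div M'"
  define hi where "hi = N div (M + 1)"
  have almost_mono: "f m B' - f m B \<ge> - \<beta> * (real B' - real B)" if "B \<le> B'" for m B B'
  proof -
    have "{1..B'} = {1..B} \<union> {B<..B'}" using that by auto
    then have "f m B' = f m B + (\<Sum>n\<in>{B<..B'}. g (m * n))"
      unfolding f_def by (subst sum.union_disjoint[symmetric]) auto
    moreover have "(\<Sum>n\<in>{B<..B'}. g (m * n)) \<ge> (\<Sum>n\<in>{B<..B'}. - \<beta>)" by (intro sum_mono \<beta>)
    ultimately show ?thesis using that by (simp add: algebra_simps of_nat_diff)
  qed
  have range: "lo \<le> N div m" "N div m \<le> hi" if "m \<in> {M<..M'}" for m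
    using that unfolding lo_def hi_def by (auto intro!: div_le_mono2)
  have lohi: "lo \<le> hi" using M(1) unfolding lo_def hi_def by (intro div_le_mono2) auto
  \<comment> \<open>Across the strip the curve falls from N/(M+1) to N/M', by at most \<Delta> N/M'
    because M' \<le> (1 + \<Delta>)(M + 1); the 1 accounts for the floors.\<close>
  have gap: "real hi - real lo \<le> \<Delta> * real N / real M' + 1"
  proof -
    have "real hi \<le> real N / real (M + 1)" unfolding hi_def by (rule of_nat_div_le_of_nat)
    moreover have "real N / real M' \<le> real lo + 1"
    proof -
      have "N < M' + lo * M'" unfolding lo_def using M(1) by (intro dividend_less_div_times) simp
      then have "real N < real (M' + lo * M')" by (simp only: of_nat_less_iff)
      then show ?thesis using M(1) by (simp add: field_simps)
    qed
    moreover have "real N / real (M + 1) \<le> real N * ((1 + \<Delta>) / real M')"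
    proof -
      have "1 / real (M + 1) \<le> (1 + \<Delta>) / real M'" using M by (simp add: field_simps)
      then show ?thesis using mult_left_mono[of "1 / real (M + 1)" "(1 + \<Delta>) / real M'" "real N"] by simp
    qed
    moreover have "real N * ((1 + \<Delta>) / real M') = real N / real M' + \<Delta> * real N / real M'"
      by (simp add: distrib_left add_divide_distrib mult.commute)
    ultimately show ?thesis by linarith
  qed
  have upper: "(\<Sum>m\<in>{M<..M'}. f m (N div m)) \<le> (\<Sum>m\<in>{M<..M'}. f m hi) + real (M' - M) * (\<beta> * (real hi - real lo))"
  proof -
    have "(\<Sum>m\<in>{M<..M'}. f m (N div m)) \<le> (\<Sum>m\<in>{M<..M'}. f m hi + \<beta> * (real hi - real lo))"
    proof (rule sum_mono)
      fix m assume m: "m \<in> {M<..M'}"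
      have "f m hi - f m (N div m) \<ge> - \<beta> * (real hi - real (N div m))"
        using range[OF m] by (intro almost_mono)
      moreover have "\<beta> * (real hi - real (N div m)) \<le> \<beta> * (real hi - real lo)"
        using range[OF m] \<beta> by (intro mult_left_mono) auto
      ultimately show "f m (N div m) \<le> f m hi + \<beta> * (real hi - real lo)" by simp
    qed
    then show ?thesis by (simp add: sum.distrib)
  qed
  have lower: "(\<Sum>m\<in>{M<..M'}. f m (N div m)) \<ge> (\<Sum>m\<in>{M<..M'}. f m lo) - real (M' - M) * (\<beta> * (real hi - real lo))"
  proof -
    have "(\<Sum>m\<in>{M<..M'}. f m (N div m)) \<ge> (\<Sum>m\<in>{M<..M'}. f m lo - \<beta> * (real hi - real lo))"
    proof (rule sum_mono)
      fix m assume m: "m \<in> {M<..M'}"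
      have "f m (N div m) - f m lo \<ge> - \<beta> * (real (N div m) - real lo)"
        using range[OF m] by (intro almost_mono)
      moreover have "\<beta> * (real (N div m) - real lo) \<le> \<beta> * (real hi - real lo)"
        using range[OF m] \<beta> by (intro mult_left_mono) auto
      ultimately show "f m (N div m) \<ge> f m lo - \<beta> * (real hi - real lo)" by simp
    qed
    then show ?thesis by (simp add: sum_subtractf)
  qed
  have "real (M' - M) * (\<beta> * (real hi - real lo)) \<le> real (M' - M) * (\<beta> * (\<Delta> * real N / real M' + 1))"
    using gap \<beta> by (intro mult_left_mono) auto
  also have "\<dots> = \<beta> * (\<Delta> * real N * (real (M' - M) * (1 / real M')) + real (M' - M))"
    by (simp add: algebra_simps)
  also have "\<dots> \<le> \<beta> * (\<Delta> * real N * (\<Sum>m\<in>{M<..M'}. 1 / real m) + real (M' - M))"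
  proof -
    \<comment> \<open>(M' - M)/M' is dominated by the harmonic sum over the strip, which adds up
      over consecutive strips.\<close>
    have "(\<Sum>m\<in>{M<..M'}. 1 / real M') \<le> (\<Sum>m\<in>{M<..M'}. 1 / real m)"
      by (intro sum_mono divide_left_mono) auto
    then have "real (M' - M) * (1 / real M') \<le> (\<Sum>m\<in>{M<..M'}. 1 / real m)" by simp
    then show ?thesis using \<beta> \<Delta> by (intro mult_left_mono add_right_mono) auto
  qed
  finally have "real (M' - M) * (\<beta> * (real hi - real lo)) \<le> \<beta> * (\<Delta> * real N * (\<Sum>m\<in>{M<..M'}. 1 / real m) + real (M' - M))" .
  moreover have "\<bar>\<Sum>m\<in>{M<..M'}. f m hi\<bar> \<le> e1 * real (M' - M) + e0" "\<bar>\<Sum>m\<in>{M<..M'}. f m lo\<bar> \<le> e1 * real (M' - M) + e0"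
    unfolding f_def using M by (intro box; simp)+
  ultimately have "\<bar>\<Sum>m\<in>{M<..M'}. f m (N div m)\<bar>
    \<le> e1 * real (M' - M) + e0 + \<beta> * (\<Delta> * real N * (\<Sum>m\<in>{M<..M'}. 1 / real m) + real (M' - M))"
    using upper lower by linarith
  then show ?thesis unfolding f_def .
qed

text \<open>Right ends of strips grow by about a factor 1 + \<Delta>, so i strips reach Y. The terms
  with e1 and \<beta> are additive over strips; only e0 is paid once per strip. The induction keeps
  the alternative that Y is reached or M + 1 \<ge> (1 + \<Delta>)^i.\<close>

lemma hyperbola_region_bound:
  fixes g :: "nat \<Rightarrow> real"
  assumes \<beta>: "\<beta> \<ge> 0" "\<And>l. g l \<ge> - \<beta>"
    and box: "\<And>M M' B. M \<le> M' \<Longrightarrow> \<bar>\<Sum>m\<in>{M<..M'}. \<Sum>n\<in>{1..B}. g (m * n)\<bar> \<le> e1 * real (M' - M) + e0"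
    and e: "e0 \<ge> 0" and \<Delta>: "\<Delta> > 0"
    and i: "(1 + \<Delta>) ^ i \<ge> real Y + 1"
  shows "\<bar>\<Sum>m\<in>{1..Y}. \<Sum>n\<in>{1..N div m}. g (m * n)\<bar>
    \<le> e1 * real Y + real i * e0 + \<beta> * (\<Delta> * real N * (\<Sum>m\<in>{1..Y}. 1 / real m) + real Y)"
proof -
  define \<Phi> where "\<Phi> M = (\<Sum>m\<in>{1..M}. \<Sum>n\<in>{1..N div m}. g (m * n))" for M
  define H where "H M = (\<Sum>m\<in>{1..M}. 1 / real m)" for M
  define R where "R i M = e1 * real M + real i * e0 + \<beta> * (\<Delta> * real N * H M + real M)" for i M
  have "\<exists>M\<le>Y. (M = Y \<or> real M + 1 \<ge> (1 + \<Delta>) ^ i) \<and> \<bar>\<Phi> M\<bar> \<le> R i M" for i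
  proof (induction i)
    case 0
    show ?case by (rule exI[of _ 0]) (simp add: \<Phi>_def R_def H_def)
  next
    case (Suc i)
    then obtain M where M: "M \<le> Y" "M = Y \<or> real M + 1 \<ge> (1 + \<Delta>) ^ i" "\<bar>\<Phi> M\<bar> \<le> R i M" by blast
    have RS: "R i M \<le> R (Suc i) M" for M using e by (simp add: R_def algebra_simps)
    show ?case
    proof (cases "M = Y")
      case True
      then show ?thesis using M RS[of M] by (intro exI[of _ M]) auto
    next
      case False
      \<comment> \<open>Scaling M + 1 instead of M ensures T \<ge> M + 1, so that a strip contains a
        new integer even while \<Delta> M < 1.\<close>
      define T where "T = nat \<lfloor>(1 + \<Delta>) * real (M + 1)\<rfloor>"
      define M' where "M' = min Y T"
      have ge: "(1 + \<Delta>) * real (M + 1) \<ge> real (M + 1)" using \<Delta> by (simp add: algebra_simps)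
      then have T: "real T \<le> (1 + \<Delta>) * real (M + 1)" "(1 + \<Delta>) * real (M + 1) < real T + 1" "T \<ge> M + 1"
        unfolding T_def by (auto simp: le_nat_floor)
      have M': "M < M'" "real M' \<le> (1 + \<Delta>) * real (M + 1)" "M' \<le> Y"
        using T M False by (auto simp: M'_def)
      have "M' = Y \<or> real M' + 1 \<ge> (1 + \<Delta>) ^ Suc i"
      proof (cases "T < Y")
        case True
        have "(1 + \<Delta>) ^ Suc i \<le> (1 + \<Delta>) * real (M + 1)"
          using M(2) False \<Delta> by (simp add: mult_left_mono add.commute)
        then show ?thesis using T(2) True by (simp add: M'_def)
      qed (simp add: M'_def)
      moreover have "\<bar>\<Phi> M'\<bar> \<le> R (Suc i) M'"
      proof -
        have un: "{1..M'} = {1..M} \<union> {M<..M'}" using M' by auto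
        have "\<Phi> M' = \<Phi> M + (\<Sum>m\<in>{M<..M'}. \<Sum>n\<in>{1..N div m}. g (m * n))"
          unfolding \<Phi>_def un by (rule sum.union_disjoint) auto
        moreover have "H M' = H M + (\<Sum>m\<in>{M<..M'}. 1 / real m)"
          unfolding H_def un by (rule sum.union_disjoint) auto
        moreover have "\<bar>\<Sum>m\<in>{M<..M'}. \<Sum>n\<in>{1..N div m}. g (m * n)\<bar>
          \<le> e1 * real (M' - M) + e0 + \<beta> * (\<Delta> * real N * (\<Sum>m\<in>{M<..M'}. 1 / real m) + real (M' - M))"
          using \<Delta> by (intro strip_bound \<beta> box M') auto
        moreover have "real (M' - M) = real M' - real M" using M' by simp
        ultimately show ?thesis using M(3) by (simp add: R_def algebra_simps)
      qed
      ultimately show ?thesis using M' by blast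
    qed
  qed
  then obtain M where "M \<le> Y" "M = Y \<or> real M + 1 \<ge> (1 + \<Delta>) ^ i" "\<bar>\<Phi> M\<bar> \<le> R i M" by blast
  moreover from this have "M = Y" using i by linarith
  ultimately show ?thesis unfolding \<Phi>_def R_def H_def by simp
qed

text \<open>Counts the strips: ln(1 + \<Delta>) \<ge> \<Delta> - \<Delta>^2 \<ge> \<Delta>/2 for
  \<Delta> \<le> 1/2.\<close>

lemma real_power_ge_exists:
  fixes \<Delta> z :: real
  assumes "0 < \<Delta>" "\<Delta> \<le> 1/2" "z \<ge> 1"
  obtains i where "(1 + \<Delta>) ^ i \<ge> z" "real i \<le> 2 * ln z / \<Delta> + 1"
proof
  define i where "i = nat \<lceil>ln z / ln (1 + \<Delta>)\<rceil>"
  have "\<Delta> / 2 \<le> \<Delta> - \<Delta>\<^sup>2" using assms mult_left_mono[of \<Delta> "1/2" \<Delta>] by (simp add: power2_eq_square)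
  also have "\<dots> \<le> ln (1 + \<Delta>)" using assms by (intro ln_one_plus_pos_lower_bound) auto
  finally have l: "\<Delta> / 2 \<le> ln (1 + \<Delta>)" .
  have lz: "ln z \<ge> 0" using assms by simp
  have l0: "ln (1 + \<Delta>) > 0" using assms by simp
  have "real i \<ge> ln z / ln (1 + \<Delta>)" unfolding i_def by linarith
  then have "ln z \<le> real i * ln (1 + \<Delta>)" using l0 by (simp add: field_simps)
  then have "ln z \<le> ln ((1 + \<Delta>) ^ i)" using assms by (simp add: ln_realpow)
  then show "(1 + \<Delta>) ^ i \<ge> z" using assms by (subst (asm) ln_le_cancel_iff) auto
  have "0 \<le> ln z / ln (1 + \<Delta>)" using lz l0 by simp
  then have "real i \<le> ln z / ln (1 + \<Delta>) + 1" unfolding i_def by linarith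
  also have "ln z / ln (1 + \<Delta>) \<le> ln z / (\<Delta> / 2)" using l lz l0 assms by (intro divide_left_mono) auto
  also have "ln z / (\<Delta> / 2) = 2 * ln z / \<Delta>" by simp
  finally show "real i \<le> 2 * ln z / \<Delta> + 1" by simp
qed

section \<open>Choice of parameters and conclusion\<close>

lemma box_sum_eq_disc:
  fixes M :: nat
  assumes "M \<le> M'"
  shows "(\<Sum>m\<in>{M<..M'}. \<Sum>n\<in>{1..B}. wt q a (int (m * n))) = disc q a (int M + 1) (M' - M) 1 B"
proof -
  have inner: "(\<Sum>n\<in>{1..B}. wt q a (int (m * n))) = (\<Sum>j<B. wt q a (int m * (1 + int j)))" for m
    by (rule sum.reindex_bij_witness[of _ Suc "\<lambda>n. n - 1"]) (auto simp: algebra_simps)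
  show ?thesis
    unfolding inner disc_def
    by (rule sum.reindex_bij_witness[of _ "\<lambda>i. M + 1 + i" "\<lambda>m. m - (M + 1)"]) (use assms in \<open>auto simp: algebra_simps\<close>)
qed

text \<open>Box errors come in powers of q and the target is a power of x; the exponent comparisons
  at the end use the lower bound for x in this form.\<close>

lemma powr_le_powr_transfer:
  fixes q x :: real
  assumes "q \<ge> 1" "q powr r \<le> x" "0 \<le> t" "s \<le> r * t"
  shows "q powr s \<le> x powr t"
proof -
  have "q powr s \<le> q powr (r * t)" using assms by (intro powr_mono) auto
  also have "\<dots> = (q powr r) powr t" by (simp add: powr_powr)
  also have "\<dots> \<le> x powr t" using assms by (intro powr_mono2) auto
  finally show ?thesis .
qed

theorem theorem1p1:
  fixes k :: nat
  assumes "k \<ge> 7"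
  shows "\<exists>\<eta>>0. \<exists>\<delta>>0. \<exists>C>0.
    \<forall>(p::nat) (q::nat) (a::int) (x::real).
      prime p \<longrightarrow> odd p \<longrightarrow> q = p ^ k \<longrightarrow> coprime a (int q) \<longrightarrow>
      x > real q powr (3 / 2 - \<eta>) \<longrightarrow>
      \<bar>(\<Sum>n | 0 < n \<and> real n \<le> x \<and> [int n = a] (mod (int q)). real (divisor_count n))
        - 1 / real (totient q) *
          (\<Sum>n | 0 < n \<and> real n \<le> x \<and> coprime n q. real (divisor_count n))\<bar>
      \<le> C * (x powr (1 - \<delta>) / real q)"
proof -
  obtain C \<epsilon> where C: "C > 0" and \<epsilon>: "\<epsilon> > 0" "\<epsilon> \<le> 1" and
    disc: "\<And>p a X A Y B. prime (p::nat) \<Longrightarrow> odd p \<Longrightarrow> \<not> int p dvd a \<Longrightarrow>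
     \<bar>disc (p ^ k) a X A Y B\<bar> \<le> C * (real A * real (p ^ k) powr (- (1/4) - \<epsilon>) + real (p ^ k) powr (1/2 - \<epsilon>))"
    using disc_bound[OF assms] by blast
  \<comment> \<open>These fractions of \<epsilon> give (3/2 - \<eta>)(1 - \<delta> - 2 \<kappa>)
    \<ge> 3/2 - \<epsilon> and (3/2 - \<eta>)(1/2 - \<delta>) \<ge> 3/4 - \<epsilon>, while \<delta>
    = \<kappa>/2 matches the error made along the hyperbola.\<close>
  define \<eta> where "\<eta> = \<epsilon> / 4"
  define \<kappa> where "\<kappa> = \<epsilon> / 8"
  define \<delta> where "\<delta> = \<epsilon> / 16"
  \<comment> \<open>The summands collect the fixed error per box, the error proportional to the
    length in m, and the two parts of the comparison error of density 1/phi(q).\<close>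
  define K where "K = C * (64 / \<kappa>) + 3 * C + 16 / \<kappa> + 4"
  have par: "\<eta> > 0" "\<kappa> > 0" "\<delta> > 0" "\<kappa> \<le> 1" using \<epsilon> by (auto simp: \<eta>_def \<kappa>_def \<delta>_def)
  have K: "K > 0" using C par by (simp add: K_def add_pos_pos)
  have "\<bar>(\<Sum>n | 0 < n \<and> real n \<le> x \<and> [int n = a] (mod (int q)). real (divisor_count n))
        - 1 / real (totient q) *
          (\<Sum>n | 0 < n \<and> real n \<le> x \<and> coprime n q. real (divisor_count n))\<bar>
      \<le> K * (x powr (1 - \<delta>) / real q)"
    if p: "prime p" "odd p" and q: "q = p ^ k" and a: "coprime a (int q)" and x: "x > real q powr (3 / 2 - \<eta>)"
    for p q :: nat and a :: int and x :: real
  proof -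
    have k0: "k > 0" using assms by simp
    have p3: "p \<ge> 3" using p prime_ge_2_nat[OF p(1)] by (cases "p = 2") auto
    have q1: "q \<ge> 1" using p3 by (simp add: q)
    have ap: "\<not> int p dvd a" using a coprime_prime_power_iff[OF p(1) k0] unfolding q by blast
    have "real q powr 0 \<le> real q powr (3 / 2 - \<eta>)" using q1 \<epsilon> by (intro powr_mono) (auto simp: \<eta>_def)
    then have x1: "x > 1" using x q1 by simp
    define N where "N = nat \<lfloor>x\<rfloor>"
    define Y where "Y = nat \<lfloor>sqrt (real N)\<rfloor>"
    have N: "real N \<le> x" "N \<ge> 1" "real n \<le> x \<longleftrightarrow> n \<le> N" for n
      using x1 by (auto simp: N_def le_nat_floor le_nat_iff le_floor_iff)
    have sqN: "sqrt (real N) \<ge> 1" using N by simp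
    then have "real Y = of_int \<lfloor>sqrt (real N)\<rfloor>" by (simp add: Y_def)
    then have Yle: "real Y \<le> sqrt (real N)" "sqrt (real N) < real Y + 1" by linarith+
    from sqN have Y1: "Y \<ge> 1" unfolding Y_def by (simp add: le_nat_iff)
    have "real Y * real Y \<le> sqrt (real N) * sqrt (real N)" using Yle by (intro mult_mono) auto
    then have YN: "Y * Y \<le> N" by (simp flip: of_nat_mult)
    have "sqrt (real N) * sqrt (real N) < (real Y + 1) * (real Y + 1)"
      using Yle by (intro mult_strict_mono') auto
    then have "real N < real (Suc Y * Suc Y)" by (simp add: algebra_simps)
    then have YN': "N < Suc Y * Suc Y" by (simp only: of_nat_less_iff)
    have "sqrt (real N) \<le> sqrt x" using N by simp
    then have "real Y \<le> sqrt x" using Yle by linarith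
    then have Yx: "real Y \<le> x powr (1/2)" using x1 by (simp add: powr_half_sqrt)
    define g where "g n = wt q a (int n)" for n
    define e0 where "e0 = C * real q powr (1/2 - \<epsilon>)"
    define e1 where "e1 = C * real q powr (- (1/4) - \<epsilon>)"
    define \<beta> where "\<beta> = 1 / real (totient q)"
    \<comment> \<open>Only the density term of the weight is negative, and phi(q) = q (1 - 1/p)
      \<ge> q/2.\<close>
    have \<beta>: "0 \<le> \<beta>" "\<beta> \<le> 2 / real q" "g n \<ge> - \<beta>" for n
    proof -
      have t: "totient q = p ^ (k - 1) * (p - 1)" unfolding q by (rule totient_prime_power[OF p(1) k0])
      have "q = p ^ (k - 1) * p" using k0 by (simp add: q power_eq_if)
      also have "\<dots> \<le> p ^ (k - 1) * (2 * (p - 1))" using p3 by (intro mult_left_mono) auto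
      also have "\<dots> = 2 * totient q" by (simp add: t)
      finally have "real q \<le> 2 * real (totient q)" by (metis of_nat_le_iff of_nat_mult of_nat_numeral)
      moreover have "totient q > 0" using q1 by simp
      ultimately show "\<beta> \<le> 2 / real q" using q1 by (simp add: \<beta>_def field_simps)
      show "0 \<le> \<beta>" "g n \<ge> - \<beta>" by (auto simp: \<beta>_def g_def wt_def intro: order_trans[of _ 0])
    qed
    have box: "\<bar>\<Sum>m\<in>{M<..M'}. \<Sum>n\<in>{1..B}. g (m * n)\<bar> \<le> e1 * real (M' - M) + e0" if "M \<le> M'" for M M' B
    proof -
      have "C * (real (M' - M) * real q powr (- (1/4) - \<epsilon>) + real q powr (1/2 - \<epsilon>)) = e1 * real (M' - M) + e0"
        by (simp add: e0_def e1_def algebra_simps)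
      then show ?thesis
        using disc[OF p ap, of "int M + 1" "M' - M" 1 B] unfolding g_def box_sum_eq_disc[OF that] q by simp
    qed
    have e: "e0 \<ge> 0" "e1 \<ge> 0" using C by (auto simp: e0_def e1_def)
    have lhs: "(\<Sum>n | 0 < n \<and> real n \<le> x \<and> [int n = a] (mod (int q)). real (divisor_count n))
        - 1 / real (totient q) * (\<Sum>n | 0 < n \<and> real n \<le> x \<and> coprime n q. real (divisor_count n))
      = (\<Sum>l\<in>{1..N}. real (card {d. d dvd l}) * g l)"
    proof -
      have s1: "{n. 0 < n \<and> real n \<le> x \<and> P n} = {n\<in>{1..N}. P n}" for P using N(3) by auto
      have flt: "(\<Sum>n\<in>{n\<in>{1..N}. P n}. h n) = (\<Sum>n\<in>{1..N}. if P n then h n else 0)" for P and h :: "nat \<Rightarrow> real"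
        by (rule sum.inter_filter) simp
      show ?thesis
        unfolding s1 flt sum_distrib_left sum_subtractf[symmetric]
        by (intro sum.cong refl) (simp add: g_def wt_def divisor_count_def right_diff_distrib)
    qed
    \<comment> \<open>Narrow strips save x^(-\<kappa>) in the comparison error \<beta> \<Delta> N,
      at the price of about x^\<kappa> log x strips, counted below as x^(2 \<kappa>).\<close>
    define \<Delta> where "\<Delta> = x powr (- \<kappa>) / 2"
    have "x powr (- \<kappa>) \<le> x powr 0" using x1 par by (intro powr_mono) auto
    then have \<Delta>: "\<Delta> > 0" "\<Delta> \<le> 1/2" using x1 by (auto simp: \<Delta>_def)
    obtain i where i: "(1 + \<Delta>) ^ i \<ge> real Y + 1" "real i \<le> 2 * ln (real Y + 1) / \<Delta> + 1"
      using real_power_ge_exists[OF \<Delta>, of "real Y + 1"] by auto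
    have lnx: "1 + ln x \<le> 4 / \<kappa> * x powr (\<kappa> / 2)" "1 + ln x \<le> 2 / \<kappa> * x powr \<kappa>"
      using one_plus_ln_le_powr[of x "\<kappa> / 2"] one_plus_ln_le_powr[of x \<kappa>] x1 par by auto
    have xmono: "x powr s \<le> x powr t" if "s \<le> t" for s t using that x1 by (intro powr_mono) auto
    have Yx1: "real Y \<le> x" using Yx xmono[of "1/2" 1] x1 by simp
    \<comment> \<open>The fixed error e0 occurs 2 i + 1 times: i strips, doubled by the symmetry of
      the hyperbola, and one square.\<close>
    have i2: "2 * real i + 1 \<le> 64 / \<kappa> * x powr (2 * \<kappa>)"
    proof -
      have "2 * x \<le> exp 1 * x"
        using x1 exp_ge_add_one_self[of 1] by (intro mult_right_mono) auto
      then have "real Y + 1 \<le> exp 1 * x" using Yx1 x1 by linarith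
      then have "ln (real Y + 1) \<le> ln (exp 1 * x)"
        using x1 by (subst ln_le_cancel_iff) auto
      also have "\<dots> = 1 + ln x" using x1 by (simp add: ln_mult)
      also have "\<dots> \<le> 2 / \<kappa> * x powr \<kappa>" by (rule lnx(2))
      finally have "2 * ln (real Y + 1) / \<Delta> \<le> 2 * (2 / \<kappa> * x powr \<kappa>) / \<Delta>"
        using \<Delta> by (intro divide_right_mono mult_left_mono) auto
      also have "\<dots> = 8 / \<kappa> * x powr (2 * \<kappa>)"
      proof -
        have "x powr (- \<kappa>) * x powr \<kappa> = 1" using x1 by (simp flip: powr_add)
        then have "1 / \<Delta> = 2 * x powr \<kappa>" using x1 by (simp add: \<Delta>_def field_simps)
        then have "2 * (2 / \<kappa> * x powr \<kappa>) / \<Delta> = 2 * (2 / \<kappa> * x powr \<kappa>) * (2 * x powr \<kappa>)"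
          by (metis divide_inverse inverse_eq_divide)
        also have "\<dots> = 8 / \<kappa> * (x powr \<kappa> * x powr \<kappa>)" by simp
        also have "x powr \<kappa> * x powr \<kappa> = x powr (2 * \<kappa>)" by (simp flip: powr_add)
        finally show ?thesis .
      qed
      finally have "2 * real i + 1 \<le> 16 / \<kappa> * x powr (2 * \<kappa>) + 3" using i by simp
      also have "3 \<le> 48 / \<kappa> * x powr (2 * \<kappa>)"
      proof -
        have "x powr 0 \<le> x powr (2 * \<kappa>)" using par by (intro xmono) auto
        then have "1 \<le> x powr (2 * \<kappa>)" using x1 by simp
        moreover have "3 \<le> 48 / \<kappa>" using par by (simp add: field_simps)
        ultimately show ?thesis using mult_mono[of 3 "48 / \<kappa>" 1 "x powr (2 * \<kappa>)"] par by simp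
      qed
      also have "16 / \<kappa> * x powr (2 * \<kappa>) + 48 / \<kappa> * x powr (2 * \<kappa>) = 64 / \<kappa> * x powr (2 * \<kappa>)"
        unfolding distrib_right[symmetric] add_divide_distrib[symmetric] by simp
      finally show ?thesis by simp
    qed
    have HY: "(\<Sum>m\<in>{1..Y}. 1 / real m) \<le> 4 / \<kappa> * x powr (\<kappa> / 2)"
    proof -
      have "(\<Sum>m\<in>{1..Y}. 1 / real m) \<le> 1 + ln (real Y)" using Y1 by (intro harm_le_one_plus_ln) simp
      also have "ln (real Y) \<le> ln x" using Yx1 Y1 x1 by (subst ln_le_cancel_iff) auto
      finally show ?thesis using lnx(1) by simp
    qed
    have "\<bar>\<Sum>l\<in>{1..N}. real (card {d. d dvd l}) * g l\<bar>
      \<le> 2 * \<bar>\<Sum>m\<in>{1..Y}. \<Sum>n\<in>{1..N div m}. g (m * n)\<bar> + \<bar>\<Sum>m\<in>{0<..Y}. \<Sum>n\<in>{1..Y}. g (m * n)\<bar>"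
    proof -
      have "{0<..Y} = {1..Y}" by auto
      then show ?thesis unfolding hyperbola[OF YN YN'] by (simp only: abs_le_iff) linarith
    qed
    also have "\<dots> \<le> 2 * (e1 * real Y + real i * e0 + \<beta> * (\<Delta> * real N * (\<Sum>m\<in>{1..Y}. 1 / real m) + real Y))
        + (e1 * real (Y - 0) + e0)"
      by (intro add_mono mult_left_mono hyperbola_region_bound \<beta> box e \<Delta> i) auto
    also have "\<dots> = (2 * real i + 1) * e0 + 3 * e1 * real Y + 2 * \<beta> * (\<Delta> * real N * (\<Sum>m\<in>{1..Y}. 1 / real m) + real Y)"
      by (simp add: algebra_simps)
    also have "\<dots> \<le> (64 / \<kappa> * x powr (2 * \<kappa>)) * e0 + 3 * e1 * x powr (1/2)
        + 2 * (2 / real q) * (x powr (- \<kappa>) * x * (4 / \<kappa> * x powr (\<kappa> / 2)) + x powr (1/2))"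
    proof (intro add_mono mult_mono mult_left_mono)
      show "\<Delta> \<le> x powr - \<kappa>" by (simp add: \<Delta>_def)
    qed (use i2 e Yx \<beta> N HY x1 \<Delta> par in \<open>auto intro!: sum_nonneg add_nonneg_nonneg mult_nonneg_nonneg\<close>)
    also have "\<dots> \<le> K * (x powr (1 - \<delta>) / real q)"
    proof -
      have xq: "real q powr (3/2 - \<eta>) \<le> x" using x by simp
      have rq: "real q \<ge> 1" using q1 by simp
      have ee: "\<epsilon> * \<epsilon> \<ge> 0" using \<epsilon> by simp
      \<comment> \<open>After multiplication by q the claim is x^(2 \<kappa>) q^(3/2 - \<epsilon>)
        \<le> x^(1 - \<delta>): the gain \<epsilon> is what lets x fall below q^(3/2).\<close>
      have T1: "x powr (2 * \<kappa>) * e0 \<le> C * (x powr (1 - \<delta>) / real q)"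
      proof -
        have "real q powr (3/2 - \<epsilon>) \<le> x powr (1 - \<delta> - 2 * \<kappa>)"
        proof (rule powr_le_powr_transfer[OF rq xq])
          show "3/2 - \<epsilon> \<le> (3/2 - \<eta>) * (1 - \<delta> - 2 * \<kappa>)"
            using \<epsilon> ee by (simp add: \<eta>_def \<delta>_def \<kappa>_def algebra_simps)
        qed (use \<epsilon> in \<open>simp add: \<delta>_def \<kappa>_def\<close>)
        then have "x powr (2 * \<kappa>) * real q powr (3/2 - \<epsilon>) \<le> x powr (2 * \<kappa>) * x powr (1 - \<delta> - 2 * \<kappa>)"
          by (intro mult_left_mono) auto
        also have "\<dots> = x powr (1 - \<delta>)" by (simp flip: powr_add)
        finally have "C * (x powr (2 * \<kappa>) * real q powr (3/2 - \<epsilon>) / real q) \<le> C * (x powr (1 - \<delta>) / real q)"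
          using C by (intro mult_left_mono divide_right_mono) auto
        moreover have "real q powr (3/2 - \<epsilon>) = real q powr (1/2 - \<epsilon>) * real q"
        proof -
          have "3/2 - \<epsilon> = (1/2 - \<epsilon>) + 1" by simp
          then show ?thesis using rq by (simp only: powr_add) simp
        qed
        ultimately show ?thesis using rq by (simp add: e0_def mult_ac)
      qed
      \<comment> \<open>At x = q^(3/2), without the gains, x^(1/2) q^(-1/4) and q^(1/2) both equal
        x/q, so the two error terms of a box balance exactly at the barrier.\<close>
      have T2: "e1 * x powr (1/2) \<le> C * (x powr (1 - \<delta>) / real q)"
      proof -
        have "real q powr (3/4 - \<epsilon>) \<le> x powr (1/2 - \<delta>)"
        proof (rule powr_le_powr_transfer[OF rq xq])
          show "3/4 - \<epsilon> \<le> (3/2 - \<eta>) * (1/2 - \<delta>)"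
            using \<epsilon> ee by (simp add: \<eta>_def \<delta>_def \<kappa>_def algebra_simps)
        qed (use \<epsilon> in \<open>simp add: \<delta>_def\<close>)
        then have "x powr (1/2) * real q powr (3/4 - \<epsilon>) \<le> x powr (1/2) * x powr (1/2 - \<delta>)"
          by (intro mult_left_mono) auto
        also have "\<dots> = x powr (1 - \<delta>)" by (simp flip: powr_add)
        finally have "C * (x powr (1/2) * real q powr (3/4 - \<epsilon>) / real q) \<le> C * (x powr (1 - \<delta>) / real q)"
          using C by (intro mult_left_mono divide_right_mono) auto
        moreover have "real q powr (3/4 - \<epsilon>) = real q powr (- (1/4) - \<epsilon>) * real q"
        proof -
          have "3/4 - \<epsilon> = (- (1/4) - \<epsilon>) + 1" by simp
          then show ?thesis using rq by (simp only: powr_add) simp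
        qed
        ultimately show ?thesis using rq by (simp add: e1_def mult_ac)
      qed
      have T3: "x powr (- \<kappa>) * x * x powr (\<kappa> / 2) = x powr (1 - \<delta>)"
      proof -
        have "x powr (- \<kappa>) * x powr 1 * x powr (\<kappa> / 2) = x powr (- \<kappa> + 1 + \<kappa> / 2)" by (simp only: powr_add)
        also have "- \<kappa> + 1 + \<kappa> / 2 = 1 - \<delta>" by (simp add: \<kappa>_def \<delta>_def)
        finally show ?thesis using x1 by simp
      qed
      have T4: "x powr (1/2) \<le> x powr (1 - \<delta>)" using \<epsilon> by (intro xmono) (simp add: \<delta>_def)
      have "(64 / \<kappa> * x powr (2 * \<kappa>)) * e0 = 64 / \<kappa> * (x powr (2 * \<kappa>) * e0)" by simp
      also have "\<dots> \<le> 64 / \<kappa> * (C * (x powr (1 - \<delta>) / real q))"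
        using T1 par by (intro mult_left_mono) auto
      finally have U1: "(64 / \<kappa> * x powr (2 * \<kappa>)) * e0 \<le> 64 / \<kappa> * (C * (x powr (1 - \<delta>) / real q))" .
      have "2 * (2 / real q) * (x powr (- \<kappa>) * x * (4 / \<kappa> * x powr (\<kappa> / 2)) + x powr (1/2))
        = 2 * (2 / real q) * (4 / \<kappa> * (x powr (- \<kappa>) * x * x powr (\<kappa> / 2)) + x powr (1/2))"
        by simp
      also have "\<dots> \<le> 2 * (2 / real q) * (4 / \<kappa> * x powr (1 - \<delta>) + x powr (1 - \<delta>))"
        unfolding T3 using T4 by (intro mult_left_mono add_left_mono) auto
      also have "\<dots> = (16 / \<kappa> + 4) * (x powr (1 - \<delta>) / real q)"
        using rq par by (simp add: field_simps)
      finally have U2: "2 * (2 / real q) * (x powr (- \<kappa>) * x * (4 / \<kappa> * x powr (\<kappa> / 2)) + x powr (1/2))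
        \<le> (16 / \<kappa> + 4) * (x powr (1 - \<delta>) / real q)" .
      have "3 * e1 * x powr (1/2) \<le> 3 * (C * (x powr (1 - \<delta>) / real q))" using T2 by simp
      note add_mono[OF add_mono[OF U1 this] U2]
      also have "64 / \<kappa> * (C * (x powr (1 - \<delta>) / real q)) + 3 * (C * (x powr (1 - \<delta>) / real q)) + (16 / \<kappa> + 4) * (x powr (1 - \<delta>) / real q)
        = K * (x powr (1 - \<delta>) / real q)"
      proof -
        have "u * (C * z) + 3 * (C * z) + (v + 4) * z = (C * u + 3 * C + v + 4) * z" for u v z :: real
          by (simp add: algebra_simps)
        then show ?thesis unfolding K_def .
      qed
      finally show ?thesis .
    qed
    finally show ?thesis unfolding lhs .
  qed
  then show ?thesis using K par by (intro exI[of _ \<eta>] exI[of _ \<delta>] exI[of _ K] conjI allI impI) (assumption | simp)+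
qed

end
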